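(* Let $\lambda\in\{0,1,2,\dots\}$ and let $d_1,d_2,d_3>0$ and $C>0$ be real numbers. Then there are only finitely many natural numbers $k\ge 2$ for which there exist positive integers $\alpha,\beta,\gamma,\iota$ with $|\alpha-\lambda k|\le C k^{1-d_1}$, $\iota\le Ck^{1-d_2}$, $\beta\le C k\log^{d_3}k$, such that $k$ is a $P(\alpha,\beta,\gamma,\iota)$-integer.
   Context: For positive integers $\alpha,\beta,\gamma,\iota$ and a natural number $k$, let $M$ be the set of prime numbers $p$ with $\alpha\le p\le\beta$. Then $k$ is called a $P(\alpha,\beta,\gamma,\iota)$-integer if for every residue class $r$ modulo $k$ with $\gcd(r,k)=1$, at least $\gamma$ primes $p\in M$ satisfy $p\equiv r\pmod k$, and $|M|=\gamma\varphi(k)+\iota$, where $\varphi$ is Euler's totient function. *)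

theory Defs
  imports Complex_Main "HOL-Number_Theory.Number_Theory"
begin

definition primes_between :: "nat \<Rightarrow> nat \<Rightarrow> nat set" where
  "primes_between \<alpha> \<beta> = {p. prime p \<and> \<alpha> \<le> p \<and> p \<le> \<beta>}"

text \<open>Residue classes modulo \<open>k\<close> are given by arbitrary natural representatives \<open>r\<close>.\<close>

definition P_integer :: "nat \<Rightarrow> nat \<Rightarrow> nat \<Rightarrow> nat \<Rightarrow> nat \<Rightarrow> bool" where
  "P_integer \<alpha> \<beta> \<gamma> \<iota> k \<longleftrightarrow>
     (\<forall>r. coprime r k \<longrightarrow> \<gamma> \<le> card {p \<in> primes_between \<alpha> \<beta>. [p = r] (mod k)}) \<and>
     card (primes_between \<alpha> \<beta>) = \<gamma> * totient k + \<iota>"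

end

theory Submission
  imports Defs "HOL-Complex_Analysis.Complex_Analysis" "HOL-Probability.Probability"
    "HOL-Real_Asymp.Real_Asymp" "HOL-Number_Theory.Prime_Powers"
begin

text \<open>
  If \<open>k\<close> is a \<open>P(\<alpha>, \<beta>, \<gamma>, \<iota>)\<close>-integer, then by the symmetry \<open>r \<mapsto> k - r\<close> of the reduced residue
  classes the primes of \<open>[\<alpha>, \<beta>]\<close> with residue in \<open>[1, k/2]\<close> exceed those with residue in
  \<open>(k/2, k]\<close> by at most \<open>\<iota> = O(k\<^sup>1\<^sup>-\<^sup>d)\<close>. But the density \<open>1 / log x\<close> of
  the primes decreases, so every block \<open>(j k, (j + 1) k]\<close> favours its first half, the block
  \<open>j = \<lambda>\<close> by an amount of order \<open>k / log\<^sup>2 k\<close>. Since there are only \<open>O(log\<^sup>d k)\<close> blocks, a prime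
  number theorem with error \<open>O(x / log\<^sup>A x)\<close> for all \<open>A\<close> makes this a contradiction. If \<open>[\<alpha>, \<beta>]\<close> does
  not contain the whole block \<open>j = \<lambda>\<close>, then the class of a suitable square \<open>q\<^sup>2\<close> of a prime in that
  block contains no prime of \<open>[\<alpha>, \<beta>]\<close> at all.

  For the prime number theorem, the inequality \<open>3 + 4 cos \<theta> + cos 2\<theta> \<ge> 0\<close> bounds \<open>\<zeta>'/\<zeta> + \<zeta>\<close> in a
  neighbourhood of the line \<open>Re s = 1\<close> of width \<open>c / log\<^sup>9 |t|\<close>. By Cauchy's inequalities its \<open>k\<close>-th
  derivative, the Dirichlet series of \<open>\<plusminus>(1 - \<Lambda>(n)) log\<^sup>k n\<close>, is \<open>O(log\<^sup>9\<^sup>k\<^sup>+\<^sup>9 |t|)\<close> for \<open>Re s > 1\<close>, and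
  integrating it against \<open>x\<^sup>s / s\<^sup>2\<close> and letting \<open>Re s\<close> tend to \<open>1\<close> gives
  \<open>\<Sum>\<^sub>n\<^sub>\<le>\<^sub>x (\<Lambda>(n) - 1) log\<^sup>k n log(x/n) = O(x)\<close>. Removing the weights gains a factor \<open>log\<^sup>k\<^sup>/\<^sup>2 x\<close>.
\<close>

section \<open>Dirichlet series\<close>

text \<open>The distribution of primes in individual progressions never enters: the defining
  property is turned into a count over all residues of one half, so only primes in intervals of
  length about k / 2 matter. What has to be beaten is the gain k / log^2 k of a single block. The
  errors of O(log^d3 k) blocks at height O(k log^d3 k) add up to k log^(2 d3 - A) k, hence the
  demand for a saving of every fixed power A. Adding \<zeta> to \<zeta>'/\<zeta> cancels the pole at
  s = 1, so no main term has to be extracted. No contour is moved to the left of Re s = 1: the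
  derivatives are bounded by powers of log |t| up to that line, and x^s then contributes exactly x.
  The saving comes from the factor log^j n produced by j differentiations: the weighted sum has
  natural size x log^j x, while removing the smoothing with a logarithmic step h costs x / h + h x
  log^j x, which is least for h = log^(-j/2) x.\<close>

definition dirichlet_admissible :: "(nat \<Rightarrow> real) \<Rightarrow> bool" where
  "dirichlet_admissible a \<longleftrightarrow> (\<forall>\<sigma>>1. summable (\<lambda>n. \<bar>a n\<bar> * real n powr (- \<sigma>)))"

text \<open>The term \<open>n = 0\<close> vanishes because \<open>0 powr z = 0\<close>.\<close>

definition dirichlet_series :: "(nat \<Rightarrow> real) \<Rightarrow> complex \<Rightarrow> complex" where
  "dirichlet_series a s = (\<Sum>n. of_real (a n) * of_nat n powr (- s))"

lemma norm_of_nat_powr: "norm (of_nat n powr (s::complex)) = real n powr Re s"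
  by (cases "n = 0") (simp_all add: norm_powr_real_powr)

lemma ln_le_powr:
  assumes "n > 0" "\<epsilon> > 0"
  shows "ln (real n) \<le> real n powr \<epsilon> / \<epsilon>"
proof -
  have "\<epsilon> * ln (real n) = ln (real n powr \<epsilon>)"
    using assms by (simp add: ln_powr)
  also have "\<dots> \<le> real n powr \<epsilon> - 1"
    using assms by (intro ln_le_minus_one) simp
  finally show ?thesis using assms by (simp add: field_simps)
qed

lemma dirichlet_admissible_bound:
  assumes "dirichlet_admissible b" "\<And>n. n > 0 \<Longrightarrow> \<bar>a n\<bar> \<le> \<bar>b n\<bar>"
  shows "dirichlet_admissible a"
  unfolding dirichlet_admissible_def
proof safe
  fix \<sigma> :: real assume "\<sigma> > 1"
  then have "summable (\<lambda>n. \<bar>b n\<bar> * real n powr (- \<sigma>))"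
    using assms(1) by (simp add: dirichlet_admissible_def)
  then show "summable (\<lambda>n. \<bar>a n\<bar> * real n powr (- \<sigma>))"
  proof (rule summable_comparison_test'[where N = 0])
    fix n show "norm (\<bar>a n\<bar> * real n powr (- \<sigma>)) \<le> \<bar>b n\<bar> * real n powr (- \<sigma>)"
      using assms(2)[of n] by (cases "n = 0") (auto intro: mult_right_mono)
  qed
qed

lemma dirichlet_admissible_one: "dirichlet_admissible (\<lambda>_. 1)"
  by (simp add: dirichlet_admissible_def summable_real_powr_iff)

lemma dirichlet_admissible_ln:
  assumes "dirichlet_admissible a"
  shows "dirichlet_admissible (\<lambda>n. a n * ln n)"
  unfolding dirichlet_admissible_def
proof safe
  fix \<sigma> :: real assume s: "\<sigma> > 1"
  \<comment> \<open>Half of the distance to the line Re s = 1 is spent on the logarithm; the other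
    half keeps the series convergent.\<close>
  define \<epsilon> where "\<epsilon> = (\<sigma> - 1) / 2"
  have e: "\<epsilon> > 0" "\<sigma> - \<epsilon> > 1" using s by (auto simp: \<epsilon>_def field_simps)
  have "summable (\<lambda>n. \<bar>a n\<bar> * real n powr (- (\<sigma> - \<epsilon>)))"
    using assms e by (simp only: dirichlet_admissible_def)
  then have "summable (\<lambda>n. (\<bar>a n\<bar> * real n powr (- (\<sigma> - \<epsilon>))) * (1 / \<epsilon>))"
    by (rule summable_mult2)
  then show "summable (\<lambda>n. \<bar>a n * ln (real n)\<bar> * real n powr (- \<sigma>))"
  proof (rule summable_comparison_test'[where N = 0])
    fix n show "norm (\<bar>a n * ln (real n)\<bar> * real n powr (- \<sigma>)) \<le> (\<bar>a n\<bar> * real n powr (- (\<sigma> - \<epsilon>))) * (1 / \<epsilon>)"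
    proof (cases "n = 0")
      case False
      have "ln (real n) * real n powr (- \<sigma>) \<le> (real n powr \<epsilon> / \<epsilon>) * real n powr (- \<sigma>)"
        using ln_le_powr[of n \<epsilon>] e False by (intro mult_right_mono) auto
      also have "\<dots> = real n powr (- (\<sigma> - \<epsilon>)) * (1 / \<epsilon>)"
        by (simp add: powr_add[symmetric] field_simps)
      finally have "\<bar>a n\<bar> * (ln (real n) * real n powr (- \<sigma>)) \<le> \<bar>a n\<bar> * (real n powr (- (\<sigma> - \<epsilon>)) * (1 / \<epsilon>))"
        by (intro mult_left_mono) auto
      then show ?thesis using False by (simp add: abs_mult mult_ac)
    qed auto
  qed
qed

lemma dirichlet_admissible_ln_power:
  assumes "dirichlet_admissible a"
  shows "dirichlet_admissible (\<lambda>n. a n * ln n ^ k)"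
proof (induction k)
  case (Suc k)
  then show ?case using dirichlet_admissible_ln[OF Suc] by (simp add: mult_ac)
qed (use assms in simp)

lemma dirichlet_admissible_minus:
  "dirichlet_admissible a \<Longrightarrow> dirichlet_admissible (\<lambda>n. - a n)"
  by (simp add: dirichlet_admissible_def)

lemma dirichlet_admissible_diff:
  assumes "dirichlet_admissible a" "dirichlet_admissible b"
  shows "dirichlet_admissible (\<lambda>n. a n - b n)"
  unfolding dirichlet_admissible_def
proof safe
  fix \<sigma> :: real assume "\<sigma> > 1"
  then have "summable (\<lambda>n. \<bar>a n\<bar> * real n powr (- \<sigma>) + \<bar>b n\<bar> * real n powr (- \<sigma>))"
    using assms by (intro summable_add) (simp_all add: dirichlet_admissible_def)
  then show "summable (\<lambda>n. \<bar>a n - b n\<bar> * real n powr (- \<sigma>))"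
  proof (rule summable_comparison_test'[where N = 0])
    fix n
    have "\<bar>a n - b n\<bar> * real n powr (- \<sigma>) \<le> (\<bar>a n\<bar> + \<bar>b n\<bar>) * real n powr (- \<sigma>)"
      by (intro mult_right_mono) auto
    then show "norm (\<bar>a n - b n\<bar> * real n powr (- \<sigma>)) \<le> \<bar>a n\<bar> * real n powr (- \<sigma>) + \<bar>b n\<bar> * real n powr (- \<sigma>)"
      by (simp add: ring_distribs)
  qed
qed

lemma dirichlet_series_summable_norm:
  assumes "dirichlet_admissible a" "Re s > 1"
  shows "summable (\<lambda>n. norm (of_real (a n) * of_nat n powr (- s)))"
  using assms by (simp add: dirichlet_admissible_def norm_mult norm_of_nat_powr)

lemma dirichlet_series_sums:
  assumes "dirichlet_admissible a" "Re s > 1"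
  shows "(\<lambda>n. of_real (a n) * of_nat n powr (- s)) sums dirichlet_series a s"
  unfolding dirichlet_series_def
  by (rule summable_sums) (rule summable_norm_cancel[OF dirichlet_series_summable_norm[OF assms]])

lemma dirichlet_series_has_sum:
  assumes "dirichlet_admissible a" "Re s > 1"
  shows "((\<lambda>n. of_real (a n) * of_nat n powr (- s)) has_sum dirichlet_series a s) UNIV"
  by (rule norm_summable_imp_has_sum[OF dirichlet_series_summable_norm[OF assms] dirichlet_series_sums[OF assms]])

lemma dirichlet_series_minus:
  assumes "dirichlet_admissible a" "Re s > 1"
  shows "dirichlet_series (\<lambda>n. - a n) s = - dirichlet_series a s"
  using sums_minus[OF dirichlet_series_sums[OF assms]] 
  by (simp add: sums_iff dirichlet_series_def)

lemma dirichlet_series_diff: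
  assumes "dirichlet_admissible a" "dirichlet_admissible b" "Re s > 1"
  shows "dirichlet_series (\<lambda>n. a n - b n) s = dirichlet_series a s - dirichlet_series b s"
  using sums_diff[OF dirichlet_series_sums[OF assms(1,3)] dirichlet_series_sums[OF assms(2,3)]] 
  by (simp add: sums_iff dirichlet_series_def ring_distribs)

lemma open_Re_gt: "open {s::complex. Re s > c}"
  by (rule open_halfspace_Re_gt)

lemma has_field_derivative_nat_powr_minus:
  assumes "n > 0"
  shows "((\<lambda>z::complex. of_nat n powr (- z)) has_field_derivative - of_real (ln (real n)) * of_nat n powr (- z)) (at z)"
proof -
  have "((\<lambda>z::complex. of_nat n powr (- z)) has_field_derivative (Ln (of_nat n) * of_nat n powr (- z)) * (- 1)) (at z)"
    by (rule DERIV_chain2[OF has_field_derivative_powr_right]) (use assms in \<open>auto intro!: derivative_eq_intros\<close>)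
  then show ?thesis using assms by (simp add: Ln_of_nat)
qed

lemma dirichlet_series_has_field_derivative:
  assumes a: "dirichlet_admissible a" and s: "Re s > 1"
  shows "(dirichlet_series a has_field_derivative dirichlet_series (\<lambda>n. - (a n * ln n)) s) (at s)"
proof -
  define f where "f n z = of_real (a n) * of_nat n powr (- z)" for n and z :: complex
  define f' where "f' n z = of_real (- (a n * ln n)) * of_nat n powr (- z)" for n and z :: complex
  have a': "dirichlet_admissible (\<lambda>n. - (a n * ln n))"
    by (intro dirichlet_admissible_minus dirichlet_admissible_ln a)
  have "\<exists>g g'. \<forall>x\<in>{z. Re z > 1}. ((\<lambda>n. f n x) sums g x) \<and> ((\<lambda>n. f' n x) sums g' x) \<and> (g has_field_derivative g' x) (at x)"
  proof (rule series_and_derivative_comparison_complex[OF open_Re_gt])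
    fix n and z :: complex
    show "(f n has_field_derivative f' n z) (at z)"
    proof (cases "n = 0")
      case False
      then show ?thesis unfolding f_def f'_def
        using DERIV_cmult[OF has_field_derivative_nat_powr_minus[of n z], of "of_real (a n)"]
        by (simp add: mult_ac)
    qed (simp add: f_def[abs_def] f'_def)
  next
    fix z :: complex assume "z \<in> {z. Re z > 1}"
    then have z: "Re z > 1" by simp
    \<comment> \<open>On the disc of this radius each term is at most its modulus at the real point
      Re z - d > 1, which supplies the summable majorant for termwise differentiation.\<close>
    define d where "d = (Re z - 1) / 2"
    have d: "d > 0" "Re z - d > 1" using z by (auto simp: d_def field_simps)
    define h :: "nat \<Rightarrow> complex" where "h n = of_real (\<bar>a n\<bar> * real n powr (- (Re z - d)))" for n
    have "summable h" unfolding h_def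
      by (intro summable_of_real) (use a d in \<open>simp only: dirichlet_admissible_def\<close>)
    moreover have "range h \<subseteq> \<real>\<^sub>\<ge>\<^sub>0" by (auto simp: h_def)
    moreover have "cmod (f n y) \<le> cmod (h n)" if y: "y \<in> ball z d \<inter> {z. Re z > 1}" for n y
    proof (cases "n = 0")
      case False
      have "\<bar>Re z - Re y\<bar> \<le> norm (z - y)" by (metis abs_Re_le_cmod minus_complex.simps(1))
      also have "\<dots> < d" using y by (auto simp: dist_norm)
      finally have "Re z - d \<le> Re y" by linarith
      then have "real n powr (- Re y) \<le> real n powr (- (Re z - d))"
        using False by (intro powr_mono) auto
      then have "\<bar>a n\<bar> * real n powr (- Re y) \<le> \<bar>a n\<bar> * real n powr (- (Re z - d))"
        by (intro mult_left_mono) auto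
      then show ?thesis by (simp add: f_def h_def norm_mult norm_of_nat_powr)
    qed (simp add: f_def)
    ultimately show "\<exists>d h. 0 < d \<and> summable h \<and> range h \<subseteq> \<real>\<^sub>\<ge>\<^sub>0 \<and>
      (\<forall>\<^sub>F n in sequentially. \<forall>y\<in>ball z d \<inter> {z. 1 < Re z}. cmod (f n y) \<le> cmod (h n))"
      using d by (intro exI[of _ d] exI[of _ h] conjI always_eventually allI ballI) auto
  qed
  then obtain g g' where g: "\<And>x. Re x > 1 \<Longrightarrow> (\<lambda>n. f n x) sums g x"
    "\<And>x. Re x > 1 \<Longrightarrow> (\<lambda>n. f' n x) sums g' x"
    "\<And>x. Re x > 1 \<Longrightarrow> (g has_field_derivative g' x) (at x)" by auto
  have eq: "g x = dirichlet_series a x" if "Re x > 1" for x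
    using sums_unique2[OF g(1)[OF that] dirichlet_series_sums[OF a that, folded f_def]] .
  have eq': "g' s = dirichlet_series (\<lambda>n. - (a n * ln n)) s"
    using sums_unique2[OF g(2)[OF s] dirichlet_series_sums[OF a' s, folded f'_def]] .
  show ?thesis
    using has_field_derivative_transform_within_open[OF g(3)[OF s] open_Re_gt[of 1]] s eq eq' by simp
qed

lemma dirichlet_series_holomorphic:
  assumes "dirichlet_admissible a"
  shows "dirichlet_series a holomorphic_on {s. Re s > 1}"
  using dirichlet_series_has_field_derivative[OF assms] open_Re_gt
  by (auto simp: holomorphic_on_open)

lemma dirichlet_series_higher_deriv:
  assumes a: "dirichlet_admissible a" and s: "Re s > 1"
  shows "(deriv ^^ k) (dirichlet_series a) s = (- 1) ^ k * dirichlet_series (\<lambda>n. a n * ln n ^ k) s"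
  using s
proof (induction k arbitrary: s)
  case (Suc k)
  define b where "b = (\<lambda>n. a n * ln (real n) ^ k)"
  have b: "dirichlet_admissible b" unfolding b_def by (rule dirichlet_admissible_ln_power[OF a])
  have "((\<lambda>z. (- 1) ^ k * dirichlet_series b z) has_field_derivative
          (- 1) ^ k * dirichlet_series (\<lambda>n. - (b n * ln n)) s) (at s)"
    by (intro DERIV_cmult dirichlet_series_has_field_derivative b Suc.prems)
  then have "((deriv ^^ k) (dirichlet_series a) has_field_derivative
          (- 1) ^ k * dirichlet_series (\<lambda>n. - (b n * ln n)) s) (at s)"
    by (rule has_field_derivative_transform_within_open[OF _ open_Re_gt[of 1]])
       (use Suc in \<open>auto simp: b_def\<close>)
  then have "(deriv ^^ Suc k) (dirichlet_series a) s = (- 1) ^ k * dirichlet_series (\<lambda>n. - (b n * ln n)) s"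
    by (simp add: DERIV_imp_deriv)
  also have "dirichlet_series (\<lambda>n. - (b n * ln n)) s = - dirichlet_series (\<lambda>n. b n * ln n) s"
    by (intro dirichlet_series_minus dirichlet_admissible_ln b Suc.prems)
  finally show ?case by (simp add: b_def mult_ac)
qed simp

text \<open>Absolute convergence makes the double series summable, and grouping the pairs by their
  product gives the convolution. The identity for \<open>c\<close> is demanded only for n > 0, since
  every number divides 0.\<close>

lemma dirichlet_series_mult:
  assumes a: "dirichlet_admissible a" and b: "dirichlet_admissible b"
    and c: "dirichlet_admissible c" "\<And>n. n > 0 \<Longrightarrow> c n = (\<Sum>d | d dvd n. a d * b (n div d))"
    and s: "Re s > 1"
  shows "dirichlet_series a s * dirichlet_series b s = dirichlet_series c s"
proof -
  define f where "f n = of_real (a n) * of_nat n powr (- s)" for n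
  define g where "g n = of_real (b n) * of_nat n powr (- s)" for n
  have f: "(\<lambda>n. norm (f n)) summable_on UNIV" and f1: "(f has_sum dirichlet_series a s) UNIV"
    using dirichlet_series_summable_norm[OF a s] dirichlet_series_has_sum[OF a s]
    by (auto simp: f_def[abs_def] intro!: norm_summable_imp_summable_on)
  have g: "(\<lambda>n. norm (g n)) summable_on UNIV" and g1: "(g has_sum dirichlet_series b s) UNIV"
    using dirichlet_series_summable_norm[OF b s] dirichlet_series_has_sum[OF b s]
    by (auto simp: g_def[abs_def] intro!: norm_summable_imp_summable_on)
  have fg: "(\<lambda>x. norm (case x of (m, n) \<Rightarrow> f m * g n)) summable_on UNIV \<times> UNIV"
    unfolding Infinite_Sum.abs_summable_on_Sigma_iff
  proof (intro conjI ballI)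
    fix x show "(\<lambda>y. norm (case (x, y) of (m, n) \<Rightarrow> f m * g n)) summable_on UNIV"
      using g by (simp add: norm_mult summable_on_cmult_right)
  next
    show "(\<lambda>x. norm (\<Sum>\<^sub>\<infinity>y. norm (case (x, y) of (m, n) \<Rightarrow> f m * g n))) summable_on UNIV"
      using summable_on_cmult_left[OF f, of "infsum (\<lambda>n. norm (g n)) UNIV"] g
      by (simp add: norm_mult infsum_cmult_right' abs_mult infsum_nonneg)
  qed
  then have "(\<lambda>(m, n). f m * g n) summable_on UNIV \<times> UNIV"
    by (rule Infinite_Sum.abs_summable_summable)
  then obtain S where S: "((\<lambda>(m, n). f m * g n) has_sum S) (UNIV \<times> UNIV)"
    by (auto simp: summable_on_def)
  have "((\<lambda>m. f m * dirichlet_series b s) has_sum S) UNIV"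
    by (rule has_sum_SigmaD[OF S]) (use has_sum_cmult_right[OF g1] in auto)
  moreover have "((\<lambda>m. f m * dirichlet_series b s) has_sum dirichlet_series a s * dirichlet_series b s) UNIV"
    by (rule has_sum_cmult_left[OF f1])
  ultimately have S_eq: "S = dirichlet_series a s * dirichlet_series b s"
    by (rule has_sum_unique)
  \<comment> \<open>The index 0 is removed before the pairs are grouped: both factors vanish there,
    whereas the fibre over the product 0 would be infinite.\<close>
  have "((\<lambda>(m, n). f m * g n) has_sum S) ({0<..} \<times> {0<..})"
    by (rule has_sum_cong_neutral[THEN iffD1, OF _ _ _ S]) (auto simp: f_def g_def)
  also have "?this \<longleftrightarrow> ((\<lambda>(n, d). f d * g (n div d)) has_sum S) (SIGMA n:{0<..}. {d. d dvd n})"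
    by (rule has_sum_reindex_bij_witness[of _ "\<lambda>(n, d). (d, n div d)" "\<lambda>(m, n). (m * n, m)"])
       (auto simp: dvd_div_eq_0_iff elim!: dvdE)
  finally have "((\<lambda>n. \<Sum>d | d dvd n. f d * g (n div d)) has_sum S) {0<..}"
    by (rule has_sum_SigmaD) (auto intro!: has_sum_finite)
  also have "?this \<longleftrightarrow> ((\<lambda>n. of_real (c n) * of_nat n powr (- s)) has_sum S) UNIV"
  proof (rule has_sum_cong_neutral)
    fix n :: nat assume "n \<in> {0<..} \<inter> UNIV"
    then have n: "n > 0" by simp
    have "f d * g (n div d) = of_real (a d * b (n div d)) * of_nat n powr (- s)" if d: "d dvd n" for d
    proof -
      from d obtain e where e: "n = d * e" by (auto simp: dvd_def)
      then show ?thesis using n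
        by (simp add: f_def g_def powr_times_real mult_ac)
    qed
    then have "(\<Sum>d | d dvd n. f d * g (n div d)) = (\<Sum>d | d dvd n. of_real (a d * b (n div d)) * of_nat n powr (- s))"
      by (intro sum.cong) auto
    also have "\<dots> = of_real (c n) * of_nat n powr (- s)"
      using c(2)[OF n] by (simp add: sum_distrib_right)
    finally show "(\<Sum>d | d dvd n. f d * g (n div d)) = of_real (c n) * of_nat n powr (- s)" .
  qed auto
  finally have "((\<lambda>n. of_real (c n) * of_nat n powr (- s)) has_sum S) UNIV" .
  with dirichlet_series_has_sum[OF c(1) s] have "S = dirichlet_series c s" by (rule has_sum_unique[symmetric])
  with S_eq show ?thesis by simp
qed

section \<open>Analytic continuation of the zeta function\<close>

text \<open>Equal to (s - 1) times the integral of n^(-s) - x^(-s) over x from n to n + 1. Each term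
  is thus O(n^(-Re s - 1)) for fixed s, which gives convergence for Re s > 0; the factor s - 1
  removes the pole.\<close>

definition zeta_term :: "nat \<Rightarrow> complex \<Rightarrow> complex" where
  "zeta_term n s = (s - 1) * of_nat n powr (- s) + (of_nat (Suc n) powr (1 - s) - of_nat n powr (1 - s))"

text \<open>\<open>zeta_cont s = (s - 1) \<zeta>(s)\<close> for \<open>Re s > 0\<close>.\<close>

definition zeta_cont :: "complex \<Rightarrow> complex" where
  "zeta_cont s = 1 + (\<Sum>n. zeta_term (Suc n) s)"

text \<open>The mean value inequality is applied twice on the segment from n to n + 1: to x^(-s),
  which bounds n^(-s) - x^(-s), and to \<open>\<phi>\<close>, whose derivative is s - 1 times this
  difference and whose increment is the term.\<close>

lemma norm_zeta_term_le:
  assumes n: "n > 0" and s: "Re s > 0"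
  shows "norm (zeta_term n s) \<le> norm s * norm (s - 1) * real n powr (- Re s - 1)"
proof -
  define S where "S = complex_of_real ` {real n..real n + 1}"
  have cS: "convex S" unfolding S_def
    by (intro convex_linear_image) (auto simp: bounded_linear.linear bounded_linear_of_real)
  have mem: "of_nat n \<in> S" "of_nat (Suc n) \<in> S"
    using imageI[of "real n" "{real n..real n + 1}" complex_of_real]
      imageI[of "real (Suc n)" "{real n..real n + 1}" complex_of_real] by (simp_all add: S_def)
  have der: "((\<lambda>z. z powr w) has_field_derivative (w * z powr (w - 1))) (at z within S)" if "z \<in> S" for z w
  proof (rule has_field_derivative_at_within[OF has_field_derivative_powr])
    from that obtain x where "z = of_real x" "x \<ge> real n" by (auto simp: S_def)
    with n show "z \<notin> \<real>\<^sub>\<le>\<^sub>0" by simp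
  qed
  have le1: "norm (of_nat n powr (- s) - z powr (- s)) \<le> norm s * real n powr (- Re s - 1)" if z: "z \<in> S" for z
  proof -
    have "norm (of_nat n powr (- s) - z powr (- s)) \<le> (norm s * real n powr (- Re s - 1)) * norm (of_nat n - z)"
    proof (rule field_differentiable_bound[OF cS der])
      fix u assume "u \<in> S"
      then obtain x where x: "u = of_real x" "x \<ge> real n" by (auto simp: S_def)
      have "norm (u powr (- s - 1)) = x powr (- Re s - 1)"
        using x n by (simp add: norm_powr_real_powr)
      also have "\<dots> \<le> real n powr (- Re s - 1)"
        using x n s by (intro powr_mono2') auto
      finally show "norm (- s * u powr (- s - 1)) \<le> norm s * real n powr (- Re s - 1)"
        by (auto simp: norm_mult intro: mult_left_mono)
    qed (use mem z in auto)
    also have "\<dots> \<le> (norm s * real n powr (- Re s - 1)) * 1"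
    proof (intro mult_left_mono)
      from z obtain x where x: "z = of_real x" "x \<ge> real n" "x \<le> real n + 1" by (auto simp: S_def)
      have "norm (of_nat n - z) = \<bar>real n - x\<bar>"
        unfolding x(1) by (metis norm_of_real of_real_diff of_real_of_nat_eq)
      then show "norm (of_nat n - z) \<le> 1" using x by simp
    qed auto
    finally show ?thesis by simp
  qed
  define \<phi> where "\<phi> z = (s - 1) * of_nat n powr (- s) * z + z powr (1 - s)" for z
  have "norm (\<phi> (of_nat (Suc n)) - \<phi> (of_nat n)) \<le> (norm s * norm (s - 1) * real n powr (- Re s - 1)) * norm (of_nat (Suc n) - of_nat n :: complex)"
  proof (rule field_differentiable_bound[OF cS])
    fix z assume z: "z \<in> S"
    have "(\<phi> has_field_derivative (s - 1) * of_nat n powr (- s) * 1 + (1 - s) * z powr (1 - s - 1)) (at z within S)"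
      unfolding \<phi>_def by (intro DERIV_add DERIV_cmult der z DERIV_ident)
    then show "(\<phi> has_field_derivative (s - 1) * (of_nat n powr (- s) - z powr (- s))) (at z within S)"
      by (simp add: algebra_simps)
    show "norm ((s - 1) * (of_nat n powr (- s) - z powr (- s))) \<le> norm s * norm (s - 1) * real n powr (- Re s - 1)"
      using mult_left_mono[OF le1[OF z], of "norm (s - 1)"] by (simp add: norm_mult mult_ac)
  qed (use mem in auto)
  also have "\<phi> (of_nat (Suc n)) - \<phi> (of_nat n) = zeta_term n s"
    by (simp add: \<phi>_def zeta_term_def algebra_simps)
  finally show ?thesis by simp
qed

lemma summable_Suc_powr:
  assumes "\<sigma> > 0"
  shows "summable (\<lambda>n. real (Suc n) powr (- \<sigma> - 1))"
  using summable_real_powr_iff[of "- \<sigma> - 1"] assms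
  by (subst summable_Suc_iff[where f = "\<lambda>n. real n powr (- \<sigma> - 1)"]) simp

text \<open>The bound on a term is locally uniform in s, so on a small disc one majorant serves all
  points and the limit is holomorphic.\<close>

lemma zeta_cont_aux:
  obtains g where "\<And>s. Re s > 0 \<Longrightarrow> (\<lambda>n. zeta_term (Suc n) s) sums g s"
    "g holomorphic_on {s. Re s > 0}"
proof -
  have "\<And>n s. s \<in> {s. Re s > 0} \<Longrightarrow> zeta_term (Suc n) field_differentiable (at s)"
    "\<And>s. s \<in> {s. Re s > 0} \<Longrightarrow> \<exists>d h. 0 < d \<and> summable h \<and> range h \<subseteq> \<real>\<^sub>\<ge>\<^sub>0 \<and>
        (\<forall>\<^sub>F n in sequentially. \<forall>y\<in>ball s d \<inter> {s. Re s > 0}. cmod (zeta_term (Suc n) y) \<le> cmod (h n))"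
  proof -
    fix n s
    have "zeta_term (Suc n) holomorphic_on UNIV"
      unfolding zeta_term_def[abs_def] by (intro holomorphic_intros) (simp_all del: of_nat_Suc)
    then show "zeta_term (Suc n) field_differentiable (at s)"
      by (simp add: holomorphic_on_def)
  next
    fix s :: complex assume "s \<in> {s. Re s > 0}"
    then have s: "Re s > 0" by simp
    define d where "d = Re s / 2"
    have d: "d > 0" "Re s - d > 0" using s by (auto simp: d_def)
    define h :: "nat \<Rightarrow> complex" where
      "h n = of_real ((norm s + d) * (norm s + d + 1) * real (Suc n) powr (- (Re s - d) - 1))" for n
    have "summable h" unfolding h_def
      by (intro summable_of_real summable_mult summable_Suc_powr d)
    moreover have "range h \<subseteq> \<real>\<^sub>\<ge>\<^sub>0" using d by (auto simp: h_def simp del: of_nat_Suc)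
    moreover have "cmod (zeta_term (Suc n) y) \<le> cmod (h n)" if y: "y \<in> ball s d \<inter> {s. Re s > 0}" for n y
    proof -
      have "\<bar>Re s - Re y\<bar> \<le> norm (s - y)" by (metis abs_Re_le_cmod minus_complex.simps(1))
      also have sy: "norm (s - y) < d" using y by (auto simp: dist_norm)
      finally have re: "Re s - d \<le> Re y" by linarith
      have n1: "norm y \<le> norm s + d" using sy norm_triangle_sub[of y s] by (simp add: norm_minus_commute)
      have n2: "norm (y - 1) \<le> norm s + d + 1" using n1 norm_triangle_ineq4[of y 1] by simp
      have "norm (zeta_term (Suc n) y) \<le> norm y * norm (y - 1) * real (Suc n) powr (- Re y - 1)"
        using norm_zeta_term_le[of "Suc n" y] y by simp
      also have "\<dots> \<le> (norm s + d) * (norm s + d + 1) * real (Suc n) powr (- (Re s - d) - 1)"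
        using re d by (intro mult_mono n1 n2 powr_mono) auto
      also have "\<dots> = norm (h n)" using d by (simp add: h_def norm_mult abs_mult del: of_nat_Suc of_real_mult)
      finally show ?thesis .
    qed
    ultimately show "\<exists>d h. 0 < d \<and> summable h \<and> range h \<subseteq> \<real>\<^sub>\<ge>\<^sub>0 \<and>
        (\<forall>\<^sub>F n in sequentially. \<forall>y\<in>ball s d \<inter> {s. Re s > 0}. cmod (zeta_term (Suc n) y) \<le> cmod (h n))"
      using d by (intro exI[of _ d] exI[of _ h] conjI always_eventually allI ballI) auto
  qed
  then obtain g where "\<forall>s \<in> {s. Re s > 0}. ((\<lambda>n. zeta_term (Suc n) s) sums g s) \<and> g field_differentiable (at s)"
    using series_differentiable_comparison_complex[OF open_Re_gt[of 0], of "\<lambda>n. zeta_term (Suc n)"] by blast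
  then show ?thesis
    by (intro that[of g]) (auto simp: holomorphic_on_def intro: field_differentiable_at_within)
qed

lemma zeta_cont_sums:
  assumes "Re s > 0"
  shows "(\<lambda>n. zeta_term (Suc n) s) sums (zeta_cont s - 1)"
  using zeta_cont_aux assms by (metis add_diff_cancel_left' sums_unique zeta_cont_def)

lemma zeta_cont_holomorphic: "zeta_cont holomorphic_on {s. Re s > 0}"
proof -
  obtain g where g: "\<And>s. Re s > 0 \<Longrightarrow> (\<lambda>n. zeta_term (Suc n) s) sums g s"
    "g holomorphic_on {s. Re s > 0}" using zeta_cont_aux by blast
  have "(\<lambda>s. 1 + g s) holomorphic_on {s. Re s > 0}" by (intro holomorphic_intros g(2))
  then show ?thesis
    by (rule holomorphic_transform) (use g(1) in \<open>auto simp: zeta_cont_def sums_iff\<close>)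
qed

lemma zeta_cont_1: "zeta_cont 1 = 1"
  by (simp add: zeta_cont_def zeta_term_def del: of_nat_Suc)

lemma zeta_cont_eq_dirichlet:
  assumes s: "Re s > 1"
  shows "zeta_cont s = (s - 1) * dirichlet_series (\<lambda>_. 1) s"
proof -
  have "(\<lambda>n. of_nat (Suc n) powr (1 - s) :: complex) \<longlonglongrightarrow> 0"
    by (rule tendsto_neg_powr_complex_of_nat) (use s in \<open>auto intro: filterlim_Suc\<close>)
  from telescope_sums[OF this]
  have 1: "(\<lambda>n. of_nat (Suc (Suc n)) powr (1 - s) - of_nat (Suc n) powr (1 - s) :: complex) sums (- 1)" by simp
  have "(\<lambda>n. of_nat n powr (- s) :: complex) sums dirichlet_series (\<lambda>_. 1) s"
    using dirichlet_series_sums[OF dirichlet_admissible_one s] by simp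
  then have "(\<lambda>n. of_nat (Suc n) powr (- s) :: complex) sums dirichlet_series (\<lambda>_. 1) s"
    using sums_Suc_iff[of "\<lambda>n. of_nat n powr (- s) :: complex"] by simp
  from sums_add[OF sums_mult[OF this, of "s - 1"] 1]
  have "(\<lambda>n. zeta_term (Suc n) s) sums ((s - 1) * dirichlet_series (\<lambda>_. 1) s - 1)"
    by (simp add: zeta_term_def)
  with zeta_cont_sums[of s] s show ?thesis using sums_unique2 by fastforce
qed

lemma sum_zeta_term:
  assumes "N \<ge> 1"
  shows "(\<Sum>n<N-1. zeta_term (Suc n) s) =
    (s - 1) * (\<Sum>n=1..<N. of_nat n powr (- s)) + of_nat N powr (1 - s) - 1"
  using assms
proof (induction N rule: nat_induct_at_least)
  case (Suc n)
  then obtain m where m: "n = Suc m" by (cases n) auto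
  show ?case using Suc unfolding m
    by (simp add: zeta_term_def algebra_simps)
qed simp

text \<open>The first N - 1 terms telescope. The Dirichlet polynomial that appears has a free length
  N; it will be chosen close to the height |Im s|, which balances it against the tail.\<close>

lemma zeta_cont_split:
  assumes s: "Re s > 0" and N: "N \<ge> 1"
  shows "zeta_cont s = (s - 1) * (\<Sum>n=1..<N. of_nat n powr (- s)) + of_nat N powr (1 - s) +
           (\<Sum>n. zeta_term (n + N) s)"
proof -
  have "(\<Sum>n. zeta_term (Suc n) s) = (\<Sum>n. zeta_term (Suc (n + (N - 1))) s) + (\<Sum>n<N-1. zeta_term (Suc n) s)"
    by (rule suminf_split_initial_segment) (use zeta_cont_sums[OF s] in \<open>auto simp: sums_iff\<close>)
  then show ?thesis using N sum_zeta_term[OF N, of s] by (simp add: zeta_cont_def)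
qed

lemma powr_tail_le:
  assumes \<sigma>: "\<sigma> > 0" and N: "N \<ge> 2"
  shows "summable (\<lambda>n. real (n + N) powr (- \<sigma> - 1))"
    and "(\<Sum>n. real (n + N) powr (- \<sigma> - 1)) \<le> real (N - 1) powr (- \<sigma>) / \<sigma>"
proof -
  \<comment> \<open>\<open>f n\<close> is the integral of x^(-\<sigma> - 1) from n + N - 1 to
    infinity, so its differences telescope and majorise the terms.\<close>
  define f where "f n = real (n + N - 1) powr (- \<sigma>) / \<sigma>" for n
  have "f \<longlonglongrightarrow> 0 / \<sigma>" unfolding f_def
  proof (intro tendsto_divide tendsto_neg_powr tendsto_const)
    show "filterlim (\<lambda>x. real (x + N - 1)) at_top sequentially"
      using N by real_asymp
  qed (use \<sigma> in auto)
  then have f: "(\<lambda>n. f n - f (Suc n)) sums (f 0 - 0)" using telescope_sums' by force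
  have le: "real (n + N) powr (- \<sigma> - 1) \<le> f n - f (Suc n)" for n
  proof -
    define m where "m = n + N - 1"
    have m: "m \<ge> 1" "n + N = Suc m" using N by (auto simp: m_def)
    have "\<exists>z. real m < z \<and> z < real m + 1 \<and>
        ((real m + 1) powr (- \<sigma>) - real m powr (- \<sigma>)) = (real m + 1 - real m) * (- \<sigma> * z powr (- \<sigma> - 1))"
    proof (rule MVT2)
      fix x assume "real m \<le> x" "x \<le> real m + 1"
      then have "x > 0" using m by linarith
      from has_real_derivative_powr[OF this]
      show "((\<lambda>x. x powr (- \<sigma>)) has_real_derivative - \<sigma> * x powr (- \<sigma> - 1)) (at x)" .
    qed simp
    then obtain z where z: "real m < z" "z < real m + 1"
      "real m powr (- \<sigma>) - (real m + 1) powr (- \<sigma>) = \<sigma> * z powr (- \<sigma> - 1)" by auto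
    have "\<sigma> * (real m + 1) powr (- \<sigma> - 1) \<le> \<sigma> * z powr (- \<sigma> - 1)"
      using z \<sigma> m by (intro mult_left_mono powr_mono2') auto
    then show ?thesis using z(3) \<sigma> m unfolding f_def m_def[symmetric]
      by (simp add: field_simps)
  qed
  show sm: "summable (\<lambda>n. real (n + N) powr (- \<sigma> - 1))"
    by (rule summable_comparison_test'[OF sums_summable[OF f], where N = 0]) (use le in simp)
  have "(\<Sum>n. real (n + N) powr (- \<sigma> - 1)) \<le> (\<Sum>n. f n - f (Suc n))"
    by (rule suminf_le[OF le sm sums_summable[OF f]])
  then show "(\<Sum>n. real (n + N) powr (- \<sigma> - 1)) \<le> real (N - 1) powr (- \<sigma>) / \<sigma>"
    using f by (simp add: sums_iff f_def)
qed

lemma sum_inverse_le_ln: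
  assumes "N \<ge> 1"
  shows "(\<Sum>n=1..N. 1 / real n) \<le> 1 + ln (real N)"
  using assms
proof (induction N rule: nat_induct_at_least)
  case (Suc N)
  have "ln (real N / real (Suc N)) \<le> real N / real (Suc N) - 1"
    using Suc by (intro ln_le_minus_one) auto
  then have "1 / real (Suc N) \<le> ln (real (Suc N)) - ln (real N)"
    using Suc by (simp add: ln_div field_simps)
  then show ?case using Suc by simp
qed simp

text \<open>The shift by 4 > e keeps the value above 1 for every real t, so that larger powers of it
  are larger.\<close>

definition log_height :: "real \<Rightarrow> real" where
  "log_height t = ln (\<bar>t\<bar> + 4)"

lemma log_height_gt_1: "log_height t > 1"
proof -
  have "exp 1 < (4::real)" using exp_le by linarith
  then have "ln (exp 1) < ln (\<bar>t\<bar> + 4)" by (subst ln_less_cancel_iff) auto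
  then show ?thesis by (simp add: log_height_def)
qed

text \<open>Within 1 / log(|t| + 4) of the line Re s = 1 the factor n^(1 - \<sigma>) is at most e as
  long as n \<le> |t| + 4. With N of that size the Dirichlet polynomial is no larger than a constant
  times a harmonic sum, hence the logarithm, and the tail is O(|t| + 4). The bound Re s \<ge> 1/4
  controls the factor 1 / \<sigma> of the tail.\<close>

lemma zeta_cont_bound:
  assumes s: "Re s \<ge> 1 - 1 / log_height (Im s)" "Re s \<ge> 1/4" "Re s \<le> 4"
  shows "norm (zeta_cont s) \<le> 100 * (\<bar>Im s\<bar> + 4) * log_height (Im s)"
proof -
  define t L \<sigma> where "t = \<bar>Im s\<bar>" and "L = log_height (Im s)" and "\<sigma> = Re s"
  define e :: real where "e = exp 1"
  have e: "1 \<le> e" "e \<le> 3" using exp_le by (auto simp: e_def)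
  have L1: "L > 1" by (simp add: L_def log_height_gt_1)
  have t0: "t \<ge> 0" by (simp add: t_def)
  have eL: "exp L = t + 4" by (simp add: L_def log_height_def t_def)
  have \<sigma>: "\<sigma> \<ge> 1 - 1 / L" "\<sigma> \<ge> 1/4" "\<sigma> \<le> 4" using s by (auto simp: \<sigma>_def L_def)
  \<comment> \<open>N lies in (t + 3, t + 4], so both N and N - 1 are comparable with the
    height.\<close>
  define N where "N = nat \<lfloor>t\<rfloor> + 4"
  have N: "real N \<le> t + 4" "real N > t + 3" "N \<ge> 4" using t0 by (auto simp: N_def; linarith)+
  have small: "real n powr (1 - \<sigma>) \<le> e" if n: "n \<ge> 1" "n \<le> N" for n
  proof -
    have "real n powr (1 - \<sigma>) = exp ((1 - \<sigma>) * ln (real n))" using n by (simp add: powr_def)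
    also have "(1 - \<sigma>) * ln (real n) \<le> 1 / L * L"
    proof (rule mult_mono)
      have "ln (real n) \<le> ln (t + 4)" using n N by simp
      then show "ln (real n) \<le> L" using eL by (metis ln_exp)
    qed (use \<sigma> L1 n in auto)
    finally show ?thesis using L1 by (simp add: e_def)
  qed
  have ns: "norm s \<le> \<sigma> + t" using cmod_le[of s] s by (simp add: \<sigma>_def t_def)
  have ns1: "norm (s - 1) \<le> t + 4"
  proof -
    have "norm (s - 1) \<le> \<bar>Re s - 1\<bar> + \<bar>Im s\<bar>" using cmod_le[of "s - 1"] by simp
    also have "\<bar>Re s - 1\<bar> \<le> 3" using s by auto
    finally show ?thesis by (simp add: t_def)
  qed
  have p1: "norm (\<Sum>n=1..<N. of_nat n powr (- s)) \<le> e * (1 + L)"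
  proof -
    have "norm (\<Sum>n=1..<N. of_nat n powr (- s)) \<le> (\<Sum>n=1..<N. real n powr (- \<sigma>))"
      by (rule order_trans[OF norm_sum]) (simp add: norm_of_nat_powr \<sigma>_def)
    also have "\<dots> \<le> (\<Sum>n=1..<N. e * (1 / real n))"
    proof (rule sum_mono)
      fix n assume n: "n \<in> {1..<N}"
      have "real n powr (- \<sigma>) = real n powr (1 - \<sigma>) * (1 / real n)"
        using n by (simp add: powr_diff powr_minus field_simps)
      also have "\<dots> \<le> e * (1 / real n)" using small[of n] n by (intro mult_right_mono) auto
      finally show "real n powr (- \<sigma>) \<le> e * (1 / real n)" .
    qed
    also have "\<dots> = e * (\<Sum>n=1..<N. 1 / real n)" by (simp add: sum_distrib_left)
    also have "\<dots> \<le> e * (\<Sum>n=1..N. 1 / real n)"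
      using e by (intro mult_left_mono sum_mono2) auto
    also have "\<dots> \<le> e * (1 + ln (real N))" using sum_inverse_le_ln[of N] N e by (intro mult_left_mono) auto
    also have "ln (real N) \<le> L" using N eL by (metis ln_exp ln_le_cancel_iff exp_gt_zero less_le_trans of_nat_0_less_iff zero_less_numeral)
    finally show ?thesis using e by simp
  qed
  have p2: "norm (of_nat N powr (1 - s)) \<le> e"
    using small[of N] N by (simp add: norm_of_nat_powr \<sigma>_def)
  have p3: "norm (\<Sum>n. zeta_term (n + N) s) \<le> 16 * e * (t + 4)"
  proof -
    have le: "norm (zeta_term (n + N) s) \<le> norm s * norm (s - 1) * real (n + N) powr (- \<sigma> - 1)" for n
      using norm_zeta_term_le[of "n + N" s] N \<sigma> by (simp add: \<sigma>_def)
    have sm: "summable (\<lambda>n. norm s * norm (s - 1) * real (n + N) powr (- \<sigma> - 1))"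
      by (intro summable_mult powr_tail_le) (use \<sigma> N in auto)
    have "norm (\<Sum>n. zeta_term (n + N) s) \<le> (\<Sum>n. norm s * norm (s - 1) * real (n + N) powr (- \<sigma> - 1))"
      by (rule norm_suminf_le[OF le sm])
    also have "\<dots> = norm s * norm (s - 1) * (\<Sum>n. real (n + N) powr (- \<sigma> - 1))"
      by (rule suminf_mult) (intro powr_tail_le, use \<sigma> N in auto)
    also have "\<dots> \<le> norm s * norm (s - 1) * (real (N - 1) powr (- \<sigma>) / \<sigma>)"
      by (intro mult_left_mono powr_tail_le) (use \<sigma> N in auto)
    also have "real (N - 1) powr (- \<sigma>) = real (N - 1) powr (1 - \<sigma>) / real (N - 1)"
      using N by (simp add: powr_diff powr_minus field_simps)
    also have "norm s * norm (s - 1) * (real (N - 1) powr (1 - \<sigma>) / real (N - 1) / \<sigma>) =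
       (norm s / real (N - 1)) * norm (s - 1) * real (N - 1) powr (1 - \<sigma>) * (1 / \<sigma>)" by simp
    also have "\<dots> \<le> 2 * (t + 4) * e * 4"
    proof (intro mult_mono)
      have "norm s \<le> 2 * (t + 2)" using ns \<sigma>(3) t0 by simp
      also have "t + 2 \<le> real (N - 1)" using N by (simp add: of_nat_diff)
      finally show "norm s / real (N - 1) \<le> 2" using N by (simp add: field_simps of_nat_diff)
    qed (use ns1 small[of "N - 1"] \<sigma> N t0 e in \<open>auto simp: field_simps\<close>)
    also have "\<dots> \<le> 16 * e * (t + 4)" using t0 e by (simp add: mult_ac)
    finally show ?thesis .
  qed
  have "norm (zeta_cont s) \<le> norm (s - 1) * (e * (1 + L)) + e + 16 * e * (t + 4)"
    unfolding zeta_cont_split[of s N, OF _ _] using p1 p2 p3 s N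
    by (subst zeta_cont_split[of s N])
       (auto intro!: norm_triangle_le add_mono mult_left_mono simp: norm_mult)
  also have "\<dots> \<le> (t + 4) * (e * (1 + L)) + e + 16 * e * (t + 4)"
    using ns1 e L1 t0 by (intro add_mono mult_right_mono) auto
  also have "\<dots> = e * ((t + 4) * (17 + L) + 1)" by (simp add: algebra_simps)
  also have "\<dots> \<le> 3 * ((t + 4) * (18 * L) + (t + 4) * L)"
  proof (intro mult_mono add_mono mult_left_mono)
    show "1 \<le> (t + 4) * L" using mult_mono[of 1 "t + 4" 1 L] t0 L1 by simp
  qed (use e t0 L1 in auto)
  also have "\<dots> \<le> 100 * (t + 4) * L" using t0 L1 by (simp add: algebra_simps)
  finally show ?thesis by (simp add: t_def L_def)
qed

section \<open>The logarithmic derivative of the zeta function\<close>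

lemma mangoldt_nonneg: "(mangoldt n :: real) \<ge> 0"
  using aprimedivisor_gt_0_nat[OF primepow_gt_Suc_0, of n] by (auto simp: mangoldt_def Suc_le_eq)

lemma mangoldt_le_ln: "(mangoldt n :: real) \<le> ln (real n)"
proof (cases "primepow n")
  case True
  then have "n > Suc 0" by (rule primepow_gt_Suc_0)
  then show ?thesis using True aprimedivisor_le_nat[of n] aprimedivisor_gt_0_nat[of n]
    by (simp add: mangoldt_def)
next
  case False
  then show ?thesis by (cases "n = 0") (simp_all add: mangoldt_def)
qed

lemma dirichlet_admissible_mangoldt: "dirichlet_admissible mangoldt"
  by (rule dirichlet_admissible_bound[OF dirichlet_admissible_ln[OF dirichlet_admissible_one]])
     (use mangoldt_nonneg mangoldt_le_ln in \<open>auto intro: order_trans\<close>)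

lemma dirichlet_admissible_mangoldt_div_ln: "dirichlet_admissible (\<lambda>n. mangoldt n / ln n)"
  by (rule dirichlet_admissible_bound[OF dirichlet_admissible_one])
     (use mangoldt_nonneg mangoldt_le_ln in \<open>auto simp: divide_le_eq\<close>)

abbreviation zeta :: "complex \<Rightarrow> complex" where
  "zeta \<equiv> dirichlet_series (\<lambda>_. 1)"

text \<open>Comes from the convolution identity \<Lambda> * 1 = log: the series of log n is both
  -\<zeta>' and the product of \<zeta> with the series of \<Lambda>.\<close>

lemma zeta_has_field_derivative:
  assumes s: "Re s > 1"
  shows "(zeta has_field_derivative - (zeta s * dirichlet_series mangoldt s)) (at s)"
proof -
  have "dirichlet_series mangoldt s * zeta s = dirichlet_series (\<lambda>n. ln (real n)) s"
  proof (rule dirichlet_series_mult[OF dirichlet_admissible_mangoldt dirichlet_admissible_one _ _ s])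
    show "dirichlet_admissible (\<lambda>n. ln (real n))"
      using dirichlet_admissible_ln[OF dirichlet_admissible_one] by simp
  qed (use mangoldt_sum[where 'a = real] in simp)
  moreover have "dirichlet_series (\<lambda>n. - ln (real n)) s = - dirichlet_series (\<lambda>n. ln (real n)) s"
    using dirichlet_admissible_ln[OF dirichlet_admissible_one] s by (intro dirichlet_series_minus) auto
  ultimately show ?thesis
    using dirichlet_series_has_field_derivative[OF dirichlet_admissible_one s] by (simp add: mult.commute)
qed

section \<open>The logarithm of zeta and the 3-4-1 inequality\<close>

text \<open>Serves to determine a constant of integration: along the integers s = k only the term n
  = 1 survives, since n^(-k) \<le> n^(-2) 2^(2 - k) for n \<ge> 2 and k \<ge> 2.\<close>

lemma dirichlet_series_tendsto_at_top:
  assumes a: "dirichlet_admissible a"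
  shows "(\<lambda>k. dirichlet_series a (of_nat k)) \<longlonglongrightarrow> of_real (a 1)"
proof -
  define S where "S = (\<Sum>n. \<bar>a (n + 2)\<bar> * real (n + 2) powr (- 2))"
  have sm: "summable (\<lambda>n. \<bar>a (n + 2)\<bar> * real (n + 2) powr (- 2))"
    using a by (subst summable_iff_shift[where f = "\<lambda>n. \<bar>a n\<bar> * real n powr (- 2)"])
      (simp add: dirichlet_admissible_def)
  have le: "norm (dirichlet_series a (of_nat k) - of_real (a 1)) \<le> S * 2 powr (2 - real k)" if k: "k \<ge> 2" for k
  proof -
    let ?f = "\<lambda>n. of_real (a n) * of_nat n powr (- of_nat k) :: complex"
    have f: "?f sums dirichlet_series a (of_nat k)" by (rule dirichlet_series_sums[OF a]) (use k in auto)
    have "dirichlet_series a (of_nat k) = (\<Sum>n. ?f (n + 2)) + (\<Sum>n<2. ?f n)"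
      using suminf_split_initial_segment[of ?f 2] f by (simp add: sums_iff)
    then have "dirichlet_series a (of_nat k) - of_real (a 1) = (\<Sum>n. ?f (n + 2))"
      by (simp add: numeral_2_eq_2)
    also have "norm \<dots> \<le> (\<Sum>n. (\<bar>a (n + 2)\<bar> * real (n + 2) powr (- 2)) * 2 powr (2 - real k))"
    proof (rule norm_suminf_le)
      fix n
      have "real (n + 2) powr (- real k) = real (n + 2) powr (- 2) * real (n + 2) powr (2 - real k)"
        by (simp add: powr_add[symmetric])
      also have "\<dots> \<le> real (n + 2) powr (- 2) * 2 powr (2 - real k)"
        using k by (intro mult_left_mono powr_mono2') auto
      finally have "\<bar>a (n + 2)\<bar> * real (n + 2) powr (- real k) \<le> \<bar>a (n + 2)\<bar> * (real (n + 2) powr (- 2) * 2 powr (2 - real k))"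
        by (intro mult_left_mono) auto
      then show "norm (?f (n + 2)) \<le> \<bar>a (n + 2)\<bar> * real (n + 2) powr (- 2) * 2 powr (2 - real k)"
        using norm_of_nat_powr[of "n + 2" "- of_nat k"] by (simp add: norm_mult mult_ac)
    qed (intro summable_mult2 sm)
    also have "\<dots> = S * 2 powr (2 - real k)"
      unfolding S_def by (rule suminf_mult2[symmetric, OF sm])
    finally show ?thesis .
  qed
  have "(\<lambda>k. dirichlet_series a (of_nat k) - of_real (a 1)) \<longlonglongrightarrow> 0"
  proof (rule Lim_null_comparison)
    show "\<forall>\<^sub>F k in sequentially. norm (dirichlet_series a (of_nat k) - of_real (a 1)) \<le> S * 2 powr (2 - real k)"
      using eventually_ge_at_top[of 2] by eventually_elim (rule le)
    show "(\<lambda>k. S * 2 powr (2 - real k)) \<longlonglongrightarrow> 0" by real_asymp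
  qed
  then show ?thesis by (simp add: LIM_zero_iff)
qed

text \<open>The product of \<zeta> and exp(-l) has derivative 0, hence is constant, and its limit
  along the integers is 1. Neither an Euler product nor a branch of the logarithm is
  involved.\<close>

lemma zeta_eq_exp:
  assumes s: "Re s > 1"
  shows "zeta s = exp (dirichlet_series (\<lambda>n. mangoldt n / ln n) s)"
proof -
  define l where "l = dirichlet_series (\<lambda>n. mangoldt n / ln n)"
  have l: "(l has_field_derivative - dirichlet_series mangoldt z) (at z)" if z: "Re z > 1" for z
  proof -
    have "(\<lambda>n. - (mangoldt n / ln (real n) * ln (real n))) = (\<lambda>n. - mangoldt n)"
    proof
      fix n show "- (mangoldt n / ln (real n) * ln (real n)) = - mangoldt n"
        using mangoldt_nonneg[of n] mangoldt_le_ln[of n] by (cases "ln (real n) = 0") auto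
    qed
    then show ?thesis
      using dirichlet_series_has_field_derivative[OF dirichlet_admissible_mangoldt_div_ln z]
        dirichlet_series_minus[OF dirichlet_admissible_mangoldt z] by (simp add: l_def)
  qed
  have "\<exists>c. \<forall>z\<in>{z. Re z > 1}. zeta z * exp (- l z) = c"
  proof (rule has_field_derivative_zero_constant)
    show "convex {z. Re z > 1}" by (rule convex_halfspace_Re_gt)
    fix z assume "z \<in> {z. Re z > 1}"
    then have z: "Re z > 1" by simp
    have "((\<lambda>z. zeta z * exp (- l z)) has_field_derivative
        - (zeta z * dirichlet_series mangoldt z) * exp (- l z) + (exp (- l z) * - (- dirichlet_series mangoldt z)) * zeta z) (at z)"
      by (intro DERIV_mult zeta_has_field_derivative[OF z] DERIV_chain2[OF DERIV_exp] DERIV_minus l[OF z])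
    then show "((\<lambda>z. zeta z * exp (- l z)) has_field_derivative 0) (at z within {z. 1 < Re z})"
      by (simp add: algebra_simps has_field_derivative_at_within)
  qed
  then obtain c where c: "\<And>z. Re z > 1 \<Longrightarrow> zeta z * exp (- l z) = c" by auto
  have "(\<lambda>k. zeta (of_nat k) * exp (- l (of_nat k))) \<longlonglongrightarrow> of_real 1 * exp (- of_real (mangoldt 1 / ln 1))"
    unfolding l_def
    using dirichlet_series_tendsto_at_top[OF dirichlet_admissible_one]
      dirichlet_series_tendsto_at_top[OF dirichlet_admissible_mangoldt_div_ln]
    by (intro tendsto_intros) auto
  moreover have "\<forall>\<^sub>F k in sequentially. zeta (of_nat k) * exp (- l (of_nat k)) = c"
    using eventually_ge_at_top[of 2] by eventually_elim (rule c, simp)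
  ultimately have "c = 1"
    using tendsto_eventually[of _ c sequentially] LIMSEQ_unique by fastforce
  then show ?thesis using c[OF s] by (simp add: l_def exp_minus field_simps)
qed

lemma Re_nat_powr: 
  assumes "n > 0"
  shows "Re (of_nat n powr (- Complex \<sigma> t)) = real n powr (- \<sigma>) * cos (t * ln (real n))"
proof -
  have "of_nat n powr (- Complex \<sigma> t) = exp (- Complex \<sigma> t * of_real (ln (real n)))"
    using assms by (simp add: powr_def Ln_of_nat)
  then show ?thesis using assms by (simp add: Re_exp powr_def)
qed

text \<open>After taking logarithms the n-th coefficient is \<Lambda>(n) n^(-\<sigma>) / log n times
  3 + 4 cos \<theta> + cos 2\<theta> = 2 (1 + cos \<theta>)^2 with \<theta> = t log n. A small value
  at height t, taken to the fourth power, would have to be compensated by the pole at height 0,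
  taken only to the third, or by a large value at height 2t.\<close>

lemma zeta_341:
  assumes s: "\<sigma> > 1"
  shows "norm (zeta (Complex \<sigma> 0)) ^ 3 * norm (zeta (Complex \<sigma> t)) ^ 4 * norm (zeta (Complex \<sigma> (2 * t))) \<ge> 1"
proof -
  define a where "a n = mangoldt n / ln (real n)" for n
  define l where "l = dirichlet_series a"
  have a0: "a n \<ge> 0" for n using mangoldt_nonneg[of n] mangoldt_le_ln[of n] by (auto simp: a_def)
  have norm: "norm (zeta (Complex \<sigma> u)) = exp (Re (l (Complex \<sigma> u)))" for u
    using zeta_eq_exp[of "Complex \<sigma> u"] s by (simp add: l_def a_def[abs_def])
  have sums: "(\<lambda>n. a n * Re (of_nat n powr (- Complex \<sigma> u))) sums Re (l (Complex \<sigma> u))" for u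
    using sums_Re[OF dirichlet_series_sums[OF dirichlet_admissible_mangoldt_div_ln, of "Complex \<sigma> u"]] s
    by (simp add: l_def a_def[abs_def])
  have "(\<lambda>n. 3 * (a n * Re (of_nat n powr (- Complex \<sigma> 0))) + 4 * (a n * Re (of_nat n powr (- Complex \<sigma> t)))
      + a n * Re (of_nat n powr (- Complex \<sigma> (2 * t)))) sums
      (3 * Re (l (Complex \<sigma> 0)) + 4 * Re (l (Complex \<sigma> t)) + Re (l (Complex \<sigma> (2 * t))))"
    by (intro sums_add sums_mult sums)
  then have "3 * Re (l (Complex \<sigma> 0)) + 4 * Re (l (Complex \<sigma> t)) + Re (l (Complex \<sigma> (2 * t))) \<ge> 0"
  proof (rule sums_le[OF _ sums_zero, rotated])
    fix n
    show "0 \<le> 3 * (a n * Re (of_nat n powr (- Complex \<sigma> 0))) + 4 * (a n * Re (of_nat n powr (- Complex \<sigma> t)))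
      + a n * Re (of_nat n powr (- Complex \<sigma> (2 * t)))"
    proof (cases "n = 0")
      case False
      define c where "c = cos (t * ln (real n))"
      define p where "p = real n powr (- \<sigma>)"
      have "cos (2 * t * ln (real n)) = 2 * c ^ 2 - 1"
        using cos_double_cos[of "t * ln (real n)"] by (simp add: c_def mult_ac)
      then have "Re (of_nat n powr (- Complex \<sigma> 0)) = p" "Re (of_nat n powr (- Complex \<sigma> t)) = p * c"
        "Re (of_nat n powr (- Complex \<sigma> (2 * t))) = p * (2 * c ^ 2 - 1)"
        using False by (simp_all add: Re_nat_powr c_def p_def)
      then have "3 * (a n * Re (of_nat n powr (- Complex \<sigma> 0))) + 4 * (a n * Re (of_nat n powr (- Complex \<sigma> t)))
        + a n * Re (of_nat n powr (- Complex \<sigma> (2 * t))) = a n * p * (2 * (1 + c) ^ 2)"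
        by (simp only:) (simp add: power2_eq_square algebra_simps)
      moreover have "p \<ge> 0" by (simp add: p_def)
      ultimately show ?thesis using a0[of n] by simp
    qed simp
  qed
  then have "exp (3 * Re (l (Complex \<sigma> 0)) + 4 * Re (l (Complex \<sigma> t)) + Re (l (Complex \<sigma> (2 * t)))) \<ge> 1"
    by simp
  then show ?thesis by (simp add: norm exp_add exp_of_nat_mult[symmetric])
qed

section \<open>Bounds near the line \<open>Re s = 1\<close>\<close>

text \<open>The continuation of \<zeta> itself. Its value at the pole is 0 by the convention for
  division, so it is used only away from s = 1.\<close>

definition zeta_ext :: "complex \<Rightarrow> complex" where
  "zeta_ext s = zeta_cont s / (s - 1)"

lemma zeta_ext_eq_zeta: "Re s > 1 \<Longrightarrow> zeta_ext s = zeta s"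
  by (auto simp: zeta_ext_def zeta_cont_eq_dirichlet)

lemma zeta_ext_holomorphic: "zeta_ext holomorphic_on {s. Re s > 0} - {1}"
  unfolding zeta_ext_def[abs_def]
  by (intro holomorphic_intros holomorphic_on_subset[OF zeta_cont_holomorphic]) auto

lemma open_zeta_ext_domain: "open ({s. Re s > 0} - {1})"
  using open_Re_gt[of 0] by (intro open_Diff) auto

text \<open>Lets one logarithm L = \<open>log_height t\<close> serve for all heights that occur
  together with t, namely those within a bounded distance and the height 2t of the 3-4-1
  inequality.\<close>

lemma log_height_double:
  assumes "\<bar>u\<bar> + 4 \<le> (\<bar>t\<bar> + 4) ^ 2"
  shows "log_height u \<le> 2 * log_height t"
proof -
  have "ln (\<bar>u\<bar> + 4) \<le> ln ((\<bar>t\<bar> + 4) ^ 2)" using assms by (subst ln_le_cancel_iff) auto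
  also have "\<dots> = 2 * ln (\<bar>t\<bar> + 4)" by (subst ln_realpow) auto
  finally show ?thesis by (simp add: log_height_def)
qed

text \<open>Away from the real axis, dividing by |s - 1| \<ge> |Im s| cancels the linear growth of
  \<open>zeta_cont\<close> and leaves only the logarithm. The reference height t is kept free for
  later use on discs around t and at 2t.\<close>

lemma zeta_ext_upper_bound:
  assumes \<epsilon>: "\<epsilon> > 0"
  obtains C where "C > 0"
    "\<And>s t. \<lbrakk>\<bar>Im s\<bar> \<ge> \<epsilon>; \<bar>Im s\<bar> + 4 \<le> (\<bar>t\<bar> + 4) ^ 2; 1 - 1 / (2 * log_height t) \<le> Re s; Re s \<le> 4\<rbrakk>
       \<Longrightarrow> norm (zeta_ext s) \<le> C * log_height t"
proof -
  define C where "C = 200 * (1 + 4 / \<epsilon>)"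
  have "norm (zeta_ext s) \<le> C * log_height t"
    if s: "\<bar>Im s\<bar> \<ge> \<epsilon>" "\<bar>Im s\<bar> + 4 \<le> (\<bar>t\<bar> + 4) ^ 2" "1 - 1 / (2 * log_height t) \<le> Re s" "Re s \<le> 4" for s t
  proof -
    define u where "u = \<bar>Im s\<bar>"
    have u: "u \<ge> \<epsilon>" "u > 0" using s \<epsilon> by (auto simp: u_def)
    have L: "log_height (Im s) \<le> 2 * log_height t" using s by (intro log_height_double) auto
    have L1: "log_height (Im s) > 1" "log_height t > 1" by (rule log_height_gt_1)+
    have "1 / (2 * log_height t) \<le> 1 / log_height (Im s)" using L L1 by (intro divide_left_mono) auto
    moreover have "1 / (2 * log_height t) \<le> 1 / 2" using L1 by simp
    ultimately have "norm (zeta_cont s) \<le> 100 * (u + 4) * log_height (Im s)"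
      unfolding u_def using s by (intro zeta_cont_bound) linarith+
    also have "\<dots> \<le> 100 * (u + 4) * (2 * log_height t)" using L u by (intro mult_left_mono) auto
    finally have 1: "norm (zeta_cont s) \<le> 200 * (u + 4) * log_height t" by (simp add: algebra_simps)
    have "u \<le> norm (s - 1)" using abs_Im_le_cmod[of "s - 1"] by (simp add: u_def)
    then have "norm (zeta_ext s) \<le> 200 * (u + 4) * log_height t / u"
      unfolding zeta_ext_def norm_divide using 1 u L1 by (intro frac_le) auto
    also have "\<dots> = 200 * (1 + 4 / u) * log_height t" using u by (simp add: field_simps)
    also have "\<dots> \<le> C * log_height t"
      unfolding C_def using u \<epsilon> L1 by (intro mult_right_mono mult_left_mono add_left_mono divide_left_mono) auto
    finally show ?thesis .
  qed
  moreover have "C > 0" using \<epsilon> by (simp add: C_def add_pos_pos)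
  ultimately show ?thesis using that by blast
qed

lemma zeta_ext_deriv_bound:
  assumes \<epsilon>: "\<epsilon> > 0" "\<epsilon> \<le> 1/4"
  obtains C where "C > 0"
    "\<And>s t. \<lbrakk>\<bar>Im s\<bar> \<ge> 2 * \<epsilon>; \<bar>Im s - t\<bar> \<le> 1; 1 - 1 / (4 * log_height t) \<le> Re s; Re s \<le> 3\<rbrakk>
       \<Longrightarrow> norm (zeta_ext s) \<le> C * log_height t \<and> norm (deriv zeta_ext s) \<le> C * log_height t ^ 2"
proof -
  obtain C where C: "C > 0" "\<And>s t. \<lbrakk>\<bar>Im s\<bar> \<ge> \<epsilon>; \<bar>Im s\<bar> + 4 \<le> (\<bar>t\<bar> + 4) ^ 2; 1 - 1 / (2 * log_height t) \<le> Re s; Re s \<le> 4\<rbrakk>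
       \<Longrightarrow> norm (zeta_ext s) \<le> C * log_height t"
    using zeta_ext_upper_bound[OF \<epsilon>(1)] by blast
  have "norm (zeta_ext s) \<le> (C + C / \<epsilon>) * log_height t \<and> norm (deriv zeta_ext s) \<le> (C + C / \<epsilon>) * log_height t ^ 2"
    if s: "\<bar>Im s\<bar> \<ge> 2 * \<epsilon>" "\<bar>Im s - t\<bar> \<le> 1" "1 - 1 / (4 * log_height t) \<le> Re s" "Re s \<le> 3" for s t
  proof -
    define L where "L = log_height t"
    have L: "L > 1" by (simp add: L_def log_height_gt_1)
    \<comment> \<open>Radius for Cauchy's inequality: at most \<epsilon>, so that the disc stays off
      the real axis, and at most 1 / (4 L), so that it stays in the strip of the upper
      bound.\<close>
    define r where "r = \<epsilon> / L"
    have r: "r > 0" "r \<le> \<epsilon>" "r \<le> 1 / (4 * L)" using \<epsilon> L by (auto simp: r_def field_simps)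
    have bnd: "norm (zeta_ext w) \<le> C * L" "w \<in> {s. Re s > 0} - {1}" if w: "norm (s - w) \<le> r" for w
    proof -
      have re: "\<bar>Re s - Re w\<bar> \<le> r" using w abs_Re_le_cmod[of "s - w"] by simp
      have im: "\<bar>Im s - Im w\<bar> \<le> r" using w abs_Im_le_cmod[of "s - w"] by simp
      have im1: "\<bar>Im w\<bar> \<ge> \<epsilon>" using im s r by linarith
      have "1 / (2 * L) = 1 / (4 * L) + 1 / (4 * L)" using L by (simp add: field_simps)
      then have re1: "1 - 1 / (2 * L) \<le> Re w" using re s r by (simp add: L_def)
      have "\<bar>Im w\<bar> + 4 \<le> \<bar>t\<bar> + 6" using im s r \<epsilon> by linarith
      also have "\<dots> \<le> (\<bar>t\<bar> + 4) ^ 2" by (simp add: power2_eq_square algebra_simps)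
      finally show "norm (zeta_ext w) \<le> C * L" unfolding L_def
        using im1 re1 re r s \<epsilon> by (intro C(2)) (auto simp: L_def)
      have "1 / (2 * L) < 1" using L by simp
      then show "w \<in> {s. Re s > 0} - {1}" using re1 im1 \<epsilon> by auto
    qed
    have sub: "cball s r \<subseteq> {s. Re s > 0} - {1}" using bnd(2) by (force simp: dist_norm)
    have "norm ((deriv ^^ 1) zeta_ext s) \<le> fact 1 * (C * L) / r ^ 1"
    proof (rule Cauchy_inequality)
      show "zeta_ext holomorphic_on ball s r"
        by (rule holomorphic_on_subset[OF zeta_ext_holomorphic]) (use sub ball_subset_cball in blast)
      show "continuous_on (cball s r) zeta_ext"
        by (rule holomorphic_on_imp_continuous_on[OF holomorphic_on_subset[OF zeta_ext_holomorphic sub]])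
    qed (use r bnd in auto)
    then have "norm (deriv zeta_ext s) \<le> C / \<epsilon> * L ^ 2" by (simp add: r_def power2_eq_square)
    also have "\<dots> \<le> (C + C / \<epsilon>) * L ^ 2" using C by (intro mult_right_mono) auto
    finally have 1: "norm (deriv zeta_ext s) \<le> (C + C / \<epsilon>) * L ^ 2" .
    have "norm (zeta_ext s) \<le> C * L" using bnd(1)[of s] r by simp
    also have "\<dots> \<le> (C + C / \<epsilon>) * L" using C \<epsilon> L by (intro mult_right_mono) auto
    finally show ?thesis using 1 by (simp add: L_def)
  qed
  moreover have "C + C / \<epsilon> > 0" using C \<epsilon> by (simp add: add_pos_pos)
  ultimately show ?thesis using that by blast
qed

text \<open>In the 3-4-1 inequality the value at 1 + a is O(1 / a) because of the pole, and the one
  at height 2t is O(L). The result stays in the form of a fourth power, so that no fractional powers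
  appear.\<close>

lemma zeta_lower_bound_right:
  assumes \<epsilon>: "\<epsilon> > 0"
  obtains c where "c > 0"
    "\<And>a t. \<lbrakk>0 < a; a \<le> 2; \<bar>t\<bar> \<ge> \<epsilon>\<rbrakk> \<Longrightarrow> norm (zeta (Complex (1 + a) t)) ^ 4 \<ge> c ^ 4 * a ^ 3 / log_height t"
proof -
  obtain C where C: "C > 0" "\<And>s t. \<lbrakk>\<bar>Im s\<bar> \<ge> \<epsilon>; \<bar>Im s\<bar> + 4 \<le> (\<bar>t\<bar> + 4) ^ 2; 1 - 1 / (2 * log_height t) \<le> Re s; Re s \<le> 4\<rbrakk>
       \<Longrightarrow> norm (zeta_ext s) \<le> C * log_height t"
    using zeta_ext_upper_bound[OF \<epsilon>(1)] by blast
  \<comment> \<open>The number 800 is 100 * 4 * 2: \<open>zeta_cont_bound\<close> at height 0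
    together with log 4 \<le> 2.\<close>
  define c where "c = root 4 (1 / (800 ^ 3 * C))"
  have c: "c > 0" "c ^ 4 = 1 / (800 ^ 3 * C)" using C by (auto simp: c_def)
  have "norm (zeta (Complex (1 + a) t)) ^ 4 \<ge> c ^ 4 * a ^ 3 / log_height t"
    if a: "0 < a" "a \<le> 2" "\<bar>t\<bar> \<ge> \<epsilon>" for a t
  proof -
    define L where "L = log_height t"
    have L: "L > 1" by (simp add: L_def log_height_gt_1)
    define x where "x = norm (zeta (Complex (1 + a) t)) ^ 4"
    have x: "x \<ge> 0" by (simp add: x_def)
    have "1 / (2 * L) > 0" using L by simp
    then have re: "1 - 1 / (2 * log_height t) \<le> 1 + a" using a unfolding L_def by linarith
    have "norm (zeta_ext (Complex (1 + a) (2 * t))) \<le> C * L" unfolding L_def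
    proof (intro C)
      show "\<bar>Im (Complex (1 + a) (2 * t))\<bar> + 4 \<le> (\<bar>t\<bar> + 4)\<^sup>2"
        by (simp add: abs_mult power2_eq_square algebra_simps)
    qed (use a re in \<open>auto simp: L_def\<close>)
    then have b2: "norm (zeta (Complex (1 + a) (2 * t))) \<le> C * L"
      using a by (simp add: zeta_ext_eq_zeta)
    have "log_height 0 > 1" by (rule log_height_gt_1)
    moreover have "log_height 0 \<le> 2"
      using ln_le_cancel_iff[of 4 "exp 2"] exp_ge_add_one_self[of 1] 
        power_mono[of 2 "exp 1::real" 2] exp_double[of "1::real"] by (simp add: log_height_def)
    moreover have "- (1 / log_height 0) \<le> a"
    proof -
      have "1 / log_height 0 > 0" using calculation by simp
      then show ?thesis using a by linarith
    qed
    ultimately have "norm (zeta_cont (Complex (1 + a) 0)) \<le> 800"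
      using zeta_cont_bound[of "Complex (1 + a) 0"] a by auto
    moreover have "Complex (1 + a) 0 - 1 = Complex a 0" by (simp add: complex_eq_iff)
    then have "zeta (Complex (1 + a) 0) = zeta_cont (Complex (1 + a) 0) / Complex a 0"
      using zeta_ext_eq_zeta[of "Complex (1 + a) 0"] a by (simp add: zeta_ext_def)
    moreover have "norm (Complex a 0) = a" using a by (simp add: cmod_def)
    ultimately have b1: "norm (zeta (Complex (1 + a) 0)) \<le> 800 / a"
      using a by (simp add: norm_divide divide_right_mono)
    have "1 \<le> norm (zeta (Complex (1 + a) 0)) ^ 3 * x * norm (zeta (Complex (1 + a) (2 * t)))"
      unfolding x_def using a by (intro zeta_341) auto
    also have "\<dots> \<le> (800 / a) ^ 3 * x * (C * L)"
      using b1 b2 x C L a by (intro mult_mono power_mono) auto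
    finally have "c ^ 4 * a ^ 3 / L \<le> x" unfolding c(2) using a C(1) L by (simp add: field_simps)
    then show ?thesis by (simp add: x_def L_def)
  qed
  with c(1) that show ?thesis by blast
qed

text \<open>Since \<open>\<zeta>\<close> is at least of order \<open>(\<eta>\<^sup>3 / L)^(1/4)\<close> at distance \<open>\<eta>\<close> to the right of
  the line \<open>Re s = 1\<close> and \<open>\<zeta>'\<close> is of order \<open>L\<^sup>2\<close>, it cannot become small within distance
  \<open>\<eta> = \<kappa>\<^sup>4 / L\<^sup>9\<close> of that line if \<open>\<kappa>\<close> is small.\<close>

lemma zeta_ext_region:
  assumes \<epsilon>: "\<epsilon> > 0" "\<epsilon> \<le> 1/4"
  obtains \<kappa> c C where "\<kappa> > 0" "c > 0" "C > 0"
    "\<And>\<sigma> t z. \<lbrakk>1 \<le> \<sigma>; \<sigma> \<le> 2; \<bar>t\<bar> \<ge> 3 * \<epsilon>; norm (Complex \<sigma> t - z) \<le> \<kappa> / log_height t ^ 9\<rbrakk>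
       \<Longrightarrow> Re z > 0 \<and> z \<noteq> 1 \<and> norm (zeta_ext z) \<ge> c / log_height t ^ 7 \<and>
           norm (zeta_ext z) \<le> C * log_height t \<and> norm (deriv zeta_ext z) \<le> C * log_height t ^ 2"
proof -
  obtain C where C: "C > 0" 
    "\<And>s t. \<lbrakk>\<bar>Im s\<bar> \<ge> 2 * \<epsilon>; \<bar>Im s - t\<bar> \<le> 1; 1 - 1 / (4 * log_height t) \<le> Re s; Re s \<le> 3\<rbrakk>
       \<Longrightarrow> norm (zeta_ext s) \<le> C * log_height t \<and> norm (deriv zeta_ext s) \<le> C * log_height t ^ 2"
    using zeta_ext_deriv_bound[OF \<epsilon>] by blast
  obtain c where c: "c > 0"
    "\<And>a t. \<lbrakk>0 < a; a \<le> 2; \<bar>t\<bar> \<ge> \<epsilon>\<rbrakk> \<Longrightarrow> norm (zeta (Complex (1 + a) t)) ^ 4 \<ge> c ^ 4 * a ^ 3 / log_height t"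
    using zeta_lower_bound_right[OF \<epsilon>(1)] by blast
  \<comment> \<open>The first bound makes the variation of \<zeta> over a distance 2 \<eta> at most
    half of its lower bound, the second keeps the discs in the region of the derivative bound. The
    exponents fit for \<eta> = k^4 / L^9: the fourth root of \<eta>^3 / L is k^3 / L^7, and L^2
    \<eta> equals k^4 / L^7.\<close>
  define k where "k = min (c / (4 * C)) (\<epsilon> / 2)"
  have k: "k > 0" "k \<le> c / (4 * C)" "k \<le> \<epsilon> / 2" using c C \<epsilon> by (auto simp: k_def)
  have k4: "k ^ 4 \<le> k" using power_decreasing[of 1 4 k] k \<epsilon> by simp
  have main: "Re z > 0 \<and> z \<noteq> 1 \<and> norm (zeta_ext z) \<ge> (c * k ^ 3 / 2) / log_height t ^ 7 \<and>
           norm (zeta_ext z) \<le> C * log_height t \<and> norm (deriv zeta_ext z) \<le> C * log_height t ^ 2"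
    if z: "1 \<le> \<sigma>" "\<sigma> \<le> 2" "\<bar>t\<bar> \<ge> 3 * \<epsilon>" "norm (Complex \<sigma> t - z) \<le> k ^ 4 / log_height t ^ 9" for \<sigma> t z
  proof -
    define L where "L = log_height t"
    have L: "L > 1" by (simp add: L_def log_height_gt_1)
    define \<eta> where "\<eta> = k ^ 4 / L ^ 9"
    have \<eta>: "\<eta> > 0" using k L by (simp add: \<eta>_def)
    have "\<eta> \<le> k / L ^ 9" unfolding \<eta>_def using k4 L by (intro divide_right_mono) auto
    also have "\<dots> \<le> k / L" using k L power_increasing[of 1 9 L] by (intro divide_left_mono) auto
    finally have \<eta>k: "\<eta> \<le> k / L" .
    have "k / L \<le> k" using k L by (simp add: field_simps)
    moreover have "k / L \<le> (1 / 8) / L" using k \<epsilon> L by (intro divide_right_mono) auto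
    ultimately have \<eta>1: "\<eta> \<le> \<epsilon> / 2" "2 * \<eta> \<le> 1 / (4 * L)" using \<eta>k k by (auto simp: field_simps)
    \<comment> \<open>The point with which \<open>z\<close> is compared: it lies at least \<eta> to
      the right of the line Re s = 1, and \<open>z\<close> is within 2 \<eta> of it.\<close>
    define s0 where "s0 = Complex (\<sigma> + \<eta>) t"
    have reg: "\<bar>Im w\<bar> \<ge> 2 * \<epsilon>" "\<bar>Im w - t\<bar> \<le> 1" "1 - 1 / (4 * L) \<le> Re w" "Re w \<le> 3" "Re w > 0" "w \<noteq> 1"
      if "w \<in> cball s0 (2 * \<eta>)" for w
    proof -
      have w: "norm (s0 - w) \<le> 2 * \<eta>" using that by (simp add: dist_norm)
      have re: "\<bar>\<sigma> + \<eta> - Re w\<bar> \<le> 2 * \<eta>" using w abs_Re_le_cmod[of "s0 - w"] by (simp add: s0_def)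
      have im: "\<bar>t - Im w\<bar> \<le> 2 * \<eta>" using w abs_Im_le_cmod[of "s0 - w"] by (simp add: s0_def)
      show 1: "\<bar>Im w\<bar> \<ge> 2 * \<epsilon>" "\<bar>Im w - t\<bar> \<le> 1" "Re w \<le> 3" using re im z \<eta>1 \<epsilon> by linarith+
      show "1 - 1 / (4 * L) \<le> Re w" using re z \<eta>1 \<eta> by linarith
      show "Re w > 0" using re z \<eta>1 \<eta> \<epsilon> by linarith
      show "w \<noteq> 1" using 1(1) \<epsilon> by auto
    qed
    have bd: "norm (zeta_ext w) \<le> C * L" "norm (deriv zeta_ext w) \<le> C * L ^ 2" if "w \<in> cball s0 (2 * \<eta>)" for w
      using C(2)[of w t] reg[OF that] by (auto simp: L_def)
    have zS: "z \<in> cball s0 (2 * \<eta>)"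
    proof -
      have "norm (s0 - Complex \<sigma> t) = \<eta>" using \<eta> by (simp add: s0_def cmod_def)
      then have "norm (s0 - z) \<le> \<eta> + \<eta>"
        using norm_triangle_le[of "s0 - Complex \<sigma> t" "Complex \<sigma> t - z" "\<eta> + \<eta>"] z(4) 
        by (simp add: \<eta>_def L_def)
      then show ?thesis by (simp add: dist_norm)
    qed
    have s0S: "s0 \<in> cball s0 (2 * \<eta>)" using \<eta> by simp
    have lip: "norm (zeta_ext z - zeta_ext s0) \<le> C * L ^ 2 * norm (z - s0)"
    proof (rule field_differentiable_bound[OF convex_cball])
      fix w assume w: "w \<in> cball s0 (2 * \<eta>)"
      show "(zeta_ext has_field_derivative deriv zeta_ext w) (at w within cball s0 (2 * \<eta>))"
        using holomorphic_derivI[OF zeta_ext_holomorphic open_zeta_ext_domain, of w] reg[OF w]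
        by (auto intro: has_field_derivative_at_within)
    qed (use bd zS s0S in auto)
    also have "\<dots> \<le> C * L ^ 2 * (2 * \<eta>)"
      using zS C by (intro mult_left_mono) (auto simp: dist_norm norm_minus_commute)
    also have "\<dots> = 2 * C * k * k ^ 3 / L ^ 7"
    proof -
      have "L ^ 9 = L ^ 2 * L ^ 7" "k ^ 4 = k * k ^ 3" by (simp_all flip: power_add power_Suc)
      then have "C * L\<^sup>2 * (2 * \<eta>) = C * L ^ 2 * (2 * (k * k ^ 3 / (L ^ 2 * L ^ 7)))"
        unfolding \<eta>_def by (simp only:)
      also have "x * y * (2 * (q / (y * z))) = 2 * x * q / z" if "y \<noteq> 0" for x y z q :: real
        using that by simp
      from this[of "L\<^sup>2" C "k * k ^ 3" "L ^ 7"] have "C * L ^ 2 * (2 * (k * k ^ 3 / (L ^ 2 * L ^ 7))) = 2 * C * (k * k ^ 3) / L ^ 7"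
        using L by simp
      finally show ?thesis by (simp add: mult.assoc)
    qed
    also have "\<dots> \<le> (c / 2) * k ^ 3 / L ^ 7"
      using k C L by (intro divide_right_mono mult_right_mono) (auto simp: field_simps)
    finally have lip': "norm (zeta_ext z - zeta_ext s0) \<le> (c * k ^ 3 / 2) / L ^ 7" by simp
    have "(c * k ^ 3 / L ^ 7) ^ 4 = c ^ 4 * \<eta> ^ 3 / L"
      using power_add[of L 27 1] by (simp add: \<eta>_def power_divide power_mult_distrib power_mult[symmetric])
    also have "\<dots> \<le> c ^ 4 * (\<sigma> - 1 + \<eta>) ^ 3 / L"
      using c L \<eta> z by (intro divide_right_mono mult_left_mono power_mono) auto
    also have "\<dots> \<le> norm (zeta (Complex (1 + (\<sigma> - 1 + \<eta>)) t)) ^ 4"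
      unfolding L_def using z \<eta> \<eta>1 \<epsilon> by (intro c(2)) auto
    also have "Complex (1 + (\<sigma> - 1 + \<eta>)) t = s0" by (simp add: s0_def)
    finally have "c * k ^ 3 / L ^ 7 \<le> norm (zeta s0)"
      using power_mono_iff[of "c * k ^ 3 / L ^ 7" "norm (zeta s0)" 4] c k L by simp
    also have "zeta s0 = zeta_ext s0" using z \<eta> by (simp add: zeta_ext_eq_zeta s0_def)
    finally have "norm (zeta_ext z) \<ge> (c * k ^ 3 / 2) / L ^ 7"
      using lip' norm_triangle_ineq2[of "zeta_ext s0" "zeta_ext z"]
      by (simp add: norm_minus_commute field_simps)
    then show ?thesis using bd[OF zS] reg[OF zS] by (simp add: L_def)
  qed
  show ?thesis
    by (rule that[of "k ^ 4" "c * k ^ 3 / 2" C]) (use k c C main in auto)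
qed

text \<open>On Re s = 1 away from s = 1 the lower bound near that line is used with an \<epsilon>
  adapted to the point, which is why that bound is formulated for every small \<epsilon>.\<close>

lemma zeta_cont_nonzero:
  assumes "Re s \<ge> 1"
  shows "zeta_cont s \<noteq> 0"
proof -
  consider "s = 1" | "Re s > 1" | "Re s = 1" "Im s \<noteq> 0"
    using assms by (cases "Re s > 1") (auto simp: complex_eq_iff)
  then show ?thesis
  proof cases
    case 1 then show ?thesis by (simp add: zeta_cont_1)
  next
    case 2 then show ?thesis by (auto simp: zeta_cont_eq_dirichlet zeta_eq_exp)
  next
    case 3
    define \<epsilon> where "\<epsilon> = min (1/4) (\<bar>Im s\<bar> / 3)"
    have \<epsilon>: "\<epsilon> > 0" "\<epsilon> \<le> 1/4" "\<bar>Im s\<bar> \<ge> 3 * \<epsilon>" using 3 by (auto simp: \<epsilon>_def)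
    obtain \<kappa> c C where r: "\<kappa> > 0" "c > 0" "C > 0"
      "\<And>\<sigma> t z. \<lbrakk>1 \<le> \<sigma>; \<sigma> \<le> 2; \<bar>t\<bar> \<ge> 3 * \<epsilon>; norm (Complex \<sigma> t - z) \<le> \<kappa> / log_height t ^ 9\<rbrakk>
       \<Longrightarrow> Re z > 0 \<and> z \<noteq> 1 \<and> norm (zeta_ext z) \<ge> c / log_height t ^ 7 \<and>
           norm (zeta_ext z) \<le> C * log_height t \<and> norm (deriv zeta_ext z) \<le> C * log_height t ^ 2"
      using zeta_ext_region[OF \<epsilon>(1,2)] by blast
    have L: "log_height (Im s) > 1" by (rule log_height_gt_1)
    have "Complex 1 (Im s) = s" using 3 by (simp add: complex_eq_iff)
    have "norm (zeta_ext s) \<ge> c / log_height (Im s) ^ 7"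
      using r(4)[of 1 "Im s" s] \<epsilon> r(1) L \<open>Complex 1 (Im s) = s\<close> by simp
    moreover have "c / log_height (Im s) ^ 7 > 0" using r L by simp
    ultimately show ?thesis by (auto simp: zeta_ext_def)
  qed
qed

section \<open>The logarithmic derivative with its pole removed\<close>

text \<open>With F(s) = (s - 1) \<zeta>(s) this is -\<zeta>'/\<zeta> - \<zeta>: the parts 1 / (s -
  1) and -F(s) / (s - 1) combine into -(F(s) - F(1)) / (s - 1), as F(1) = 1, and the difference
  quotient is filled in by F'(1) at s = 1. The Dirichlet coefficients are \<Lambda>(n) - 1.\<close>

definition zeta_log_ext :: "complex \<Rightarrow> complex" where
  "zeta_log_ext s = - (if s = 1 then deriv zeta_cont 1 else (zeta_cont s - zeta_cont 1) / (s - 1)) -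
     deriv zeta_cont s / zeta_cont s"

lemma open_zeta_log_ext_domain: "open {s. Re s > 0 \<and> zeta_cont s \<noteq> 0}"
proof -
  have "open ({s. Re s > 0} \<inter> zeta_cont -` (- {0}))"
    by (rule continuous_open_preimage[OF holomorphic_on_imp_continuous_on[OF zeta_cont_holomorphic] open_Re_gt]) auto
  also have "{s. Re s > 0} \<inter> zeta_cont -` (- {0}) = {s. Re s > 0 \<and> zeta_cont s \<noteq> 0}" by auto
  finally show ?thesis .
qed

lemma zeta_log_ext_holomorphic: "zeta_log_ext holomorphic_on {s. Re s > 0 \<and> zeta_cont s \<noteq> 0}"
proof -
  have "(\<lambda>s. if s = 1 then deriv zeta_cont 1 else (zeta_cont s - zeta_cont 1) / (s - 1)) holomorphic_on {s. Re s > 0}"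
    by (rule pole_lemma[OF zeta_cont_holomorphic]) (simp add: interior_open[OF open_Re_gt])
  moreover have "deriv zeta_cont holomorphic_on {s. Re s > 0}"
    by (rule holomorphic_deriv[OF zeta_cont_holomorphic open_Re_gt])
  ultimately show ?thesis unfolding zeta_log_ext_def[abs_def]
    by (intro holomorphic_intros holomorphic_on_subset[OF zeta_cont_holomorphic])
       (auto intro: holomorphic_on_subset simp: open_zeta_log_ext_domain)
qed

lemma zeta_log_ext_eq:
  assumes s: "Re s > 0" "s \<noteq> 1" "zeta_cont s \<noteq> 0"
  shows "zeta_log_ext s = - deriv zeta_ext s / zeta_ext s - zeta_ext s"
proof -
  have "(zeta_cont has_field_derivative deriv zeta_cont s) (at s)"
    using holomorphic_derivI[OF zeta_cont_holomorphic open_Re_gt] s by simp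
  then have "(zeta_ext has_field_derivative (deriv zeta_cont s * (s - 1) - zeta_cont s) / (s - 1) ^ 2) (at s)"
    unfolding zeta_ext_def[abs_def]
    by (auto intro!: derivative_eq_intros simp: s power2_eq_square)
  then have d: "deriv zeta_ext s = (deriv zeta_cont s * (s - 1) - zeta_cont s) / (s - 1) ^ 2"
    by (rule DERIV_imp_deriv)
  have "- ((z - 1) / w) - v / z = - ((v * w - z) / w ^ 2) / (z / w) - z / w"
    if "w \<noteq> 0" "z \<noteq> 0" for v w z :: complex
    using that by (simp add: field_simps power2_eq_square)
  from this[of "s - 1" "zeta_cont s" "deriv zeta_cont s"] show ?thesis
    unfolding d using s by (simp add: zeta_log_ext_def zeta_ext_def zeta_cont_1)
qed

lemma dirichlet_admissible_mangoldt_minus_1: "dirichlet_admissible (\<lambda>n. mangoldt n - 1)"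
  by (intro dirichlet_admissible_diff dirichlet_admissible_mangoldt dirichlet_admissible_one)

lemma zeta_log_ext_eq_dirichlet:
  assumes s: "Re s > 1"
  shows "zeta_log_ext s = dirichlet_series (\<lambda>n. mangoldt n - 1) s"
proof -
  have nz: "zeta_cont s \<noteq> 0" "s \<noteq> 1" using zeta_cont_nonzero[of s] s by auto
  have "(zeta_ext has_field_derivative - (zeta s * dirichlet_series mangoldt s)) (at s)"
    by (rule has_field_derivative_transform_within_open[OF zeta_has_field_derivative[OF s] open_Re_gt[of 1]])
       (use s in \<open>auto simp: zeta_ext_eq_zeta\<close>)
  then have d: "deriv zeta_ext s = - (zeta s * dirichlet_series mangoldt s)" by (rule DERIV_imp_deriv)
  have "zeta s \<noteq> 0" using s by (simp add: zeta_eq_exp)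
  then show ?thesis using s nz
    by (simp add: zeta_log_ext_eq d zeta_ext_eq_zeta dirichlet_series_diff dirichlet_admissible_mangoldt
          dirichlet_admissible_one)
qed

lemma zeta_log_ext_higher_deriv:
  assumes s: "Re s > 1"
  shows "(deriv ^^ k) zeta_log_ext s = (- 1) ^ k * dirichlet_series (\<lambda>n. (mangoldt n - 1) * ln n ^ k) s"
proof -
  have "(deriv ^^ k) zeta_log_ext s = (deriv ^^ k) (dirichlet_series (\<lambda>n. mangoldt n - 1)) s"
  proof (rule higher_deriv_transform_within_open[OF _ _ open_Re_gt[of 1]])
    show "zeta_log_ext holomorphic_on {s. Re s > 1}"
      by (rule holomorphic_on_subset[OF zeta_log_ext_holomorphic]) (use zeta_cont_nonzero in auto)
  qed (use s in \<open>auto simp: zeta_log_ext_eq_dirichlet intro: dirichlet_series_holomorphic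
         dirichlet_admissible_mangoldt_minus_1\<close>)
  then show ?thesis using dirichlet_series_higher_deriv[OF dirichlet_admissible_mangoldt_minus_1 s] by simp
qed

text \<open>The point is that the constant does not depend on Re s, so that Re s may tend to 1. For
  |Im s| \<ge> 3/4, Cauchy's inequality on a disc of radius \<kappa> / L^9 loses L^(9 k), on top of
  the L^9 = L^2 / L^(-7) that bounds the function itself.\<close>

lemma mangoldt_dirichlet_bound:
  obtains C where "C > 0" "\<And>s. 1 < Re s \<Longrightarrow> Re s \<le> 2 \<Longrightarrow>
    norm (dirichlet_series (\<lambda>n. (mangoldt n - 1) * ln n ^ k) s) \<le> C * log_height (Im s) ^ (9 * (k + 1))"
proof -
  obtain \<kappa> c C where r: "\<kappa> > 0" "c > 0" "C > 0"
      "\<And>\<sigma> t z. \<lbrakk>1 \<le> \<sigma>; \<sigma> \<le> 2; \<bar>t\<bar> \<ge> 3 * (1/4); norm (Complex \<sigma> t - z) \<le> \<kappa> / log_height t ^ 9\<rbrakk>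
       \<Longrightarrow> Re z > 0 \<and> z \<noteq> 1 \<and> norm (zeta_ext z) \<ge> c / log_height t ^ 7 \<and>
           norm (zeta_ext z) \<le> C * log_height t \<and> norm (deriv zeta_ext z) \<le> C * log_height t ^ 2"
    using zeta_ext_region[of "1/4"] by auto
  define C1 where "C1 = fact k * (C / c + C) / \<kappa> ^ k"
  have C1: "C1 > 0" using r by (auto simp: C1_def add_pos_pos)
  have big: "norm ((deriv ^^ k) zeta_log_ext s) \<le> C1 * log_height (Im s) ^ (9 * (k + 1))"
    if s: "1 < Re s" "Re s \<le> 2" "\<bar>Im s\<bar> \<ge> 3/4" for s
  proof -
    define L where "L = log_height (Im s)"
    have L: "L > 1" by (simp add: L_def log_height_gt_1)
    define \<eta> where "\<eta> = \<kappa> / L ^ 9"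
    have \<eta>: "\<eta> > 0" using r L by (simp add: \<eta>_def)
    have z: "Re z > 0" "z \<noteq> 1" "norm (zeta_ext z) \<ge> c / L ^ 7" "norm (zeta_ext z) \<le> C * L"
      "norm (deriv zeta_ext z) \<le> C * L ^ 2" "zeta_cont z \<noteq> 0" if "norm (s - z) \<le> \<eta>" for z
    proof -
      show z: "Re z > 0" "z \<noteq> 1" "norm (zeta_ext z) \<ge> c / L ^ 7" "norm (zeta_ext z) \<le> C * L"
      "norm (deriv zeta_ext z) \<le> C * L ^ 2"
        using r(4)[of "Re s" "Im s" z] s that by (auto simp: \<eta>_def L_def)
      have "c / L ^ 7 > 0" using r L by simp
      with z(3) show "zeta_cont z \<noteq> 0" by (auto simp: zeta_ext_def)
    qed
    have sub: "cball s \<eta> \<subseteq> {s. Re s > 0 \<and> zeta_cont s \<noteq> 0}" using z by (auto simp: dist_norm)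
    have "norm ((deriv ^^ k) zeta_log_ext s) \<le> fact k * ((C / c + C) * L ^ 9) / \<eta> ^ k"
    proof (rule Cauchy_inequality)
      show "zeta_log_ext holomorphic_on ball s \<eta>"
        by (rule holomorphic_on_subset[OF zeta_log_ext_holomorphic]) (use sub ball_subset_cball in blast)
      show "continuous_on (cball s \<eta>) zeta_log_ext"
        by (intro holomorphic_on_imp_continuous_on holomorphic_on_subset[OF zeta_log_ext_holomorphic] sub)
    next
      fix w assume "norm (s - w) = \<eta>"
      note w = z[of w, OF eq_refl[OF this]]
      have "norm (zeta_log_ext w) \<le> norm (deriv zeta_ext w) / norm (zeta_ext w) + norm (zeta_ext w)"
        unfolding zeta_log_ext_eq[OF w(1,2,6)]
        by (rule order_trans[OF norm_triangle_ineq4]) (simp add: norm_divide)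
      also have "\<dots> \<le> (C * L ^ 2) / (c / L ^ 7) + C * L"
        using w r L by (intro add_mono frac_le) auto
      also have "(C * L ^ 2) / (c / L ^ 7) = C / c * L ^ 9" using L r by (simp add: field_simps power_add[symmetric])
      also have "C * L \<le> C * L ^ 9" using r L power_increasing[of 1 9 L] by (intro mult_left_mono) auto
      finally show "norm (zeta_log_ext w) \<le> (C / c + C) * L ^ 9" by (simp add: algebra_simps)
    qed (use \<eta> in auto)
    also have "\<dots> = C1 * L ^ (9 * (k + 1))" using L r
      by (simp add: C1_def \<eta>_def power_divide power_add power_mult[symmetric] field_simps)
    finally show ?thesis by (simp add: L_def)
  qed
  \<comment> \<open>Near the real axis compactness suffices: the box includes part of the line Re s
    = 1, where the function is holomorphic because \<open>zeta_cont\<close> has no zero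
    there.\<close>
  define B where "B = cbox (Complex 1 (-1)) (Complex 2 1)"
  have "compact ((deriv ^^ k) zeta_log_ext ` B)"
  proof (rule compact_continuous_image)
    have "(deriv ^^ k) zeta_log_ext holomorphic_on {s. Re s > 0 \<and> zeta_cont s \<noteq> 0}"
      by (rule holomorphic_higher_deriv[OF zeta_log_ext_holomorphic open_zeta_log_ext_domain])
    then show "continuous_on B ((deriv ^^ k) zeta_log_ext)"
      using zeta_cont_nonzero
      by (intro holomorphic_on_imp_continuous_on) (auto simp: B_def in_cbox_complex_iff elim!: holomorphic_on_subset)
  qed (simp add: B_def)
  then obtain C2 where C2: "\<And>s. s \<in> B \<Longrightarrow> norm ((deriv ^^ k) zeta_log_ext s) \<le> C2" 
    by (meson compact_imp_bounded bounded_iff imageI)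
  have "norm (dirichlet_series (\<lambda>n. (mangoldt n - 1) * ln n ^ k) s) \<le> max C1 C2 * log_height (Im s) ^ (9 * (k + 1))"
    if s: "1 < Re s" "Re s \<le> 2" for s
  proof -
    have L: "log_height (Im s) ^ (9 * (k + 1)) \<ge> 1" using log_height_gt_1[of "Im s"] by (intro one_le_power) simp
    have "norm (dirichlet_series (\<lambda>n. (mangoldt n - 1) * ln n ^ k) s) = norm ((deriv ^^ k) zeta_log_ext s)"
      using s by (simp add: zeta_log_ext_higher_deriv norm_mult norm_power)
    also have "\<dots> \<le> max C1 C2 * log_height (Im s) ^ (9 * (k + 1))"
    proof (cases "\<bar>Im s\<bar> \<ge> 3/4")
      case True
      have "C1 * log_height (Im s) ^ (9 * (k + 1)) \<le> max C1 C2 * log_height (Im s) ^ (9 * (k + 1))"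
        using L by (intro mult_right_mono) auto
      then show ?thesis using big[of s] s True by linarith
    next
      case False
      then have "s \<in> B" using s by (auto simp: B_def in_cbox_complex_iff)
      then have "norm ((deriv ^^ k) zeta_log_ext s) \<le> max C1 C2 * 1" using C2 by fastforce
      also have "\<dots> \<le> max C1 C2 * log_height (Im s) ^ (9 * (k + 1))" using L C1 by (intro mult_left_mono) auto
      finally show ?thesis .
    qed
    finally show ?thesis .
  qed
  moreover have "max C1 C2 > 0" using C1 by simp
  ultimately show ?thesis using that by blast
qed

section \<open>A Fourier integral\<close>

text \<open>At v = log(x / n) this is (x / n)^(-\<sigma>) times the positive part of log(x / n), the
  weight that the Perron kernel 1 / s^2 produces.\<close>

definition ramp :: "real \<Rightarrow> real \<Rightarrow> real" where
  "ramp \<sigma> v = max v 0 * exp (- \<sigma> * v)"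

text \<open>Up to the factor \<sigma>^2 the ramp is a probability density, from which its
  integrability will follow.\<close>

lemma ramp_eq_erlang: "\<sigma> > 0 \<Longrightarrow> ramp \<sigma> v = erlang_density 1 \<sigma> v / \<sigma> ^ 2"
  by (auto simp: ramp_def erlang_density_def power2_eq_square)

lemma ramp_integrable:
  assumes "\<sigma> > 0"
  shows "integrable lborel (ramp \<sigma>)"
proof -
  interpret prob_space "density lborel (erlang_density 1 \<sigma>)"
    by (rule prob_space_erlang_density[OF assms])
  have "integrable (density lborel (erlang_density 1 \<sigma>)) (\<lambda>_. 1 :: real)" by (rule integrable_const)
  then have "integrable lborel (erlang_density 1 \<sigma>)"
    using assms by (subst (asm) integrable_real_density) auto
  moreover have "ramp \<sigma> = (\<lambda>v. erlang_density 1 \<sigma> v / \<sigma> ^ 2)"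
    using assms by (simp add: ramp_eq_erlang fun_eq_iff)
  ultimately show ?thesis by simp
qed

lemma ramp_bounds:
  assumes "\<sigma> > 0"
  shows "0 \<le> ramp \<sigma> v" "ramp \<sigma> v \<le> 1 / \<sigma>"
proof -
  show "0 \<le> ramp \<sigma> v" by (simp add: ramp_def)
  show "ramp \<sigma> v \<le> 1 / \<sigma>"
  proof (cases "v > 0")
    case True
    have "\<sigma> * v \<le> exp (\<sigma> * v)" using exp_ge_add_one_self[of "\<sigma> * v"] by linarith
    then show ?thesis using True assms by (simp add: ramp_def exp_minus field_simps)
  qed (use assms in \<open>simp add: ramp_def\<close>)
qed

lemma ramp_laplace:
  assumes \<sigma>: "\<sigma> > 0"
  shows "(LINT v|lborel. of_real (ramp \<sigma> v) * exp (- \<i> * of_real (t * v))) = 1 / Complex \<sigma> t ^ 2"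
proof -
  define s where "s = Complex \<sigma> t"
  have s: "s \<noteq> 0" "Re s = \<sigma>" using \<sigma> by (auto simp: s_def complex_eq_iff)
  \<comment> \<open>An antiderivative of v exp(-s v): it is -1 / s^2 at v = 0 and vanishes at
    infinity.\<close>
  define F where "F v = - (of_real v / s + 1 / s ^ 2) * exp (- s * of_real v)" for v
  define f where "f v = of_real v * exp (- s * of_real v)" for v
  have f_eq: "indicator {0..} v *\<^sub>R f v = of_real (ramp \<sigma> v) * exp (- \<i> * of_real (t * v))" for v
  proof (cases "v \<ge> 0")
    case True
    have "exp (- s * of_real v) = of_real (exp (- \<sigma> * v)) * exp (- \<i> * of_real (t * v))"
      unfolding exp_of_real[symmetric] exp_add[symmetric]
      by (rule arg_cong[where f = exp]) (simp add: s_def complex_eq_iff)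
    then show ?thesis using True by (simp add: f_def ramp_def)
  qed (simp add: ramp_def)
  have int: "integrable lborel (\<lambda>v. indicator {0..} v *\<^sub>R f v)"
    unfolding f_eq
    by (rule Bochner_Integration.integrable_bound[OF ramp_integrable[OF \<sigma>]])
       (auto simp: norm_mult ramp_def)
  have "(LBINT v=0..\<infinity>. f v) = 0 - (- 1 / s ^ 2)"
  proof (rule interval_integral_FTC_integrable)
    fix v
    show "(F has_vector_derivative f v) (at v)"
    proof -
      have "((\<lambda>v. - (v / s + 1 / s ^ 2) * exp (- s * v)) has_field_derivative of_real v * exp (- s * of_real v)) (at (of_real v))"
        using s by (auto intro!: derivative_eq_intros simp: field_simps power2_eq_square)
      from has_vector_derivative_real_field[OF this] show ?thesis by (simp add: F_def[abs_def] f_def)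
    qed
    show "isCont f v" unfolding f_def by (intro continuous_intros)
  next
    have "set_integrable lborel {0..} f" using int by (simp add: set_integrable_def)
    then show "set_integrable lborel (einterval 0 \<infinity>) f"
      by (rule set_integrable_subset) (auto simp: einterval_def)
    have "isCont F 0" unfolding F_def using s by (intro continuous_intros) auto
    then have "(F \<longlongrightarrow> F 0) (at_right 0)" by (simp add: continuous_at filterlim_at_split)
    then show "((F \<circ> real_of_ereal) \<longlongrightarrow> - 1 / s ^ 2) (at_right 0)"
      unfolding zero_ereal_def ereal_tendsto_simps by (simp add: F_def)
    have "(F \<longlongrightarrow> 0) at_top"
    proof (rule Lim_null_comparison)
      show "\<forall>\<^sub>F v in at_top. norm (F v) \<le> (v / norm s + 1 / norm s ^ 2) * exp (- \<sigma> * v)"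
        using eventually_ge_at_top[of 0]
      proof eventually_elim
        case (elim v)
        have "norm (F v) = norm (of_real v / s + 1 / s ^ 2) * exp (- \<sigma> * v)"
          using s by (simp add: F_def norm_mult norm_minus_commute del: minus_add_distrib)
        also have "norm (of_real v / s + 1 / s ^ 2) \<le> v / norm s + 1 / norm s ^ 2"
          using elim norm_triangle_ineq[of "of_real v / s" "1 / s ^ 2"] by (simp add: norm_divide norm_power)
        finally show ?case by simp
      qed
      show "((\<lambda>v. (v / norm s + 1 / norm s ^ 2) * exp (- \<sigma> * v)) \<longlongrightarrow> 0) at_top"
        using \<sigma> s by real_asymp
    qed
    then show "((F \<circ> real_of_ereal) \<longlongrightarrow> 0) (at_left \<infinity>)"
      unfolding ereal_tendsto_simps .
  qed simp
  also have "(LBINT v=0..\<infinity>. f v) = (LBINT v:{0..}. f v)"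
    unfolding interval_lebesgue_integral_0_infty(2) set_lebesgue_integral_def
    by (intro Bochner_Integration.integral_cong) (auto simp: f_def indicator_def)
  finally show ?thesis by (simp add: set_lebesgue_integral_def f_eq s_def)
qed

text \<open>This is the characteristic function of the standard normal distribution, rescaled by x =
  d t.\<close>

lemma fourier_gaussian:
  assumes d: "d > 0"
  shows "integrable lborel (\<lambda>t. exp (- ((d * t) ^ 2) / 2))" (is ?int)
    and "(LINT t|lborel. exp (\<i> * of_real (t * u)) * of_real (exp (- ((d * t) ^ 2) / 2))) =
           of_real (sqrt (2 * pi) / d * exp (- ((u / d) ^ 2) / 2))" (is ?eq)
proof -
  have "integrable lborel (\<lambda>x. sqrt (2 * pi) * std_normal_density (0 + d * x))"
    by (intro integrable_mult_right lborel_integrable_real_affine) (use d integrable_normal_density[of 1 0] in auto)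
  also have "(\<lambda>x. sqrt (2 * pi) * std_normal_density (0 + d * x)) = (\<lambda>t. exp (- ((d * t) ^ 2) / 2))"
    by (simp add: std_normal_density_def fun_eq_iff)
  finally show ?int .
  have "of_real (exp (- ((u / d) ^ 2) / 2)) = char std_normal_distribution (u / d)"
    by (simp add: char_std_normal_distribution)
  also have "\<dots> = (LINT x|lborel. std_normal_density x *\<^sub>R iexp (u / d * x))"
    unfolding char_def by (rule integral_density) auto
  also have "\<dots> = \<bar>d\<bar> *\<^sub>R (LINT t|lborel. std_normal_density (0 + d * t) *\<^sub>R iexp (u / d * (0 + d * t)))"
    by (rule lborel_integral_real_affine) (use d in auto)
  also have "(\<lambda>t. std_normal_density (0 + d * t) *\<^sub>R iexp (u / d * (0 + d * t))) =
      (\<lambda>t. of_real (1 / sqrt (2 * pi)) * (exp (\<i> * of_real (t * u)) * of_real (exp (- ((d * t) ^ 2) / 2))))"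
    using d by (auto simp: fun_eq_iff std_normal_density_def scaleR_conv_of_real mult_ac)
  also have "(LINT t|lborel. \<dots> t) = of_real (1 / sqrt (2 * pi)) * (LINT t|lborel. exp (\<i> * of_real (t * u)) * of_real (exp (- ((d * t) ^ 2) / 2)))"
    by (rule integral_mult_right_zero)
  finally have "of_real (exp (- ((u / d) ^ 2) / 2)) = of_real (d / sqrt (2 * pi)) *
     (LINT t|lborel. exp (\<i> * of_real (t * u)) * of_real (exp (- ((d * t) ^ 2) / 2)))"
    using d by (simp add: scaleR_conv_of_real mult_ac)
  then have "of_real (sqrt (2 * pi) / d) * of_real (exp (- ((u / d) ^ 2) / 2)) = 
     of_real (sqrt (2 * pi) / d) * (of_real (d / sqrt (2 * pi)) *
     (LINT t|lborel. exp (\<i> * of_real (t * u)) * of_real (exp (- ((d * t) ^ 2) / 2))))" by simp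
  then show ?eq using d by (simp only: mult.assoc[symmetric] of_real_mult[symmetric]) simp
qed

lemma norm_Complex_power2: "norm (Complex \<sigma> t ^ 2) = \<sigma> ^ 2 + t ^ 2"
  unfolding norm_power by (simp add: cmod_def)

lemma measurable_Complex[measurable]: "Complex \<sigma> \<in> borel_measurable borel"
  by (intro borel_measurable_continuous_onI) (simp add: Complex_eq, intro continuous_intros)

text \<open>The damping by the Gaussian makes the double integral absolutely convergent, so the
  order of integration may be exchanged. The inner integral is then a Gaussian in w - v of width d,
  and what remains is the mean of the ramp over normally distributed points around w.\<close>

lemma fourier_smoothed_ramp:
  assumes \<sigma>: "\<sigma> > 0" and d: "d > 0"
  shows "(LINT t|lborel. exp (\<i> * of_real (t * w)) / Complex \<sigma> t ^ 2 * of_real (exp (- ((d * t) ^ 2) / 2))) =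
     of_real (2 * pi * (LINT z|lborel. ramp \<sigma> (w + d * z) * std_normal_density z))"
proof -
  define g where "g t = exp (- ((d * t) ^ 2) / 2)" for t
  have g_meas[measurable]: "g \<in> borel_measurable borel" unfolding g_def by measurable
  have r_meas[measurable]: "ramp \<sigma> \<in> borel_measurable borel" unfolding ramp_def by measurable
  define f where "f t v = of_real (ramp \<sigma> v) * exp (\<i> * of_real (t * (w - v))) * of_real (g t)" for t v
  have nf: "norm (f t v) = ramp \<sigma> v * g t" for t v
    using ramp_bounds[OF \<sigma>] by (simp add: f_def norm_mult g_def)
  have gi: "integrable lborel g" unfolding g_def by (rule fourier_gaussian[OF d])
  have ri: "integrable lborel (ramp \<sigma>)" by (rule ramp_integrable[OF \<sigma>])
  have fm: "case_prod f \<in> borel_measurable (lborel \<Otimes>\<^sub>M lborel)" unfolding f_def by measurable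
  have fi: "integrable (lborel \<Otimes>\<^sub>M lborel) (case_prod f)"
  proof (rule lborel_pair.Fubini_integrable[OF fm])
    show "integrable lborel (\<lambda>x. LINT y|lborel. norm (case (x, y) of (t, v) \<Rightarrow> f t v))"
      using gi by (simp add: nf)
    show "AE x in lborel. integrable lborel (\<lambda>y. case (x, y) of (t, v) \<Rightarrow> f t v)"
    proof (rule AE_I2)
      fix x
      have "integrable lborel (\<lambda>y. ramp \<sigma> y * g x)" using ri by simp
      then show "integrable lborel (\<lambda>y. case (x, y) of (t, v) \<Rightarrow> f t v)"
      proof (rule Bochner_Integration.integrable_bound)
        show "(\<lambda>y. case (x, y) of (t, v) \<Rightarrow> f t v) \<in> borel_measurable lborel"
          unfolding f_def by simp
      qed (simp add: nf)
    qed
  qed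
  have "(LINT v|lborel. f t v) = exp (\<i> * of_real (t * w)) / Complex \<sigma> t ^ 2 * of_real (g t)" for t
  proof -
    have "f t v = (exp (\<i> * of_real (t * w)) * of_real (g t)) * (of_real (ramp \<sigma> v) * exp (- \<i> * of_real (t * v)))" for v
    proof -
      have "exp (\<i> * of_real (t * (w - v))) = exp (\<i> * of_real (t * w)) * exp (- \<i> * of_real (t * v))"
        unfolding exp_add[symmetric] by (rule arg_cong[where f = exp]) (simp add: algebra_simps)
      then show ?thesis by (simp add: f_def)
    qed
    then show ?thesis using ramp_laplace[OF \<sigma>, of t] by simp
  qed
  then have "(LINT t|lborel. exp (\<i> * of_real (t * w)) / Complex \<sigma> t ^ 2 * of_real (g t)) =
      (LINT t|lborel. LINT v|lborel. f t v)" by simp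
  also have "\<dots> = (LINT v|lborel. LINT t|lborel. f t v)"
    by (rule lborel_pair.Fubini_integral[OF fi, symmetric])
  also have "\<dots> = (LINT v|lborel. of_real (ramp \<sigma> v * (sqrt (2 * pi) / d * exp (- (((w - v) / d) ^ 2) / 2))))"
  proof (rule Bochner_Integration.integral_cong[OF refl])
    fix v
    have "(LINT t|lborel. f t v) = of_real (ramp \<sigma> v) * (LINT t|lborel. exp (\<i> * of_real (t * (w - v))) * of_real (g t))"
      by (simp add: f_def mult.assoc)
    then show "(LINT t|lborel. f t v) = of_real (ramp \<sigma> v * (sqrt (2 * pi) / d * exp (- (((w - v) / d) ^ 2) / 2)))"
      using fourier_gaussian(2)[OF d, of "w - v"] by (simp add: g_def)
  qed
  also have "\<dots> = of_real (LINT v|lborel. ramp \<sigma> v * (sqrt (2 * pi) / d * exp (- (((w - v) / d) ^ 2) / 2)))"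
    by (rule integral_complex_of_real)
  also have "(LINT v|lborel. ramp \<sigma> v * (sqrt (2 * pi) / d * exp (- (((w - v) / d) ^ 2) / 2))) =
    \<bar>d\<bar> *\<^sub>R (LINT z|lborel. ramp \<sigma> (w + d * z) * (sqrt (2 * pi) / d * exp (- (((w - (w + d * z)) / d) ^ 2) / 2)))"
    by (rule lborel_integral_real_affine) (use d in auto)
  also have "(\<lambda>z. ramp \<sigma> (w + d * z) * (sqrt (2 * pi) / d * exp (- (((w - (w + d * z)) / d) ^ 2) / 2))) =
    (\<lambda>z. 2 * pi / d * (ramp \<sigma> (w + d * z) * std_normal_density z))"
  proof
    fix z
    have "sqrt (2 * pi) / d * exp (- (((w - (w + d * z)) / d) ^ 2) / 2) = 2 * pi / d * std_normal_density z"
      using d real_sqrt_mult_self[of "2 * pi"] by (simp add: std_normal_density_def field_simps)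
    then show "ramp \<sigma> (w + d * z) * (sqrt (2 * pi) / d * exp (- (((w - (w + d * z)) / d) ^ 2) / 2)) =
        2 * pi / d * (ramp \<sigma> (w + d * z) * std_normal_density z)"
      by (simp only: mult.left_commute[of "ramp \<sigma> (w + d * z)"])
  qed
  finally show ?thesis using d by (simp add: g_def)
qed

text \<open>The exponent is 1/2 - 2: half a power of |t| will be spent on powers of log |t|, the -2
  comes from the kernel 1 / s^2.\<close>

lemma integrable_abs_plus_4_powr: "integrable lborel (\<lambda>t::real. (\<bar>t\<bar> + 4) powr (- 3 / 2))"
proof -
  define f where "f x = indicator {4..} x *\<^sub>R x powr (- 3 / 2)" for x :: real
  have "((\<lambda>x. x powr (- 3 / 2)) has_integral - (4 powr (- 3 / 2 + 1)) / (- 3 / 2 + 1)) {4::real..}"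
    by (rule has_integral_powr_to_inf) auto
  then have "(\<lambda>x. x powr (- 3 / 2)) integrable_on {4::real..}" by blast
  then have "(\<lambda>x. x powr (- 3 / 2)) absolutely_integrable_on {4::real..}"
    by (rule nonnegative_absolutely_integrable_1) auto
  then have "integrable lebesgue f" by (simp add: set_integrable_def f_def[abs_def])
  then have f: "integrable lborel f"
    by (subst (asm) integrable_completion) (auto simp: f_def[abs_def])
  \<comment> \<open>The integrable tail over x \<ge> 4 is translated and reflected: the first
    summand covers t \<ge> 0, the second t \<le> 0.\<close>
  have "integrable lborel (\<lambda>t. f (4 + 1 * t) + f (4 + (- 1) * t))"
    by (intro Bochner_Integration.integrable_add lborel_integrable_real_affine f) auto
  then show ?thesis
    by (rule Bochner_Integration.integrable_bound) (auto simp: f_def abs_if indicator_def add.commute)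
qed

lemma inverse_square_le_powr:
  fixes \<sigma> t :: real
  assumes "\<sigma> \<ge> 1"
  shows "1 / (\<sigma> ^ 2 + t ^ 2) \<le> 32 * (\<bar>t\<bar> + 4) powr (- 2)"
proof -
  have "(\<bar>t\<bar> + 4) ^ 2 + (\<bar>t\<bar> - 4) ^ 2 = 2 * t ^ 2 + 32"
    by (simp add: power2_eq_square algebra_simps)
  then have "(\<bar>t\<bar> + 4) ^ 2 \<le> 32 * (1 ^ 2 + t ^ 2)"
    using zero_le_power2[of "\<bar>t\<bar> - 4"] zero_le_power2[of t] by (simp only: power_one distrib_left)
  also have "\<dots> \<le> 32 * (\<sigma> ^ 2 + t ^ 2)"
    using assms power_mono[of 1 \<sigma> 2] by simp
  finally have "1 / (\<sigma> ^ 2 + t ^ 2) \<le> 32 / (\<bar>t\<bar> + 4) ^ 2"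
    using assms by (simp add: field_simps add_pos_nonneg)
  also have "\<dots> = 32 * (\<bar>t\<bar> + 4) powr (- 2)"
    by (simp add: powr_minus divide_inverse)
  finally show ?thesis .
qed

text \<open>The Fourier transform of \<open>ramp \<sigma>\<close> is \<open>1 / (\<sigma> + i t)\<^sup>2\<close>; it is inverted by damping with the
  Gaussian \<open>exp (- (d t)\<^sup>2 / 2)\<close>, whose transform is known, and letting \<open>d\<close> tend to \<open>0\<close>.\<close>

lemma fourier_ramp:
  assumes \<sigma>: "\<sigma> \<ge> 1"
  shows "(LINT t|lborel. exp (\<i> * of_real (t * w)) / Complex \<sigma> t ^ 2) = of_real (2 * pi * ramp \<sigma> w)"
proof (rule LIMSEQ_unique)
  define d where "d n = 1 / real (Suc n)" for n
  have d: "d n > 0" for n by (simp add: d_def)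
  have d0: "d \<longlonglongrightarrow> 0" unfolding d_def by (rule LIMSEQ_Suc[OF lim_1_over_n])
  let ?f = "\<lambda>n. LINT t|lborel. exp (\<i> * of_real (t * w)) / Complex \<sigma> t ^ 2 * of_real (exp (- ((d n * t) ^ 2) / 2))"
  show "?f \<longlonglongrightarrow> (LINT t|lborel. exp (\<i> * of_real (t * w)) / Complex \<sigma> t ^ 2)"
  proof (rule integral_dominated_convergence)
    show "integrable lborel (\<lambda>t::real. 32 * (\<bar>t\<bar> + 4) powr (- 3 / 2))"
      by (intro integrable_mult_right integrable_abs_plus_4_powr)
    show "AE t in lborel. (\<lambda>n. exp (\<i> * of_real (t * w)) / Complex \<sigma> t ^ 2 * of_real (exp (- ((d n * t) ^ 2) / 2)))
       \<longlonglongrightarrow> exp (\<i> * of_real (t * w)) / Complex \<sigma> t ^ 2"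
    proof (rule AE_I2)
      fix t
      have "(\<lambda>n. exp (\<i> * of_real (t * w)) / Complex \<sigma> t ^ 2 * of_real (exp (- ((d n * t) ^ 2) / 2)))
       \<longlonglongrightarrow> exp (\<i> * of_real (t * w)) / Complex \<sigma> t ^ 2 * of_real (exp (- ((0 * t) ^ 2) / 2))"
        by (intro tendsto_intros d0) auto
      then show "(\<lambda>n. exp (\<i> * of_real (t * w)) / Complex \<sigma> t ^ 2 * of_real (exp (- ((d n * t) ^ 2) / 2)))
       \<longlonglongrightarrow> exp (\<i> * of_real (t * w)) / Complex \<sigma> t ^ 2" by simp
    qed
    fix n
    show "AE t in lborel. norm (exp (\<i> * of_real (t * w)) / Complex \<sigma> t ^ 2 * of_real (exp (- ((d n * t) ^ 2) / 2)))
       \<le> 32 * (\<bar>t\<bar> + 4) powr (- 3 / 2)"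
    proof (rule AE_I2)
      fix t
      have "norm (exp (\<i> * of_real (t * w)) / Complex \<sigma> t ^ 2 * of_real (exp (- ((d n * t) ^ 2) / 2)))
        = 1 / (\<sigma> ^ 2 + t ^ 2) * exp (- ((d n * t) ^ 2) / 2)"
        by (simp add: norm_mult norm_divide norm_Complex_power2)
      also have "\<dots> \<le> 1 / (\<sigma> ^ 2 + t ^ 2) * 1" by (intro mult_left_mono) auto
      also have "\<dots> \<le> 32 * (\<bar>t\<bar> + 4) powr (- 2)" using inverse_square_le_powr[OF \<sigma>, of t] by simp
      also have "\<dots> \<le> 32 * (\<bar>t\<bar> + 4) powr (- 3 / 2)" by (intro mult_left_mono powr_mono) auto
      finally show "norm (exp (\<i> * of_real (t * w)) / Complex \<sigma> t ^ 2 * of_real (exp (- ((d n * t) ^ 2) / 2)))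
       \<le> 32 * (\<bar>t\<bar> + 4) powr (- 3 / 2)" .
    qed
  qed auto
  \<comment> \<open>The ramp is continuous and bounded by 1 / \<sigma>, so its Gaussian means around
    w tend to its value at w when the width tends to 0.\<close>
  have "(\<lambda>n. LINT z|lborel. ramp \<sigma> (w + d n * z) * std_normal_density z) \<longlonglongrightarrow>
     (LINT z|lborel. ramp \<sigma> w * std_normal_density z)"
  proof (rule integral_dominated_convergence)
    show "integrable lborel (\<lambda>z. 1 / \<sigma> * std_normal_density z)"
      using integrable_normal_density[of 1 0] by simp
    show "AE z in lborel. (\<lambda>n. ramp \<sigma> (w + d n * z) * std_normal_density z) \<longlonglongrightarrow> ramp \<sigma> w * std_normal_density z"
    proof (rule AE_I2)
      fix z
      have "(\<lambda>n. ramp \<sigma> (w + d n * z) * std_normal_density z) \<longlonglongrightarrow> ramp \<sigma> (w + 0 * z) * std_normal_density z"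
        unfolding ramp_def by (intro tendsto_intros d0)
      then show "(\<lambda>n. ramp \<sigma> (w + d n * z) * std_normal_density z) \<longlonglongrightarrow> ramp \<sigma> w * std_normal_density z" by simp
    qed
    show "AE z in lborel. norm (ramp \<sigma> (w + d n * z) * std_normal_density z) \<le> 1 / \<sigma> * std_normal_density z" for n
    proof (rule AE_I2)
      fix z
      show "norm (ramp \<sigma> (w + d n * z) * std_normal_density z) \<le> 1 / \<sigma> * std_normal_density z"
        using mult_right_mono[OF ramp_bounds(2)[of \<sigma> "w + d n * z"], of "std_normal_density z"]
          ramp_bounds(1)[of \<sigma> "w + d n * z"] \<sigma> by (simp add: abs_mult)
    qed
  qed (auto simp: ramp_def)
  also have "(LINT z|lborel. ramp \<sigma> w * std_normal_density z) = ramp \<sigma> w"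
    using integral_normal_density[of 1 0] by simp
  finally have "(\<lambda>n. complex_of_real (2 * pi * (LINT z|lborel. ramp \<sigma> (w + d n * z) * std_normal_density z)))
      \<longlonglongrightarrow> of_real (2 * pi * ramp \<sigma> w)" by (intro tendsto_intros)
  then show "?f \<longlonglongrightarrow> of_real (2 * pi * ramp \<sigma> w)"
    by (simp only: fourier_smoothed_ramp[OF less_le_trans[OF zero_less_one \<sigma>] d])
qed

section \<open>Perron summation\<close>

lemma log_height_power_le:
  obtains C where "C > 0" "\<And>t. log_height t ^ m \<le> C * (\<bar>t\<bar> + 4) powr (1 / 2)"
proof -
  \<comment> \<open>Chosen so that m + 1 factors of exponent \<epsilon> amount to 1/2; counting m +
    1 factors also covers m = 0.\<close>
  define \<epsilon> :: real where "\<epsilon> = 1 / (2 * real (Suc m))"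
  have \<epsilon>: "\<epsilon> > 0" by (simp add: \<epsilon>_def)
  have "log_height t ^ m \<le> (1 / \<epsilon>) ^ Suc m * (\<bar>t\<bar> + 4) powr (1 / 2)" for t
  proof -
    have L: "log_height t > 1" by (rule log_height_gt_1)
    have pos: "\<bar>t\<bar> + 4 > 0" by linarith
    have "\<epsilon> * log_height t = ln ((\<bar>t\<bar> + 4) powr \<epsilon>)" by (simp add: log_height_def ln_powr)
    also have "\<dots> \<le> (\<bar>t\<bar> + 4) powr \<epsilon>" using ln_le_minus_one[of "(\<bar>t\<bar> + 4) powr \<epsilon>"] pos by simp
    finally have "log_height t \<le> 1 / \<epsilon> * (\<bar>t\<bar> + 4) powr \<epsilon>" using \<epsilon> by (simp add: field_simps)
    then have "log_height t ^ Suc m \<le> (1 / \<epsilon> * (\<bar>t\<bar> + 4) powr \<epsilon>) ^ Suc m"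
      using L by (intro power_mono) auto
    also have "\<dots> = (1 / \<epsilon>) ^ Suc m * ((\<bar>t\<bar> + 4) powr \<epsilon>) ^ Suc m" by (rule power_mult_distrib)
    also have "((\<bar>t\<bar> + 4) powr \<epsilon>) ^ Suc m = (\<bar>t\<bar> + 4) powr (\<epsilon> * real (Suc m))"
      by (subst powr_realpow[symmetric]) (simp_all add: powr_powr)
    also have "\<epsilon> * real (Suc m) = 1 / 2" by (simp add: \<epsilon>_def del: of_nat_Suc)
    finally have "log_height t ^ Suc m \<le> (1 / \<epsilon>) ^ Suc m * (\<bar>t\<bar> + 4) powr (1 / 2)" .
    moreover have "log_height t ^ m \<le> log_height t ^ Suc m" using L by (intro power_increasing) auto
    ultimately show ?thesis by linarith
  qed
  then show ?thesis using that[of "(1 / \<epsilon>) ^ Suc m"] \<epsilon> by simp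
qed

text \<open>For x \<ge> 1 this is the integral of the partial sums of \<open>a\<close> over [1, x]
  against du / u. This much smoothing corresponds to the kernel 1 / s^2, which is absolutely
  integrable on vertical lines, in place of 1 / s.\<close>

definition log_sum :: "(nat \<Rightarrow> real) \<Rightarrow> real \<Rightarrow> real" where
  "log_sum a x = (\<Sum>n=1..nat \<lfloor>x\<rfloor>. a n * (ln x - ln (real n)))"

text \<open>Fourier inversion is applied term by term at log(x / n). The ramp vanishes for n > x and
  so cuts off the series, and n^(-\<sigma>) (x / n)^(-\<sigma>) = x^(-\<sigma>) no longer depends on
  n.\<close>

lemma perron_ramp:
  assumes a: "dirichlet_admissible a" and \<sigma>: "\<sigma> > 1" and x: "x \<ge> 1"
  shows "(LINT t|lborel. dirichlet_series a (Complex \<sigma> t) * (exp (\<i> * of_real (t * ln x)) / Complex \<sigma> t ^ 2)) =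
    of_real (2 * pi * x powr (- \<sigma>) * log_sum a x)"
proof -
  define f where "f n t = of_real (a n) * of_nat n powr (- Complex \<sigma> t) * (exp (\<i> * of_real (t * ln x)) / Complex \<sigma> t ^ 2)"
    for n t
  define K where "K t = 1 / (\<sigma> ^ 2 + t ^ 2)" for t
  have nf: "norm (f n t) = (\<bar>a n\<bar> * real n powr (- \<sigma>)) * K t" for n t
    using norm_of_nat_powr[of n "- Complex \<sigma> t"]
    by (simp add: f_def norm_mult norm_divide norm_Complex_power2 K_def)
  have Ki: "integrable lborel K"
  proof (rule Bochner_Integration.integrable_bound)
    show "integrable lborel (\<lambda>t::real. 32 * (\<bar>t\<bar> + 4) powr (- 3 / 2))"
      by (intro integrable_mult_right integrable_abs_plus_4_powr)
    show "AE t in lborel. norm (K t) \<le> norm (32 * (\<bar>t\<bar> + 4) powr (- 3 / 2))"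
    proof (rule AE_I2)
      fix t
      have "K t \<le> 32 * (\<bar>t\<bar> + 4) powr (- 2)" unfolding K_def using \<sigma> by (intro inverse_square_le_powr) auto
      also have "\<dots> \<le> 32 * (\<bar>t\<bar> + 4) powr (- 3 / 2)" by (intro mult_left_mono powr_mono) auto
      finally show "norm (K t) \<le> norm (32 * (\<bar>t\<bar> + 4) powr (- 3 / 2))" by (simp add: K_def)
    qed
  qed (simp add: K_def[abs_def])
  have f_alt: "f n t = (of_real (a n) * of_nat n powr (- of_real \<sigma>)) * (exp (\<i> * of_real (t * (ln x - ln (real n)))) / Complex \<sigma> t ^ 2)" for n t
  proof (cases "n = 0")
    case False
    have "of_nat n powr (- Complex \<sigma> t) * exp (\<i> * of_real (t * ln x)) =
        exp (- Complex \<sigma> t * of_real (ln (real n)) + \<i> * of_real (t * ln x))"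
      using False by (simp add: powr_def Ln_of_nat flip: exp_add)
    also have "- Complex \<sigma> t * of_real (ln (real n)) + \<i> * of_real (t * ln x) =
        - of_real \<sigma> * of_real (ln (real n)) + \<i> * of_real (t * (ln x - ln (real n)))"
      by (simp add: complex_eq_iff algebra_simps)
    also have "exp \<dots> = of_nat n powr (- of_real \<sigma>) * exp (\<i> * of_real (t * (ln x - ln (real n))))"
      using False by (simp add: powr_def Ln_of_nat flip: exp_add)
    finally show ?thesis by (simp add: f_def)
  qed (simp add: f_def)
  have fm: "f n \<in> borel_measurable lborel" for n
    unfolding f_alt[abs_def] by measurable
  have fi: "integrable lborel (f n)" for n
    by (rule Bochner_Integration.integrable_bound[OF integrable_mult_right[OF Ki, of "\<bar>a n\<bar> * real n powr (- \<sigma>)"] fm])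
       (auto simp: nf)
  have "(\<lambda>n. integral\<^sup>L lborel (f n)) sums (LINT t|lborel. (\<Sum>n. f n t))"
  proof (rule sums_integral[OF fi])
    show "AE t in lborel. summable (\<lambda>n. norm (f n t))"
      unfolding nf using a \<sigma> by (intro AE_I2 summable_mult2) (simp add: dirichlet_admissible_def)
    show "summable (\<lambda>n. LINT t|lborel. norm (f n t))"
      unfolding nf using a \<sigma> by (simp add: dirichlet_admissible_def summable_mult2)
  qed
  also have "(\<lambda>t. \<Sum>n. f n t) = (\<lambda>t. dirichlet_series a (Complex \<sigma> t) * (exp (\<i> * of_real (t * ln x)) / Complex \<sigma> t ^ 2))"
  proof
    fix t
    show "(\<Sum>n. f n t) = dirichlet_series a (Complex \<sigma> t) * (exp (\<i> * of_real (t * ln x)) / Complex \<sigma> t ^ 2)"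
      using sums_mult2[OF dirichlet_series_sums[OF a, of "Complex \<sigma> t"], of "exp (\<i> * of_real (t * ln x)) / Complex \<sigma> t ^ 2"] \<sigma>
      by (simp add: f_def sums_iff)
  qed
  finally have 1: "(\<lambda>n. integral\<^sup>L lborel (f n)) sums (LINT t|lborel. dirichlet_series a (Complex \<sigma> t) * (exp (\<i> * of_real (t * ln x)) / Complex \<sigma> t ^ 2))" .
  have int: "integral\<^sup>L lborel (f n) = of_real (2 * pi * x powr (- \<sigma>) * (a n * max (ln x - ln (real n)) 0))" if n: "n > 0" for n
  proof -
    have "integral\<^sup>L lborel (f n) = (of_real (a n) * of_nat n powr (- of_real \<sigma>)) * of_real (2 * pi * ramp \<sigma> (ln x - ln (real n)))"
      by (simp only: f_alt[abs_def] integral_mult_right_zero fourier_ramp[OF less_imp_le[OF \<sigma>]])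
    also have "of_nat n powr (- of_real \<sigma>) = complex_of_real (real n powr (- \<sigma>))"
      using powr_of_real[of "real n" "- \<sigma>"] by simp
    also have "of_real (a n) * complex_of_real (real n powr (- \<sigma>)) * of_real (2 * pi * ramp \<sigma> (ln x - ln (real n))) =
        of_real (a n * (real n powr (- \<sigma>) * (2 * pi * ramp \<sigma> (ln x - ln (real n)))))" by simp
    also have "real n powr (- \<sigma>) * (2 * pi * ramp \<sigma> (ln x - ln (real n))) =
        2 * pi * max (ln x - ln (real n)) 0 * (exp (- \<sigma> * ln (real n)) * exp (- \<sigma> * (ln x - ln (real n))))"
      using n by (simp add: ramp_def powr_def)
    also have "exp (- \<sigma> * ln (real n)) * exp (- \<sigma> * (ln x - ln (real n))) = x powr (- \<sigma>)"
      using x by (simp add: exp_add[symmetric] powr_def algebra_simps)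
    finally show ?thesis by (simp add: mult_ac)
  qed
  have int0: "integral\<^sup>L lborel (f 0) = 0" by (simp add: f_def[abs_def])
  have zero: "integral\<^sup>L lborel (f n) = 0" if "n \<notin> {1..nat \<lfloor>x\<rfloor>}" for n
  proof (cases "n = 0")
    case False
    then have "real n > x" using that by (simp add: not_le) linarith
    then have "ln x \<le> ln (real n)" using x by simp
    then show ?thesis using int[of n] False by simp
  qed (simp add: int0)
  have "(\<Sum>n. integral\<^sup>L lborel (f n)) = (\<Sum>n=1..nat \<lfloor>x\<rfloor>. integral\<^sup>L lborel (f n))"
    by (rule suminf_finite) (use zero in auto)
  also have "\<dots> = (\<Sum>n=1..nat \<lfloor>x\<rfloor>. of_real (2 * pi * x powr (- \<sigma>) * (a n * (ln x - ln (real n)))))"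
  proof (rule sum.cong[OF refl])
    fix n assume n: "n \<in> {1..nat \<lfloor>x\<rfloor>}"
    then have "real n \<le> x" using x by (simp add: le_nat_iff le_floor_iff)
    then have "ln (real n) \<le> ln x" using n x by simp
    then show "integral\<^sup>L lborel (f n) = of_real (2 * pi * x powr (- \<sigma>) * (a n * (ln x - ln (real n))))"
      using int[of n] n by simp
  qed
  also have "\<dots> = of_real (2 * pi * x powr (- \<sigma>) * log_sum a x)"
    by (simp add: log_sum_def sum_distrib_left)
  finally show ?thesis using 1 by (simp add: sums_iff)
qed

text \<open>A non-integrable \<open>f\<close> has integral 0 by convention, so a bound by an
  integrable majorant is enough; this spares a measurability proof for Dirichlet series on vertical
  lines.\<close>

lemma norm_integral_le:
  fixes f :: "real \<Rightarrow> complex"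
  assumes g: "integrable lborel g" and le: "\<And>x. norm (f x) \<le> g x"
  shows "norm (integral\<^sup>L lborel f) \<le> integral\<^sup>L lborel g"
proof (cases "integrable lborel f")
  case True
  have "norm (integral\<^sup>L lborel f) \<le> (LINT x|lborel. norm (f x))" by (rule integral_norm_bound)
  also have "\<dots> \<le> integral\<^sup>L lborel g" using True g le by (intro integral_mono) auto
  finally show ?thesis .
next
  case False
  have "g x \<ge> 0" for x using le[of x] norm_ge_zero[of "f x"] by linarith
  then show ?thesis using False by (simp add: not_integrable_integral_eq integral_nonneg_AE)
qed

text \<open>Powers of log |t| are absorbed by |t|^(1/2), so the integrals over the lines Re s =
  \<sigma> with 1 < \<sigma> \<le> 2 have a common bound B. For fixed x the resulting estimate B
  x^\<sigma> survives the limit as \<sigma> tends to 1.\<close>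

lemma log_sum_mangoldt_bound:
  obtains C where "C > 0" "\<And>x. x \<ge> 1 \<Longrightarrow> \<bar>log_sum (\<lambda>n. (mangoldt n - 1) * ln n ^ k) x\<bar> \<le> C * x"
proof -
  define a where "a n = (mangoldt n - 1) * ln (real n) ^ k" for n
  have a: "dirichlet_admissible a" unfolding a_def[abs_def]
    by (rule dirichlet_admissible_ln_power[OF dirichlet_admissible_mangoldt_minus_1])
  obtain C1 where C1: "C1 > 0" "\<And>s. 1 < Re s \<Longrightarrow> Re s \<le> 2 \<Longrightarrow>
    norm (dirichlet_series a s) \<le> C1 * log_height (Im s) ^ (9 * (k + 1))"
    using mangoldt_dirichlet_bound[of k] unfolding a_def[abs_def] by blast
  obtain C2 where C2: "C2 > 0" "\<And>t. log_height t ^ (9 * (k + 1)) \<le> C2 * (\<bar>t\<bar> + 4) powr (1 / 2)"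
    using log_height_power_le[of "9 * (k + 1)"] by blast
  define B where "B = (LINT t|lborel. C1 * C2 * 32 * (\<bar>t\<bar> + 4) powr (- 3 / 2))"
  have Bi: "integrable lborel (\<lambda>t::real. C1 * C2 * 32 * (\<bar>t\<bar> + 4) powr (- 3 / 2))"
    by (intro integrable_mult_right integrable_abs_plus_4_powr)
  have B0: "B \<ge> 0" unfolding B_def using C1 C2 by (intro integral_nonneg_AE AE_I2) auto
  have *: "\<bar>log_sum a x\<bar> \<le> B * x powr \<sigma>" if x: "x \<ge> 1" and \<sigma>: "1 < \<sigma>" "\<sigma> \<le> 2" for x \<sigma>
  proof -
    have "norm (complex_of_real (2 * pi * x powr (- \<sigma>) * log_sum a x)) \<le> B"
      unfolding perron_ramp[OF a \<sigma>(1) x, symmetric] B_def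
    proof (rule norm_integral_le)
      show "integrable lborel (\<lambda>t. C1 * C2 * 32 * (\<bar>t\<bar> + 4) powr (- 3 / 2))" by (rule Bi)
      fix t
      have "norm (dirichlet_series a (Complex \<sigma> t) * (exp (\<i> * of_real (t * ln x)) / Complex \<sigma> t ^ 2)) =
        norm (dirichlet_series a (Complex \<sigma> t)) * (1 / (\<sigma> ^ 2 + t ^ 2))"
        by (simp add: norm_mult norm_divide norm_Complex_power2)
      also have "\<dots> \<le> (C1 * (C2 * (\<bar>t\<bar> + 4) powr (1 / 2))) * (32 * (\<bar>t\<bar> + 4) powr (- 2))"
      proof (intro mult_mono inverse_square_le_powr)
        have "norm (dirichlet_series a (Complex \<sigma> t)) \<le> C1 * log_height t ^ (9 * (k + 1))"
          using C1(2)[of "Complex \<sigma> t"] \<sigma> by simp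
        also have "\<dots> \<le> C1 * (C2 * (\<bar>t\<bar> + 4) powr (1 / 2))" using C1(1) C2(2)[of t] by (intro mult_left_mono) auto
        finally show "norm (dirichlet_series a (Complex \<sigma> t)) \<le> C1 * (C2 * (\<bar>t\<bar> + 4) powr (1 / 2))" .
      qed (use C1 C2 \<sigma> in auto)
      also have "\<dots> = C1 * C2 * 32 * ((\<bar>t\<bar> + 4) powr (1 / 2) * (\<bar>t\<bar> + 4) powr (- 2))" by simp
      also have "(\<bar>t\<bar> + 4) powr (1 / 2) * (\<bar>t\<bar> + 4) powr (- 2) = (\<bar>t\<bar> + 4) powr (- 3 / 2)"
        by (simp add: powr_add[symmetric])
      finally show "norm (dirichlet_series a (Complex \<sigma> t) * (exp (\<i> * of_real (t * ln x)) / Complex \<sigma> t ^ 2))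
        \<le> C1 * C2 * 32 * (\<bar>t\<bar> + 4) powr (- 3 / 2)" .
    qed
    then have "2 * pi * x powr (- \<sigma>) * \<bar>log_sum a x\<bar> \<le> B" by (simp add: norm_mult abs_mult)
    moreover have "1 * (x powr (- \<sigma>) * \<bar>log_sum a x\<bar>) \<le> 2 * pi * (x powr (- \<sigma>) * \<bar>log_sum a x\<bar>)"
      using pi_gt3 by (intro mult_right_mono) auto
    ultimately have "x powr (- \<sigma>) * \<bar>log_sum a x\<bar> \<le> B" by (simp add: mult.assoc)
    then show ?thesis using x by (simp add: powr_minus field_simps)
  qed
  have "\<bar>log_sum a x\<bar> \<le> (B + 1) * x" if x: "x \<ge> 1" for x
  proof -
    have "\<bar>log_sum a x\<bar> \<le> B * x"
    proof (rule tendsto_lowerbound)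
      have "(\<lambda>n. B * x powr (1 + 1 / real (Suc n))) \<longlonglongrightarrow> B * x powr (1 + 0)"
        using x by (intro tendsto_intros LIMSEQ_Suc[OF lim_1_over_n]) auto
      then show "(\<lambda>n. B * x powr (1 + 1 / real (Suc n))) \<longlonglongrightarrow> B * x" using x by simp
      show "\<forall>\<^sub>F n in sequentially. \<bar>log_sum a x\<bar> \<le> B * x powr (1 + 1 / real (Suc n))"
        by (intro always_eventually allI *) (use x in auto)
    qed simp
    also have "\<dots> \<le> (B + 1) * x" using x by simp
    finally show ?thesis .
  qed
  then show ?thesis using that[of "B + 1"] B0 by (simp add: a_def[abs_def])
qed

section \<open>Removing the smoothing\<close>

definition partial_sum :: "(nat \<Rightarrow> real) \<Rightarrow> real \<Rightarrow> real" where
  "partial_sum c x = (\<Sum>n=1..nat \<lfloor>x\<rfloor>. c n)"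

text \<open>\<open>log_sum c\<close> is the integral of \<open>partial_sum c\<close> against du / u,
  and for nonnegative coefficients the partial sums increase; the two bounds use their values at the
  ends of [x, y].\<close>

lemma log_sum_diff_bounds:
  assumes c: "\<And>n. c n \<ge> 0" and xy: "1 \<le> x" "x \<le> y"
  shows "(ln y - ln x) * partial_sum c x \<le> log_sum c y - log_sum c x"
    and "log_sum c y - log_sum c x \<le> (ln y - ln x) * partial_sum c y"
proof -
  have mem: "n \<in> {1..nat \<lfloor>z\<rfloor>} \<longleftrightarrow> n \<ge> 1 \<and> real n \<le> z" if "z \<ge> 1" for n z
    using that by (auto simp: le_nat_iff le_floor_iff)
  have sub: "{1..nat \<lfloor>x\<rfloor>} \<subseteq> {1..nat \<lfloor>y\<rfloor>}"
    using nat_mono[OF floor_mono[OF xy(2)]] by auto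
  have ln: "ln x \<le> ln y" using xy by simp
  \<comment> \<open>Cutting off by \<open>max\<close> instead of by the range lets both sums run
    over the same n.\<close>
  have "log_sum c x = (\<Sum>n=1..nat \<lfloor>y\<rfloor>. c n * max (ln x - ln (real n)) 0)"
    unfolding log_sum_def
  proof (rule sum.mono_neutral_cong_left[OF _ sub])
    show "\<forall>n\<in>{1..nat \<lfloor>y\<rfloor>} - {1..nat \<lfloor>x\<rfloor>}. c n * max (ln x - ln (real n)) 0 = 0"
    proof
      fix n assume "n \<in> {1..nat \<lfloor>y\<rfloor>} - {1..nat \<lfloor>x\<rfloor>}"
      then have "real n > x" using mem[of x n] xy by auto
      then have "ln x \<le> ln (real n)" using xy by simp
      then show "c n * max (ln x - ln (real n)) 0 = 0" by simp
    qed
    fix n assume "n \<in> {1..nat \<lfloor>x\<rfloor>}"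
    then have "n \<ge> 1" "real n \<le> x" using mem[of x n] xy by auto
    then have "ln (real n) \<le> ln x" by simp
    then show "c n * (ln x - ln (real n)) = c n * max (ln x - ln (real n)) 0" by simp
  qed simp
  then have eq: "log_sum c y - log_sum c x = (\<Sum>n=1..nat \<lfloor>y\<rfloor>. c n * ((ln y - ln (real n)) - max (ln x - ln (real n)) 0))"
    by (simp add: log_sum_def sum_subtractf[symmetric] right_diff_distrib)
  have le: "ln (real n) \<le> ln y" if "n \<in> {1..nat \<lfloor>y\<rfloor>}" for n
    using mem[of y n] that xy by simp
  have "(ln y - ln x) * partial_sum c x = (\<Sum>n=1..nat \<lfloor>x\<rfloor>. c n * (ln y - ln x))"
    by (simp add: partial_sum_def sum_distrib_left mult.commute)
  also have "\<dots> \<le> (\<Sum>n=1..nat \<lfloor>x\<rfloor>. c n * ((ln y - ln (real n)) - max (ln x - ln (real n)) 0))"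
  proof (intro sum_mono mult_left_mono c)
    fix n assume "n \<in> {1..nat \<lfloor>x\<rfloor>}"
    then have "n \<ge> 1" "real n \<le> x" using mem[of x n] xy by auto
    then have "ln (real n) \<le> ln x" by simp
    then show "ln y - ln x \<le> (ln y - ln (real n)) - max (ln x - ln (real n)) 0" by simp
  qed
  also have "\<dots> \<le> (\<Sum>n=1..nat \<lfloor>y\<rfloor>. c n * ((ln y - ln (real n)) - max (ln x - ln (real n)) 0))"
    by (rule sum_mono2[OF _ sub]) (use le ln in \<open>auto intro!: mult_nonneg_nonneg c\<close>)
  finally show "(ln y - ln x) * partial_sum c x \<le> log_sum c y - log_sum c x" by (simp add: eq)
  have "log_sum c y - log_sum c x \<le> (\<Sum>n=1..nat \<lfloor>y\<rfloor>. c n * (ln y - ln x))"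
    unfolding eq by (intro sum_mono mult_left_mono c) auto
  also have "\<dots> = (ln y - ln x) * partial_sum c y"
    by (simp add: partial_sum_def sum_distrib_left mult.commute)
  finally show "log_sum c y - log_sum c x \<le> (ln y - ln x) * partial_sum c y" .
qed

lemma partial_sum_ln_power_diff:
  assumes "1 \<le> x" "x \<le> y"
  shows "partial_sum (\<lambda>n. ln n ^ k) y - partial_sum (\<lambda>n. ln n ^ k) x \<le> (y - x + 1) * ln y ^ k"
proof -
  have fl: "nat \<lfloor>x\<rfloor> \<le> nat \<lfloor>y\<rfloor>" using assms by (intro nat_mono floor_mono)
  have "{1..nat \<lfloor>y\<rfloor>} = {1..nat \<lfloor>x\<rfloor>} \<union> {nat \<lfloor>x\<rfloor><..nat \<lfloor>y\<rfloor>}" using fl by auto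
  then have "partial_sum (\<lambda>n. ln n ^ k) y = partial_sum (\<lambda>n. ln n ^ k) x + (\<Sum>n\<in>{nat \<lfloor>x\<rfloor><..nat \<lfloor>y\<rfloor>}. ln (real n) ^ k)"
    unfolding partial_sum_def by (simp only:) (rule sum.union_disjoint, auto)
  moreover have "(\<Sum>n\<in>{nat \<lfloor>x\<rfloor><..nat \<lfloor>y\<rfloor>}. ln (real n) ^ k) \<le> real (card {nat \<lfloor>x\<rfloor><..nat \<lfloor>y\<rfloor>}) * ln y ^ k"
  proof (rule sum_bounded_above)
    fix n assume "n \<in> {nat \<lfloor>x\<rfloor><..nat \<lfloor>y\<rfloor>}"
    then have "n \<ge> 1" "real n \<le> y" using assms by (auto simp: le_nat_iff le_floor_iff)
    then show "ln (real n) ^ k \<le> ln y ^ k" by (intro power_mono) auto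
  qed
  moreover have "real (card {nat \<lfloor>x\<rfloor><..nat \<lfloor>y\<rfloor>}) * ln y ^ k \<le> (y - x + 1) * ln y ^ k"
  proof (rule mult_right_mono)
    have "real (card {nat \<lfloor>x\<rfloor><..nat \<lfloor>y\<rfloor>}) = real (nat \<lfloor>y\<rfloor>) - real (nat \<lfloor>x\<rfloor>)" using fl by (simp add: of_nat_diff)
    also have "\<dots> \<le> y - x + 1" using assms by linarith
    finally show "real (card {nat \<lfloor>x\<rfloor><..nat \<lfloor>y\<rfloor>}) \<le> y - x + 1" .
  qed (use assms in simp)
  ultimately show ?thesis by linarith
qed

lemma log_sum_diff: "log_sum (\<lambda>n. a n - b n) x = log_sum a x - log_sum b x"
  by (simp add: log_sum_def sum_subtractf left_diff_distrib)

text \<open>The bracketing needs nonnegative coefficients, so it is applied to \<Lambda>(n) log^k n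
  and to log^k n separately. A logarithmic step h turns the smoothed error O(x) into O(x / h), while
  moving the end point of the sum of log^k n by the factor exp(h) or exp(-h) costs about h x log^k
  x.\<close>

lemma mangoldt_partial_sum_local:
  assumes C: "C > 0" "\<And>x. x \<ge> 1 \<Longrightarrow> \<bar>log_sum (\<lambda>n. (mangoldt n - 1) * ln n ^ k) x\<bar> \<le> C * x"
    and x: "x \<ge> 3" and h: "0 < h" "h \<le> 1"
  shows "\<bar>partial_sum (\<lambda>n. (mangoldt n - 1) * ln n ^ k) x\<bar> \<le> 4 * C * x / h + (2 * h * x + 1) * (ln x + 1) ^ k"
proof -
  define a where "a n = mangoldt n * ln (real n) ^ k" for n
  define b where "b n = ln (real n) ^ k" for n
  have ab: "(\<lambda>n. (mangoldt n - 1) * ln (real n) ^ k) = (\<lambda>n. a n - b n)"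
    by (simp add: a_def b_def fun_eq_iff left_diff_distrib)
  have L: "\<bar>log_sum a z - log_sum b z\<bar> \<le> C * z" if "z \<ge> 1" for z
    using C(2)[OF that] by (simp add: ab log_sum_diff)
  have lnn: "ln (real n) \<ge> 0" for n by (cases "n = 0") auto
  have a0: "a n \<ge> 0" and b0: "b n \<ge> 0" for n
    using lnn[of n] mangoldt_nonneg[of n] by (auto simp: a_def b_def)
  define y where "y = x * exp h"
  \<comment> \<open>Here x \<ge> 3 matters: it ensures z \<ge> x / 3 \<ge> 1.\<close>
  define z where "z = x * exp (- h)"
  have eh: "exp h \<le> 1 + 2 * h" "exp h \<ge> 1"
  proof -
    have "exp h \<le> 1 + h + h\<^sup>2" using exp_bound[of h] h by simp
    also have "h\<^sup>2 \<le> h" using h by (simp add: power2_eq_square mult_left_le)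
    finally show "exp h \<le> 1 + 2 * h" by simp
  qed (use h in simp)
  have emh: "exp (- h) \<ge> 1 - h" "exp (- h) \<le> 1" "exp (- h) \<ge> 1/3"
  proof -
    show "exp (- h) \<ge> 1 - h" using exp_ge_add_one_self[of "- h"] by simp
    have "exp h \<le> exp 1" using h by simp
    also have "\<dots> \<le> 3" using exp_le by simp
    finally show "exp (- h) \<ge> 1/3" by (simp add: exp_minus field_simps)
  qed (use h in simp)
  have y: "x \<le> y" "y \<le> x + 2 * h * x" "ln y = ln x + h"
    using eh x mult_left_mono[OF eh(1), of x] by (simp_all add: y_def ln_mult algebra_simps)
  have z: "1 \<le> z" "z \<le> x" "x - z \<le> h * x" "ln z = ln x - h"
    using emh x mult_left_mono[OF emh(1), of x] mult_mono[of 3 x "1/3" "exp (- h)"]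
    by (simp_all add: z_def ln_mult algebra_simps)
  have upper: "partial_sum a x - partial_sum b x \<le> 4 * C * x / h + (2 * h * x + 1) * (ln x + 1) ^ k"
  proof -
    have "h * partial_sum a x \<le> log_sum a y - log_sum a x"
      using log_sum_diff_bounds(1)[of a x y] a0 x y by simp
    also have "\<dots> \<le> (log_sum b y - log_sum b x) + C * y + C * x"
      using L[of y] L[of x] x y by linarith
    also have "log_sum b y - log_sum b x \<le> h * partial_sum b y"
      using log_sum_diff_bounds(2)[of b x y] b0 x y by simp
    also have "C * y \<le> C * (3 * x)"
    proof (rule mult_left_mono)
      have "h * x \<le> 1 * x" using h x by (intro mult_right_mono) auto
      then show "y \<le> 3 * x" using y(2) by linarith
    qed (use C in simp)
    finally have "h * partial_sum a x \<le> h * partial_sum b y + 4 * C * x" by simp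
    then have "partial_sum a x \<le> partial_sum b y + 4 * C * x / h" using h by (simp add: field_simps)
    moreover have "partial_sum b y - partial_sum b x \<le> (y - x + 1) * ln y ^ k"
      unfolding b_def using x y by (intro partial_sum_ln_power_diff) auto
    moreover have "(y - x + 1) * ln y ^ k \<le> (2 * h * x + 1) * (ln x + 1) ^ k"
      using y x h by (intro mult_mono power_mono) auto
    ultimately show ?thesis by linarith
  qed
  have lower: "partial_sum b x - partial_sum a x \<le> 4 * C * x / h + (2 * h * x + 1) * (ln x + 1) ^ k"
  proof -
    have "h * partial_sum b z \<le> log_sum b x - log_sum b z"
      using log_sum_diff_bounds(1)[of b z x] b0 z by simp
    also have "\<dots> \<le> (log_sum a x - log_sum a z) + C * x + C * z"
      using L[of z] L[of x] x z by linarith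
    also have "log_sum a x - log_sum a z \<le> h * partial_sum a x"
      using log_sum_diff_bounds(2)[of a z x] a0 z by simp
    also have "C * z \<le> C * (3 * x)" using z x C by (intro mult_left_mono) auto
    finally have "h * partial_sum b z \<le> h * partial_sum a x + 4 * C * x" by simp
    then have "partial_sum b z \<le> partial_sum a x + 4 * C * x / h" using h by (simp add: field_simps)
    moreover have "partial_sum b x - partial_sum b z \<le> (x - z + 1) * ln x ^ k"
      unfolding b_def using z by (intro partial_sum_ln_power_diff) auto
    moreover have "(x - z + 1) * ln x ^ k \<le> (2 * h * x + 1) * (ln x + 1) ^ k"
      using z x h by (intro mult_mono power_mono) auto
    ultimately show ?thesis by linarith
  qed
  show ?thesis using upper lower unfolding ab by (simp add: partial_sum_def sum_subtractf abs_le_iff)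
qed

lemma ln_power_le_linear:
  obtains C where "C > 0" "\<And>x::real. x \<ge> 1 \<Longrightarrow> (ln x + 1) ^ m \<le> C * x"
proof -
  have *: "(ln x + 1) ^ m \<le> exp 1 * real (Suc m) ^ m * x" if x: "x \<ge> 1" for x :: real
  proof -
    have "(ln x + 1) / Suc m \<le> exp ((ln x + 1) / Suc m)"
      using exp_ge_add_one_self[of "(ln x + 1) / Suc m"] by linarith
    then have "((ln x + 1) / Suc m) ^ m \<le> exp ((ln x + 1) / Suc m) ^ m"
      using x by (intro power_mono) auto
    also have "\<dots> \<le> exp ((ln x + 1) / Suc m) ^ Suc m"
      using x by (intro power_increasing) auto
    also have "\<dots> = exp (real (Suc m) * ((ln x + 1) / Suc m))" by (rule exp_of_nat_mult[symmetric])
    also have "\<dots> = exp 1 * x" using x by (simp add: exp_add del: of_nat_Suc)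
    finally show ?thesis by (simp add: power_divide field_simps del: of_nat_Suc)
  qed
  show ?thesis by (rule that[OF _ *]) auto
qed

text \<open>The step h = 1 / M with M = (log N + 1)^m balances the two errors: N / h and h N (log N
  + 1)^(2m) both equal N M. The even exponent makes the optimal h an integral power.\<close>

lemma mangoldt_ln_power_partial_sum:
  obtains C where "C > 0"
    "\<And>N. N \<ge> 1 \<Longrightarrow> \<bar>\<Sum>n=1..N. (mangoldt n - 1) * ln (real n) ^ (2 * m)\<bar> \<le> C * real N * (ln (real N) + 1) ^ m"
proof -
  define c where "c n = (mangoldt n - 1) * ln (real n) ^ (2 * m)" for n
  obtain C where C: "C > 0" "\<And>x. x \<ge> 1 \<Longrightarrow> \<bar>log_sum c x\<bar> \<le> C * x"
  proof (rule log_sum_mangoldt_bound[where k = "2 * m"])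
    fix C assume C: "0 < C" "\<And>x. 1 \<le> x \<Longrightarrow> \<bar>log_sum (\<lambda>n. (mangoldt n - 1) * ln (real n) ^ (2 * m)) x\<bar> \<le> C * x"
    show thesis
    proof (rule that[of C])
      show "\<bar>log_sum c x\<bar> \<le> C * x" if "1 \<le> x" for x
        unfolding c_def[abs_def] by (rule C(2)[OF that])
    qed (rule C(1))
  qed
  obtain C' where C': "C' > 0" "\<And>x::real. x \<ge> 1 \<Longrightarrow> (ln x + 1) ^ m \<le> C' * x"
    using ln_power_le_linear[of m] by blast
  define C1 where "C1 = 4 * C + 2 + C' + \<bar>c 1\<bar> + \<bar>c 2\<bar>"
  have "\<bar>\<Sum>n=1..N. c n\<bar> \<le> C1 * real N * (ln (real N) + 1) ^ m" if N: "N \<ge> 1" for N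
  proof (cases "N \<ge> 3")
    case True
    define M where "M = (ln (real N) + 1) ^ m"
    have M: "M \<ge> 1" unfolding M_def using N by (intro one_le_power) simp
    have "\<bar>partial_sum c (real N)\<bar> \<le> 4 * C * real N / (1 / M) + (2 * (1 / M) * real N + 1) * (ln (real N) + 1) ^ (2 * m)"
      unfolding c_def[abs_def]
      by (rule mangoldt_partial_sum_local) (use C True M in \<open>auto simp: c_def[abs_def]\<close>)
    also have "(ln (real N) + 1) ^ (2 * m) = M * M" by (simp add: M_def mult_2 power_add)
    also have "4 * C * real N / (1 / M) + (2 * (1 / M) * real N + 1) * (M * M) = (4 * C + 2) * real N * M + M * M"
      using M by (simp add: field_simps)
    also have "M * M \<le> (C' * real N) * M" using C'(2)[of "real N"] N M by (intro mult_right_mono) (auto simp: M_def)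
    also have "(4 * C + 2) * real N * M + C' * real N * M = (4 * C + 2 + C') * (real N * M)" by (simp add: algebra_simps)
    also have "\<dots> \<le> C1 * (real N * M)" using M by (intro mult_right_mono) (auto simp: C1_def)
    finally show ?thesis by (simp add: partial_sum_def M_def mult.assoc)
  next
    case False
    then have "N = 1 \<or> N = 2" using N by auto
    then have "\<bar>\<Sum>n=1..N. c n\<bar> \<le> \<bar>c 1\<bar> + \<bar>c 2\<bar>" by (auto simp: numeral_2_eq_2)
    also have "\<dots> \<le> C1 * (1 * 1)" using C C' by (simp add: C1_def)
    also have "\<dots> \<le> C1 * (real N * (ln (real N) + 1) ^ m)"
      using C C' N by (intro mult_left_mono mult_mono one_le_power) (auto simp: C1_def)
    finally show ?thesis by (simp add: mult.assoc)
  qed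
  moreover have "C1 > 0" using C C' by (simp add: C1_def)
  ultimately show ?thesis using that unfolding c_def by blast
qed

section \<open>The prime number theorem\<close>

text \<open>The variation of decreasing weights telescopes. The inductive bound
  \<open>M * (2 * w (Suc r) - w K)\<close> consists of M w(r + 1) from the boundary term at the
  start and the accumulated variation M (w(r + 1) - w(K)).\<close>

lemma abel_summation_bound:
  fixes \<Delta> w :: "nat \<Rightarrow> real"
  assumes N: "r < N" and \<Delta>: "\<And>n. n \<le> N \<Longrightarrow> \<bar>\<Delta> n\<bar> \<le> M"
    and w: "\<And>n. n > r \<Longrightarrow> w (Suc n) \<le> w n" "\<And>n. w n \<ge> 0"
  shows "\<bar>\<Sum>n=Suc r..N. (\<Delta> n - \<Delta> (n - 1)) * w n\<bar> \<le> 2 * M * w (Suc r)"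
proof -
  define S where "S N = (\<Sum>n=Suc r..N. (\<Delta> n - \<Delta> (n - 1)) * w n)" for N
  have M: "M \<ge> 0" using \<Delta>[of 0] by (meson abs_ge_zero order_trans le0)
  have "\<bar>S K - \<Delta> K * w K\<bar> \<le> M * (2 * w (Suc r) - w K)" if "Suc r \<le> K" "K \<le> N" for K
    using that
  proof (induction K rule: nat_induct_at_least)
    case base
    have "\<bar>\<Delta> r\<bar> * w (Suc r) \<le> M * w (Suc r)"
      using \<Delta>[of r] w N by (intro mult_right_mono) auto
    then show ?case using w(2)[of "Suc r"] by (simp add: S_def abs_mult algebra_simps)
  next
    case (Suc K)
    have "S (Suc K) = S K + (\<Delta> (Suc K) - \<Delta> K) * w (Suc K)"
      using Suc by (simp add: S_def)
    then have "S (Suc K) - \<Delta> (Suc K) * w (Suc K) = (S K - \<Delta> K * w K) + \<Delta> K * (w K - w (Suc K))"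
      by (simp add: algebra_simps)
    also have "\<bar>\<dots>\<bar> \<le> \<bar>S K - \<Delta> K * w K\<bar> + \<bar>\<Delta> K * (w K - w (Suc K))\<bar>" by (rule abs_triangle_ineq)
    also have "\<bar>S K - \<Delta> K * w K\<bar> \<le> M * (2 * w (Suc r) - w K)" using Suc by simp
    also have "\<bar>\<Delta> K * (w K - w (Suc K))\<bar> \<le> M * (w K - w (Suc K))"
      using \<Delta>[of K] w(1)[of K] Suc by (auto simp: abs_mult intro!: mult_right_mono)
    also have "M * (2 * w (Suc r) - w K) + M * (w K - w (Suc K)) = M * (2 * w (Suc r) - w (Suc K))"
      by (simp add: algebra_simps)
    finally show ?case by simp
  qed
  then have "\<bar>S N - \<Delta> N * w N\<bar> \<le> M * (2 * w (Suc r) - w N)" using N by simp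
  moreover have "\<bar>\<Delta> N * w N\<bar> \<le> M * w N"
    using \<Delta>[of N] w by (auto simp: abs_mult intro!: mult_right_mono)
  ultimately show ?thesis by (simp add: S_def algebra_simps)
qed

lemma ln_2_ge_half: "ln (2::real) \<ge> 1 / 2"
proof -
  have "exp (1/2) ^ 2 \<le> (2::real) ^ 2" 
    using exp_le by (simp add: exp_double[symmetric])
  then have "exp (1/2) \<le> (2::real)" by (rule power2_le_imp_le) simp
  then show ?thesis by (subst ln_ge_iff) auto
qed

lemma ln_nat_ge_half:
  assumes "n \<ge> 2"
  shows "ln (real n) \<ge> 1 / 2"
proof -
  have "ln 2 \<le> ln (real n)" using assms by simp
  then show ?thesis using ln_2_ge_half by linarith
qed

text \<open>Partial summation with the weight log^(-2m - 1) n divides out the logarithms: N log^m N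
  becomes N / log^(m + 1) N. It starts only above sqrt N, where log n is comparable with log N;
  below, each term has absolute value at most 3.\<close>

lemma mangoldt_div_ln_sum:
  obtains C where "C > 0"
    "\<And>N. N \<ge> 2 \<Longrightarrow> \<bar>\<Sum>n=2..N. (mangoldt n - 1) / ln (real n)\<bar> \<le> 3 * sqrt (real N) + C * real N / ln (real N) ^ Suc m"
proof -
  obtain C where C: "C > 0"
    "\<And>N. N \<ge> 1 \<Longrightarrow> \<bar>\<Sum>n=1..N. (mangoldt n - 1) * ln (real n) ^ (2 * m)\<bar> \<le> C * real N * (ln (real N) + 1) ^ m"
    using mangoldt_ln_power_partial_sum[of m] by blast
  have main: "\<bar>\<Sum>n=2..N. (mangoldt n - 1) / ln (real n)\<bar> \<le> 3 * sqrt (real N) + (2 * C * 3 ^ m * 2 ^ (2 * m + 1)) * real N / ln (real N) ^ Suc m"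
    if N: "N \<ge> 2" for N
  proof -
    define r where "r = nat \<lfloor>sqrt (real N)\<rfloor>"
    have r: "r \<ge> 1" "real r \<le> sqrt (real N)" "sqrt (real N) < real r + 1"
    proof -
      have "1 \<le> sqrt (real N)" using N by simp
      then show "r \<ge> 1" by (simp add: r_def le_nat_iff le_floor_iff)
      show "real r \<le> sqrt (real N)" "sqrt (real N) < real r + 1" unfolding r_def by simp_all
    qed
    have rN: "r < N"
    proof -
      have "sqrt (real N) * 1 < sqrt (real N) * sqrt (real N)" using N by (intro mult_strict_left_mono) auto
      then have "sqrt (real N) < real N" by simp
      with r(2) show ?thesis by linarith
    qed
    define L where "L = ln (real N)"
    have L: "L \<ge> 1/2" using ln_nat_ge_half[OF N] by (simp add: L_def)
    have lr: "ln (real (Suc r)) \<ge> L / 2"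
    proof -
      have "L / 2 = ln (sqrt (real N))" using N by (simp add: L_def ln_sqrt)
      also have "\<dots> \<le> ln (real (Suc r))" using r N by (subst ln_le_cancel_iff) auto
      finally show ?thesis .
    qed
    define \<Delta> where "\<Delta> n = (\<Sum>j=1..n. (mangoldt j - 1) * ln (real j) ^ (2 * m))" for n
    define w where "w n = 1 / ln (real n) ^ (2 * m + 1)" for n
    define M where "M = C * real N * (L + 1) ^ m"
    have M: "\<bar>\<Delta> n\<bar> \<le> M" if "n \<le> N" for n
    proof (cases "n \<ge> 1")
      case True
      have "\<bar>\<Delta> n\<bar> \<le> C * real n * (ln (real n) + 1) ^ m" using C(2)[OF True] by (simp add: \<Delta>_def)
      also have "\<dots> \<le> C * real N * (L + 1) ^ m"
        unfolding L_def using C(1) that True by (intro mult_mono power_mono) auto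
      finally show ?thesis by (simp add: M_def)
    next
      case False
      then show ?thesis using C L by (simp add: \<Delta>_def M_def)
    qed
    have "\<bar>\<Sum>n=Suc r..N. (\<Delta> n - \<Delta> (n - 1)) * w n\<bar> \<le> 2 * M * w (Suc r)"
    proof (rule abel_summation_bound[OF rN M])
      fix n assume "n > r"
      then have n: "n \<ge> 2" using r by simp
      then show "w (Suc n) \<le> w n" unfolding w_def
        by (intro divide_left_mono power_mono mult_pos_pos zero_less_power) auto
    next
      fix n show "w n \<ge> 0" by (cases "n = 0") (auto simp: w_def)
    qed
    also have "2 * M * w (Suc r) \<le> 2 * M * (1 / (L / 2) ^ (2 * m + 1))"
    proof (intro mult_left_mono)
      show "w (Suc r) \<le> 1 / (L / 2) ^ (2 * m + 1)"
        unfolding w_def using lr L r(1) by (intro divide_left_mono power_mono mult_pos_pos zero_less_power) auto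
    qed (use C L in \<open>auto simp: M_def\<close>)
    also have "\<dots> = 2 * C * real N * (L + 1) ^ m * (2 ^ (2 * m + 1) / L ^ (2 * m + 1))"
      by (simp add: M_def power_divide)
    also have "\<dots> \<le> 2 * C * real N * (3 * L) ^ m * (2 ^ (2 * m + 1) / L ^ (2 * m + 1))"
      using C L by (intro mult_right_mono mult_left_mono power_mono) auto
    also have "\<dots> = (2 * C * 3 ^ m * 2 ^ (2 * m + 1)) * real N * (L ^ m / L ^ (2 * m + 1))"
      by (simp add: power_mult_distrib)
    also have "L ^ m / L ^ (2 * m + 1) = 1 / L ^ Suc m"
    proof -
      have "L ^ (2 * m + 1) = L ^ m * L ^ Suc m" unfolding power_add[symmetric] by (simp add: mult_2)
      moreover have "L ^ m \<noteq> 0" using L by simp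
      ultimately show ?thesis by (metis divide_divide_eq_left divide_self)
    qed
    finally have big: "\<bar>\<Sum>n=Suc r..N. (\<Delta> n - \<Delta> (n - 1)) * w n\<bar> \<le> (2 * C * 3 ^ m * 2 ^ (2 * m + 1)) * real N / L ^ Suc m"
      by simp
    have "(\<Delta> n - \<Delta> (n - 1)) * w n = (mangoldt n - 1) / ln (real n)" if "n \<in> {Suc r..N}" for n
    proof -
      have n: "n \<ge> 2" using that r by simp
      then obtain k where k: "n = Suc k" by (cases n) auto
      have "\<Delta> n - \<Delta> (n - 1) = (mangoldt n - 1) * ln (real n) ^ (2 * m)"
        unfolding k \<Delta>_def by simp
      then show ?thesis using n by (simp add: w_def)
    qed
    then have eq: "(\<Sum>n=Suc r..N. (\<Delta> n - \<Delta> (n - 1)) * w n) = (\<Sum>n=Suc r..N. (mangoldt n - 1) / ln (real n))"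
      by (intro sum.cong) auto
    have small: "\<bar>\<Sum>n=2..r. (mangoldt n - 1) / ln (real n)\<bar> \<le> 3 * sqrt (real N)"
    proof -
      have "\<bar>\<Sum>n=2..r. (mangoldt n - 1) / ln (real n)\<bar> \<le> (\<Sum>n=2..r. \<bar>(mangoldt n - 1) / ln (real n)\<bar>)" by (rule sum_abs)
      also have "\<dots> \<le> real (card {2..r}) * 3"
      proof (rule sum_bounded_above)
        fix n assume "n \<in> {2..r}"
        then have l: "ln (real n) \<ge> 1/2" by (intro ln_nat_ge_half) auto
        have "\<bar>mangoldt n - 1\<bar> \<le> ln (real n) + 1"
          using mangoldt_nonneg[of n] mangoldt_le_ln[of n] l by linarith
        also have "\<dots> \<le> 3 * ln (real n)" using l by simp
        finally show "\<bar>(mangoldt n - 1) / ln (real n)\<bar> \<le> 3" using l by (simp add: abs_divide divide_le_eq)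
      qed
      also have "\<dots> \<le> 3 * sqrt (real N)" using r by simp
      finally show ?thesis .
    qed
    have "{2..N} = {2..r} \<union> {Suc r..N}" using r rN by auto
    then have "(\<Sum>n=2..N. (mangoldt n - 1) / ln (real n)) =
      (\<Sum>n=2..r. (mangoldt n - 1) / ln (real n)) + (\<Sum>n=Suc r..N. (mangoldt n - 1) / ln (real n))"
      by (simp only:) (rule sum.union_disjoint, auto)
    then show ?thesis using small big unfolding eq L_def by linarith
  qed
  show ?thesis by (rule that[OF _ main]) (use C in auto)
qed

lemma sqrt_ln_power_le:
  obtains C where "C > 0" "\<And>N. N \<ge> 2 \<Longrightarrow> sqrt (real N) * ln (real N) ^ k \<le> C * real N"
proof -
  obtain C where C: "C > 0" "\<And>x::real. x \<ge> 1 \<Longrightarrow> (ln x + 1) ^ k \<le> C * x"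
    using ln_power_le_linear[of k] by blast
  have "sqrt (real N) * ln (real N) ^ k \<le> (2 ^ k * C) * real N" if N: "N \<ge> 2" for N
  proof -
    have "ln (real N) ^ k = 2 ^ k * ln (sqrt (real N)) ^ k"
      using N by (simp add: ln_sqrt power_divide)
    also have "\<dots> \<le> 2 ^ k * (ln (sqrt (real N)) + 1) ^ k"
      using N by (intro mult_left_mono power_mono) auto
    also have "\<dots> \<le> 2 ^ k * (C * sqrt (real N))" using C(2)[of "sqrt (real N)"] N by (intro mult_left_mono) auto
    finally have "sqrt (real N) * ln (real N) ^ k \<le> sqrt (real N) * (2 ^ k * (C * sqrt (real N)))"
      by (intro mult_left_mono) auto
    also have "\<dots> = (2 ^ k * C) * (sqrt (real N) * sqrt (real N))" by (simp only: mult_ac)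
    finally show ?thesis by simp
  qed
  then show ?thesis using that[of "2 ^ k * C"] C by simp
qed

section \<open>From prime powers to primes\<close>

text \<open>In n = p^j with j \<ge> 2 the prime p is at most sqrt N and j is at most the binary
  logarithm of N; the factor 2 comes from ln 2 \<ge> 1/2.\<close>

lemma card_proper_prime_powers:
  assumes N: "N \<ge> 2"
  shows "real (card {n \<in> {2..N}. primepow n \<and> \<not> prime n}) \<le> 2 * sqrt (real N) * ln (real N)"
proof -
  define r where "r = nat \<lfloor>sqrt (real N)\<rfloor>"
  define l where "l = nat \<lfloor>log 2 (real N)\<rfloor>"
  have r: "real r \<le> sqrt (real N)" unfolding r_def by simp
  have l: "real l \<le> log 2 (real N)" unfolding l_def using N by simp
  have "{n \<in> {2..N}. primepow n \<and> \<not> prime n} \<subseteq> (\<lambda>(p, j). p ^ j) ` ({1..r} \<times> {1..l})"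
  proof
    fix n assume "n \<in> {n \<in> {2..N}. primepow n \<and> \<not> prime n}"
    then have n: "n \<le> N" "primepow n" "\<not> prime n" by auto
    then obtain p j where pj: "prime p" "j > 0" "n = p ^ j" by (auto simp: primepow_def)
    have p2: "p \<ge> 2" using pj prime_ge_2_nat by simp
    have "j \<noteq> 1" using n pj by auto
    then have j2: "j \<ge> 2" using pj by simp
    have "p ^ 2 \<le> p ^ j" using p2 j2 by (intro power_increasing) auto
    then have "real p ^ 2 \<le> real N" using n pj by (metis of_nat_le_iff of_nat_power order_trans)
    then have "real p \<le> sqrt (real N)" by (rule real_le_rsqrt)
    then have "p \<le> r" by (simp add: r_def le_nat_iff le_floor_iff)
    moreover have "2 ^ j \<le> p ^ j" using p2 by (intro power_mono) auto
    then have "2 ^ j \<le> real N" using n pj by (metis of_nat_le_iff of_nat_numeral of_nat_power order_trans)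
    then have "real j \<le> log 2 (real N)" using N by (subst le_log_iff) (auto simp: powr_realpow)
    then have "j \<le> l" by (simp add: l_def le_nat_iff le_floor_iff)
    ultimately show "n \<in> (\<lambda>(p, j). p ^ j) ` ({1..r} \<times> {1..l})"
      using pj p2 by (intro image_eqI[of _ _ "(p, j)"]) auto
  qed
  then have "card {n \<in> {2..N}. primepow n \<and> \<not> prime n} \<le> card ((\<lambda>(p, j). p ^ j) ` ({1..r} \<times> {1..l}))"
    by (intro card_mono) auto
  also have "\<dots> \<le> card ({1..r} \<times> {1..l})" by (intro card_image_le) auto
  also have "\<dots> = r * l" by (simp add: card_cartesian_product)
  finally have "real (card {n \<in> {2..N}. primepow n \<and> \<not> prime n}) \<le> real r * real l"
    by (metis of_nat_le_iff of_nat_mult)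
  also have "\<dots> \<le> sqrt (real N) * log 2 (real N)" using r l by (intro mult_mono) auto
  also have "\<dots> \<le> sqrt (real N) * (2 * ln (real N))"
  proof (intro mult_left_mono)
    show "log 2 (real N) \<le> 2 * ln (real N)"
    using N ln_2_ge_half mult_left_mono[of "1/2" "ln 2" "ln (real N)"] by (simp add: log_def divide_le_eq)
  qed simp
  finally show ?thesis by simp
qed

text \<open>The comparison is with the discrete sum of 1 / log m in place of the logarithmic
  integral, so that the main terms of two intervals can be compared term by term.\<close>

definition prime_error :: "nat \<Rightarrow> real" where
  "prime_error n = real (card {p. prime p \<and> p \<le> n}) - (\<Sum>m=2..n. 1 / ln (real m))"

text \<open>\<Lambda>(n) / log n is 1 at primes and lies between 0 and 1 at other prime powers, so
  only the latter cause a difference.\<close>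

lemma prime_error_mangoldt:
  assumes N: "N \<ge> 2"
  shows "\<bar>prime_error N - (\<Sum>n=2..N. (mangoldt n - 1) / ln (real n))\<bar> \<le> 2 * sqrt (real N) * ln (real N)"
proof -
  define P where "P = {p. prime p \<and> p \<le> N}"
  define Q where "Q = {n \<in> {2..N}. primepow n \<and> \<not> prime n}"
  have P: "P \<subseteq> {2..N}" using prime_ge_2_nat by (auto simp: P_def)
  then have finP: "finite P" by (rule finite_subset) simp
  have "(\<Sum>n=2..N. mangoldt n / ln (real n)) = (\<Sum>n\<in>P \<union> Q. mangoldt n / ln (real n))"
    by (rule sum.mono_neutral_right) (use P in \<open>auto simp: P_def Q_def mangoldt_def\<close>)
  also have "\<dots> = (\<Sum>n\<in>P. mangoldt n / ln (real n)) + (\<Sum>n\<in>Q. mangoldt n / ln (real n))"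
    by (rule sum.union_disjoint) (use finP in \<open>auto simp: P_def Q_def\<close>)
  also have "(\<Sum>n\<in>P. mangoldt n / ln (real n)) = (\<Sum>n\<in>P. 1)"
  proof (rule sum.cong[OF refl])
    fix n assume n: "n \<in> P"
    then have "n \<ge> 2" using P by auto
    then have "ln (real n) > 0" by simp
    then show "mangoldt n / ln (real n) = 1" using n mangoldt_primepow'[of n 1] by (simp add: P_def)
  qed
  finally have eq: "(\<Sum>n=2..N. mangoldt n / ln (real n)) = real (card P) + (\<Sum>n\<in>Q. mangoldt n / ln (real n))" by simp
  have b: "0 \<le> mangoldt n / ln (real n) \<and> mangoldt n / ln (real n) \<le> 1" if "n \<in> Q" for n
    using that mangoldt_nonneg[of n] mangoldt_le_ln[of n] by (auto simp: Q_def divide_le_eq)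
  have "0 \<le> (\<Sum>n\<in>Q. mangoldt n / ln (real n))" using b by (intro sum_nonneg) auto
  moreover have "(\<Sum>n\<in>Q. mangoldt n / ln (real n)) \<le> real (card Q) * 1" using b by (intro sum_bounded_above) auto
  moreover have "real (card Q) \<le> 2 * sqrt (real N) * ln (real N)"
    unfolding Q_def by (rule card_proper_prime_powers[OF N])
  moreover have "prime_error N - (\<Sum>n=2..N. (mangoldt n - 1) / ln (real n)) = - (\<Sum>n\<in>Q. mangoldt n / ln (real n))"
    using eq by (simp add: prime_error_def P_def diff_divide_distrib sum_subtractf)
  ultimately show ?thesis by simp
qed

lemma prime_error_bound:
  obtains C where "C > 0" "\<And>N. N \<ge> 2 \<Longrightarrow> \<bar>prime_error N\<bar> \<le> C * real N / ln (real N) ^ A"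
proof -
  obtain C1 where C1: "C1 > 0"
    "\<And>N. N \<ge> 2 \<Longrightarrow> \<bar>\<Sum>n=2..N. (mangoldt n - 1) / ln (real n)\<bar> \<le> 3 * sqrt (real N) + C1 * real N / ln (real N) ^ Suc A"
    using mangoldt_div_ln_sum[of A] by blast
  obtain C2 where C2: "C2 > 0" "\<And>N. N \<ge> 2 \<Longrightarrow> sqrt (real N) * ln (real N) ^ Suc A \<le> C2 * real N"
    using sqrt_ln_power_le[of "Suc A"] by blast
  have main: "\<bar>prime_error N\<bar> \<le> (8 * C2 + 2 * C1) * real N / ln (real N) ^ A" if N: "N \<ge> 2" for N
  proof -
    define L where "L = ln (real N)"
    have L: "L \<ge> 1/2" using ln_nat_ge_half[OF N] by (simp add: L_def)
    have LA: "L ^ A > 0" using L by simp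
    have s: "sqrt (real N) * L \<le> C2 * real N / L ^ A"
      using C2(2)[OF N] LA by (simp add: L_def[symmetric] le_divide_eq mult_ac)
    have "sqrt (real N) * 1 \<le> sqrt (real N) * (2 * L)" using L by (intro mult_left_mono) auto
    then have s1: "sqrt (real N) \<le> 2 * (C2 * real N / L ^ A)" using s by simp
    have "C1 * real N / L ^ Suc A = C1 * real N / L ^ A * (1 / L)" using L by simp
    also have "\<dots> \<le> C1 * real N / L ^ A * 2" using L C1 by (intro mult_left_mono) (auto simp: field_simps)
    also have "\<dots> = 2 * (C1 * real N / L ^ A)" by simp
    finally have s2: "C1 * real N / L ^ Suc A \<le> 2 * (C1 * real N / L ^ A)" .
    have "\<bar>prime_error N\<bar> \<le> 2 * (sqrt (real N) * L) + 3 * sqrt (real N) + C1 * real N / L ^ Suc A"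
      using prime_error_mangoldt[OF N] C1(2)[OF N] by (simp add: L_def)
    also have "\<dots> \<le> 2 * (C2 * real N / L ^ A) + 3 * (2 * (C2 * real N / L ^ A)) + 2 * (C1 * real N / L ^ A)"
      using s s1 s2 by linarith
    also have "\<dots> = (8 * C2 + 2 * C1) * real N / L ^ A" by (simp add: add_divide_distrib algebra_simps)
    finally show ?thesis by (simp add: L_def)
  qed
  show ?thesis by (rule that[OF _ main]) (use C1 C2 in auto)
qed

text \<open>One bound for all n \<le> N is wanted, since the ends of all blocks up to \<beta> enter.
  For n > sqrt N the logarithms of n and N are comparable; for smaller n the crude bound 3 n
  suffices.\<close>

theorem prime_number_theorem_log_saving:
  obtains C where "C > 0" "\<And>n N. N \<ge> 2 \<Longrightarrow> n \<le> N \<Longrightarrow> \<bar>prime_error n\<bar> \<le> C * real N / ln (real N) ^ A"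
proof -
  obtain C1 where C1: "C1 > 0" "\<And>N. N \<ge> 2 \<Longrightarrow> \<bar>prime_error N\<bar> \<le> C1 * real N / ln (real N) ^ A"
    using prime_error_bound by blast
  obtain C2 where C2: "C2 > 0" "\<And>N. N \<ge> 2 \<Longrightarrow> sqrt (real N) * ln (real N) ^ A \<le> C2 * real N"
    using sqrt_ln_power_le[of A] by blast
  have main: "\<bar>prime_error n\<bar> \<le> (C1 * 2 ^ A + 3 * C2) * real N / ln (real N) ^ A" if N: "N \<ge> 2" "n \<le> N" for n N
  proof -
    define L where "L = ln (real N)"
    have L: "L \<ge> 1/2" using ln_nat_ge_half[OF N(1)] by (simp add: L_def)
    have LA: "L ^ A > 0" using L by simp
    have s: "sqrt (real N) \<le> C2 * real N / L ^ A"
      using C2(2)[OF N(1)] LA by (simp add: L_def[symmetric] le_divide_eq)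
    have split: "(C1 * 2 ^ A + 3 * C2) * real N / L ^ A = C1 * 2 ^ A * real N / L ^ A + 3 * (C2 * real N / L ^ A)"
      by (simp add: add_divide_distrib algebra_simps)
    have pos: "C1 * 2 ^ A * real N / L ^ A \<ge> 0" "C2 * real N / L ^ A \<ge> 0" using C1 C2 LA by auto
    consider "n < 2" | "n \<ge> 2" "real n \<le> sqrt (real N)" | "n \<ge> 2" "real n > sqrt (real N)" by linarith
    then have "\<bar>prime_error n\<bar> \<le> (C1 * 2 ^ A + 3 * C2) * real N / L ^ A"
    proof cases
      case 1
      then have "{p. prime p \<and> p \<le> n} = {}" by (auto dest: prime_ge_2_nat)
      then have "prime_error n = 0" using 1 by (simp only: prime_error_def) simp
      then show ?thesis using pos unfolding split by simp
    next
      case 2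
      have "card {p. prime p \<and> p \<le> n} \<le> card {1..n}"
        by (intro card_mono) (auto dest: prime_ge_1_nat)
      moreover have "(\<Sum>m=2..n. 1 / ln (real m)) \<le> real (card {2..n}) * 2"
      proof (rule sum_bounded_above)
        fix m assume "m \<in> {2..n}"
        then have "ln (real m) \<ge> 1/2" by (intro ln_nat_ge_half) auto
        then show "1 / ln (real m) \<le> 2" by (simp add: field_simps)
      qed
      moreover have "(\<Sum>m=2..n. 1 / ln (real m)) \<ge> 0" by (intro sum_nonneg) auto
      ultimately have "\<bar>prime_error n\<bar> \<le> 3 * real n" using 2 by (simp add: prime_error_def)
      then show ?thesis using 2 s pos unfolding split by linarith
    next
      case 3
      have l: "ln (real n) \<ge> L / 2"
      proof -
        have "L / 2 = ln (sqrt (real N))" using N by (simp add: L_def ln_sqrt)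
        also have "\<dots> \<le> ln (real n)" using 3 N by (subst ln_le_cancel_iff) auto
        finally show ?thesis .
      qed
      have "\<bar>prime_error n\<bar> \<le> C1 * real n / ln (real n) ^ A" by (rule C1(2)[OF 3(1)])
      also have "\<dots> \<le> C1 * real N / (L / 2) ^ A"
        using C1 N l L by (intro frac_le mult_left_mono power_mono zero_less_power) auto
      also have "\<dots> = C1 * 2 ^ A * real N / L ^ A" by (simp add: power_divide)
      finally show ?thesis using pos unfolding split by linarith
    qed
    then show ?thesis by (simp add: L_def)
  qed
  show ?thesis by (rule that[OF _ main]) (use C1 C2 in \<open>auto intro: add_pos_pos\<close>)
qed

section \<open>Primes in the two halves of the residue classes\<close>

definition prime_pi :: "nat \<Rightarrow> real" where
  "prime_pi n = real (card {p. prime p \<and> p \<le> n})"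

text \<open>The term \<open>m = 1\<close> vanishes because \<open>1 / 0 = 0\<close>.\<close>

definition inv_ln_sum :: "nat \<Rightarrow> real" where
  "inv_ln_sum n = (\<Sum>m=1..n. 1 / ln (real m))"

lemma prime_pi_eq: "prime_pi n = inv_ln_sum n + prime_error n"
proof -
  have "(\<Sum>m=1..n. 1 / ln (real m)) = (\<Sum>m=2..n. 1 / ln (real m))"
  proof (rule sum.mono_neutral_right)
    show "\<forall>i\<in>{1..n} - {2..n}. 1 / ln (real i) = 0"
    proof
      fix i assume "i \<in> {1..n} - {2..n}"
      then have "i = 1" by auto
      then show "1 / ln (real i) = 0" by simp
    qed
  qed auto
  then show ?thesis by (simp add: prime_pi_def prime_error_def inv_ln_sum_def)
qed

lemma card_primes_Ioc:
  assumes "a \<le> b"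
  shows "real (card {p. prime p \<and> a < p \<and> p \<le> b}) = prime_pi b - prime_pi a"
proof -
  have "{p. prime p \<and> p \<le> b} = {p. prime p \<and> p \<le> a} \<union> {p. prime p \<and> a < p \<and> p \<le> b}"
    using assms by auto
  then have "card {p. prime p \<and> p \<le> b} = card {p. prime p \<and> p \<le> a} + card {p. prime p \<and> a < p \<and> p \<le> b}"
    by (simp only:) (rule card_Un_disjoint, auto)
  then show ?thesis by (simp add: prime_pi_def)
qed

lemma inv_ln_sum_diff:
  assumes "a \<le> b"
  shows "inv_ln_sum b - inv_ln_sum a = (\<Sum>m\<in>{a<..b}. 1 / ln (real m))"
proof -
  have "{1..b} = {1..a} \<union> {a<..b}" using assms by auto
  then have "inv_ln_sum b = inv_ln_sum a + (\<Sum>m\<in>{a<..b}. 1 / ln (real m))"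
    unfolding inv_ln_sum_def by (simp only:) (rule sum.union_disjoint, auto)
  then show ?thesis by simp
qed

text \<open>Residue 0 counts to the second half, so that the block (j k, j k + k] falls into two
  intervals, cut at j k + k div 2.\<close>

definition first_half :: "nat \<Rightarrow> nat \<Rightarrow> bool" where
  "first_half k n \<longleftrightarrow> 1 \<le> n mod k \<and> n mod k \<le> k div 2"

definition half_sign :: "nat \<Rightarrow> nat \<Rightarrow> real" where
  "half_sign k n = (if first_half k n then 1 else - 1)"

text \<open>The reflection of r to k - r maps the first half into the second. The hypothesis k > 2
  excludes the fixed point r = k / 2, which divides k and is thus coprime to it only for k =
  2.\<close>

lemma totatives_halves:
  assumes k: "k > 2"
  shows "card {r \<in> totatives k. r \<le> k div 2} \<le> card {r \<in> totatives k. k div 2 < r}"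
proof (rule card_inj_on_le)
  show "inj_on (\<lambda>r. k - r) {r \<in> totatives k. r \<le> k div 2}"
    by (rule inj_onI) auto
  show "(\<lambda>r. k - r) ` {r \<in> totatives k. r \<le> k div 2} \<subseteq> {r \<in> totatives k. k div 2 < r}"
  proof (rule image_subsetI)
    fix r assume "r \<in> {r \<in> totatives k. r \<le> k div 2}"
    then have r: "r > 0" "coprime r k" "r \<le> k div 2" by (auto simp: totatives_def)
    have rk: "r < k" using r k by auto
    have "2 * r \<noteq> k"
    proof
      assume "2 * r = k"
      then have "r dvd k" by auto
      with r have "r = 1" using coprime_common_divisor_nat[of r k r] by simp
      with \<open>2 * r = k\<close> k show False by simp
    qed
    then have "k div 2 < k - r" using r rk by auto
    moreover have "coprime (k - r) k"
    proof -
      define s where "s = k - r"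
      have s: "k = r + s" using rk by (simp add: s_def)
      have "gcd r k = 1" using r(2) by (rule coprime_imp_gcd_eq_1)
      then have "gcd r s = 1" unfolding s gcd_add2 .
      then have "gcd s (s + r) = 1" unfolding gcd_add2 by (subst gcd.commute)
      then have "gcd s k = 1" unfolding s by (subst add.commute)
      then show ?thesis unfolding s_def by (simp only: coprime_iff_gcd_eq_1)
    qed
    ultimately show "k - r \<in> {r \<in> totatives k. k div 2 < r}" using r rk by (auto simp: totatives_def)
  qed
qed simp

text \<open>Only the second half is estimated from below: its reduced classes, at least \<phi>(k) /
  2 in number, contain at least \<gamma> primes each. By the total \<gamma> \<phi>(k) + \<iota>, at
  most \<gamma> \<phi>(k) / 2 + \<iota> primes remain for the first half, wherever the primes
  dividing k lie.\<close>

lemma P_integer_half_sign_sum: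
  assumes P: "P_integer \<alpha> \<beta> \<gamma> \<iota> k" and k: "k > 2"
  shows "(\<Sum>p\<in>primes_between \<alpha> \<beta>. half_sign k p) \<le> real \<iota>"
proof -
  define M where "M = primes_between \<alpha> \<beta>"
  have fin: "finite M" unfolding M_def primes_between_def by (rule finite_subset[of _ "{..\<beta>}"]) auto
  define c where "c r = card {p \<in> M. [p = r] (mod k)}" for r
  define R2 where "R2 = {r \<in> totatives k. k div 2 < r}"
  define F where "F = {p \<in> M. first_half k p}"
  define S where "S = {p \<in> M. \<not> first_half k p}"
  have finT: "finite (totatives k)" by simp
  have cardM: "card M = \<gamma> * totient k + \<iota>" using P by (simp add: P_integer_def M_def)
  have "totatives k = {r \<in> totatives k. r \<le> k div 2} \<union> R2" by (auto simp: R2_def)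
  then have "totient k = card ({r \<in> totatives k. r \<le> k div 2} \<union> R2)" by (simp add: totient_def)
  also have "\<dots> = card {r \<in> totatives k. r \<le> k div 2} + card R2"
    by (rule card_Un_disjoint) (use finT in \<open>auto simp: R2_def\<close>)
  finally have tot: "totient k \<le> 2 * card R2" using totatives_halves[OF k] by (simp add: R2_def)
  have "\<gamma> * card R2 = (\<Sum>r\<in>R2. \<gamma>)" by simp
  also have "\<dots> \<le> (\<Sum>r\<in>R2. c r)"
  proof (rule sum_mono)
    fix r assume "r \<in> R2"
    then have "coprime r k" by (auto simp: R2_def totatives_def)
    then show "\<gamma> \<le> c r" using P by (auto simp: P_integer_def c_def M_def)
  qed
  also have "\<dots> = card (\<Union>r\<in>R2. {p \<in> M. [p = r] (mod k)})"
    unfolding c_def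
  proof (rule card_UN_disjoint[symmetric])
    show "finite R2" using finT by (simp add: R2_def)
    show "\<forall>r\<in>R2. finite {p \<in> M. [p = r] (mod k)}" using fin by simp
    show "\<forall>i\<in>R2. \<forall>j\<in>R2. i \<noteq> j \<longrightarrow> {p \<in> M. [p = i] (mod k)} \<inter> {p \<in> M. [p = j] (mod k)} = {}"
    proof (intro ballI impI)
      fix i j assume ij: "i \<in> R2" "j \<in> R2" "i \<noteq> j"
      then have "i < k" "j < k" using k totatives_less[of i k] totatives_less[of j k] by (auto simp: R2_def)
      then show "{p \<in> M. [p = i] (mod k)} \<inter> {p \<in> M. [p = j] (mod k)} = {}"
        using ij by (auto simp: unique_euclidean_semiring_class.cong_def)
    qed
  qed
  also have "\<dots> \<le> card S"
  proof (rule card_mono)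
    show "finite S" using fin by (simp add: S_def)
    show "(\<Union>r\<in>R2. {p \<in> M. [p = r] (mod k)}) \<subseteq> S"
    proof
      fix p assume "p \<in> (\<Union>r\<in>R2. {p \<in> M. [p = r] (mod k)})"
      then obtain r where r: "r \<in> R2" "p \<in> M" "[p = r] (mod k)" by auto
      have "r < k" using r(1) k totatives_less[of r k] by (auto simp: R2_def)
      then have "p mod k = r" using r by (simp add: unique_euclidean_semiring_class.cong_def)
      then show "p \<in> S" using r by (auto simp: S_def first_half_def R2_def)
    qed
  qed
  finally have S: "\<gamma> * card R2 \<le> card S" .
  have FS: "card M = card F + card S"
  proof -
    have "M = F \<union> S" by (auto simp: F_def S_def)
    then show ?thesis by (simp only:) (rule card_Un_disjoint, use fin in \<open>auto simp: F_def S_def\<close>)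
  qed
  have "\<gamma> * totient k \<le> 2 * (\<gamma> * card R2)" using mult_le_mono2[OF tot, of \<gamma>] by simp
  then have "card F \<le> card S + \<iota>" using S FS cardM by linarith
  moreover have "(\<Sum>p\<in>M. half_sign k p) = real (card F) - real (card S)"
  proof -
    have "(\<Sum>p\<in>M. half_sign k p) = (\<Sum>p\<in>F. half_sign k p) + (\<Sum>p\<in>S. half_sign k p)"
    proof -
      have "M = F \<union> S" by (auto simp: F_def S_def)
      then show ?thesis by (simp only:) (rule sum.union_disjoint, use fin in \<open>auto simp: F_def S_def\<close>)
    qed
    also have "(\<Sum>p\<in>F. half_sign k p) = real (card F)" by (simp add: half_sign_def F_def)
    also have "(\<Sum>p\<in>S. half_sign k p) = - real (card S)" by (simp add: half_sign_def S_def)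
    finally show ?thesis by simp
  qed
  ultimately show ?thesis by (simp add: M_def)
qed

section \<open>Signed prime counts on blocks of length k\<close>

definition sign_count :: "nat \<Rightarrow> nat \<Rightarrow> nat \<Rightarrow> real" where
  "sign_count k a b = (\<Sum>p | prime p \<and> a < p \<and> p \<le> b. half_sign k p)"

lemma sign_count_split:
  assumes "a \<le> b" "b \<le> c"
  shows "sign_count k a c = sign_count k a b + sign_count k b c"
proof -
  have eq: "{p. prime p \<and> a < p \<and> p \<le> c} = {p. prime p \<and> a < p \<and> p \<le> b} \<union> {p. prime p \<and> b < p \<and> p \<le> c}"
    using assms by auto
  have fin: "finite {p. prime p \<and> u < p \<and> p \<le> v}" for u v :: nat
    by (rule finite_subset[of _ "{..v}"]) auto
  show ?thesis unfolding sign_count_def eq by (rule sum.union_disjoint[OF fin fin]) auto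
qed

lemma sign_count_const:
  assumes "a \<le> b" "\<And>p. a < p \<Longrightarrow> p \<le> b \<Longrightarrow> half_sign k p = c"
  shows "sign_count k a b = c * (prime_pi b - prime_pi a)"
proof -
  have "sign_count k a b = (\<Sum>p | prime p \<and> a < p \<and> p \<le> b. c)"
    unfolding sign_count_def by (rule sum.cong) (use assms in auto)
  then show ?thesis using card_primes_Ioc[OF assms(1)] by simp
qed

lemma half_sign_first:
  assumes "k > 2" "j * k < p" "p \<le> j * k + k div 2"
  shows "half_sign k p = 1"
proof -
  define m where "m = p - j * k"
  have m: "p = j * k + m" "1 \<le> m" "m \<le> k div 2" using assms by (auto simp: m_def)
  have "m < k" using m assms by auto
  then show ?thesis using m by (simp add: half_sign_def first_half_def)
qed

lemma half_sign_second:
  assumes "k > 2" "j * k + k div 2 < p" "p \<le> j * k + k"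
  shows "half_sign k p = - 1"
proof -
  define m where "m = p - j * k"
  have m: "p = j * k + m" "k div 2 < m" "m \<le> k" using assms by (auto simp: m_def)
  show ?thesis using m assms(1) by (cases "m = k") (auto simp: half_sign_def first_half_def)
qed

lemma inv_ln_bounds:
  shows "0 \<le> 1 / ln (real n)" "1 / ln (real n) \<le> 2"
proof -
  show "0 \<le> 1 / ln (real n)" by (cases "n = 0") auto
  show "1 / ln (real n) \<le> 2"
  proof (cases "n \<ge> 2")
    case True
    then have "ln (real n) \<ge> 1/2" by (rule ln_nat_ge_half)
    then show ?thesis by (simp add: field_simps)
  next
    case False
    then have "n = 0 \<or> n = 1" by auto
    then show ?thesis by auto
  qed
qed

lemma inv_ln_sum_mono: "a \<le> b \<Longrightarrow> inv_ln_sum a \<le> inv_ln_sum b"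
  using inv_ln_sum_diff[of a b] inv_ln_bounds(1) sum_nonneg[of "{a<..b}" "\<lambda>m. 1 / ln (real m)"] by fastforce

lemma inv_ln_sum_shift:
  "inv_ln_sum (a + n) - inv_ln_sum a = (\<Sum>m=1..n. 1 / ln (real (a + m)))"
proof (induction n)
  case (Suc n)
  then show ?case by (simp add: inv_ln_sum_def algebra_simps)
qed simp

text \<open>The term at a + m is paired with the one at a + k div 2 + m. The loss 4 has two sources,
  each at most 2: the pair m = 1, which may have the wrong sign as 1 / ln 1 = 0 when a = 0, and the
  last term of the block when k is odd.\<close>

lemma inv_ln_half_blocks:
  assumes d: "\<And>m. 2 \<le> m \<Longrightarrow> m \<le> k div 2 \<Longrightarrow>
      \<delta> \<le> 1 / ln (real (a + m)) - 1 / ln (real (a + k div 2 + m))" and d0: "\<delta> \<ge> 0" and k: "k > 2"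
  shows "(inv_ln_sum (a + k div 2) - inv_ln_sum a) - (inv_ln_sum (a + k) - inv_ln_sum (a + k div 2)) \<ge>
           (real k / 2 - 2) * \<delta> - 4"
proof -
  define h where "h = k div 2"
  have h: "h \<ge> 1" "k = 2 * h \<or> k = 2 * h + 1" using k by (auto simp: h_def)
  have "inv_ln_sum (a + k) \<le> inv_ln_sum (a + h + h) + 2"
  proof -
    have "inv_ln_sum (a + k) \<le> inv_ln_sum (Suc (a + h + h))" using h by (intro inv_ln_sum_mono) auto
    also have "\<dots> \<le> inv_ln_sum (a + h + h) + 2"
      using inv_ln_bounds(2)[of "Suc (a + h + h)"] by (simp add: inv_ln_sum_def)
    finally show ?thesis .
  qed
  then have "(inv_ln_sum (a + h) - inv_ln_sum a) - (inv_ln_sum (a + k) - inv_ln_sum (a + h)) \<ge>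
     (inv_ln_sum (a + h) - inv_ln_sum a) - (inv_ln_sum (a + h + h) - inv_ln_sum (a + h)) - 2" by simp
  also have "(inv_ln_sum (a + h) - inv_ln_sum a) - (inv_ln_sum (a + h + h) - inv_ln_sum (a + h)) =
     (\<Sum>m=1..h. 1 / ln (real (a + m)) - 1 / ln (real (a + h + m)))"
    by (simp add: inv_ln_sum_shift sum_subtractf)
  also have "\<dots> = (1 / ln (real (a + 1)) - 1 / ln (real (a + h + 1))) + (\<Sum>m=2..h. 1 / ln (real (a + m)) - 1 / ln (real (a + h + m)))"
    using h by (subst sum.atLeast_Suc_atMost) (auto simp: numeral_2_eq_2)
  finally have 1: "(inv_ln_sum (a + h) - inv_ln_sum a) - (inv_ln_sum (a + k) - inv_ln_sum (a + h)) \<ge>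
     (\<Sum>m=2..h. 1 / ln (real (a + m)) - 1 / ln (real (a + h + m))) - 4"
    using inv_ln_bounds(1)[of "a + 1"] inv_ln_bounds(2)[of "a + h + 1"] by linarith
  have "(\<Sum>m=2..h. \<delta>) \<le> (\<Sum>m=2..h. 1 / ln (real (a + m)) - 1 / ln (real (a + h + m)))"
    by (rule sum_mono) (use d in \<open>auto simp: h_def\<close>)
  moreover have "(real k / 2 - 2) * \<delta> \<le> (\<Sum>m=2..h. \<delta>)"
  proof -
    have "real k / 2 - 2 \<le> real (h - 1)" using h by (auto simp: of_nat_diff)
    then have "(real k / 2 - 2) * \<delta> \<le> real (h - 1) * \<delta>" using d0 by (intro mult_right_mono)
    then show ?thesis using h by (simp add: numeral_2_eq_2)
  qed
  ultimately show ?thesis using 1 by (simp add: h_def)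
qed

lemma inv_ln_antimono:
  assumes "2 \<le> m" "m \<le> n"
  shows "1 / ln (real n) \<le> 1 / ln (real m)"
  using assms by (intro divide_left_mono mult_pos_pos) auto

text \<open>An initial piece of a block cannot contribute much below 0: inside the first half all
  signs are +1, and beyond it the second half is compared with the complete first half, whose main
  term is at least as large up to the loss 4. Each of the two prime counts has error at most 2
  E.\<close>

lemma sign_count_block_ge:
  assumes k: "k > 2" and E: "\<And>n. n \<le> N \<Longrightarrow> \<bar>prime_error n\<bar> \<le> E" and i: "i \<le> k" "j * k + i \<le> N"
  shows "sign_count k (j * k) (j * k + i) \<ge> - (4 + 4 * E)"
proof -
  have E0: "E \<ge> 0" using E[of 0] by (meson abs_ge_zero order_trans le0)
  let ?a = "j * k"
  have err: "prime_pi n - prime_pi m \<ge> inv_ln_sum n - inv_ln_sum m - 2 * E" 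
    "prime_pi n - prime_pi m \<le> inv_ln_sum n - inv_ln_sum m + 2 * E" if "m \<le> N" "n \<le> N" for m n
    using E[OF that(1)] E[OF that(2)] by (simp_all add: prime_pi_eq abs_le_iff)
  show ?thesis
  proof (cases "i \<le> k div 2")
    case True
    have "sign_count k ?a (?a + i) = 1 * (prime_pi (?a + i) - prime_pi ?a)"
      by (rule sign_count_const) (use half_sign_first[OF k] True in auto)
    also have "\<dots> \<ge> - 2 * E" using err(1)[of ?a "?a + i"] i inv_ln_sum_mono[of ?a "?a + i"] by simp
    finally show ?thesis using E0 by simp
  next
    case False
    have 1: "sign_count k ?a (?a + k div 2) = 1 * (prime_pi (?a + k div 2) - prime_pi ?a)"
      by (rule sign_count_const) (use half_sign_first[OF k] in auto)
    have 2: "sign_count k (?a + k div 2) (?a + i) = - 1 * (prime_pi (?a + i) - prime_pi (?a + k div 2))"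
      by (rule sign_count_const) (use half_sign_second[OF k] False i in auto)
    have "sign_count k ?a (?a + i) = sign_count k ?a (?a + k div 2) + sign_count k (?a + k div 2) (?a + i)"
      by (rule sign_count_split) (use False in auto)
    also have "\<dots> \<ge> (inv_ln_sum (?a + k div 2) - inv_ln_sum ?a) - (inv_ln_sum (?a + i) - inv_ln_sum (?a + k div 2)) - 4 * E"
      unfolding 1 2 using err(1)[of ?a "?a + k div 2"] err(2)[of "?a + k div 2" "?a + i"] i False by simp
    finally have "sign_count k ?a (?a + i) \<ge> (inv_ln_sum (?a + k div 2) - inv_ln_sum ?a) - (inv_ln_sum (?a + i) - inv_ln_sum (?a + k div 2)) - 4 * E" .
    moreover have "inv_ln_sum (?a + i) \<le> inv_ln_sum (?a + k)" using i by (intro inv_ln_sum_mono) auto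
    ultimately have "sign_count k ?a (?a + i) \<ge> (inv_ln_sum (?a + k div 2) - inv_ln_sum ?a) - (inv_ln_sum (?a + k) - inv_ln_sum (?a + k div 2)) - 4 * E"
      by simp
    moreover have "(inv_ln_sum (?a + k div 2) - inv_ln_sum ?a) - (inv_ln_sum (?a + k) - inv_ln_sum (?a + k div 2)) \<ge> (real k / 2 - 2) * 0 - 4"
    proof (rule inv_ln_half_blocks[OF _ _ k])
      fix m :: nat assume "2 \<le> m"
      then show "0 \<le> 1 / ln (real (?a + m)) - 1 / ln (real (?a + k div 2 + m))"
        using inv_ln_antimono[of "?a + m" "?a + k div 2 + m"] by simp
    qed simp
    ultimately show ?thesis by simp
  qed
qed

text \<open>With x = j k + m and h = k div 2 a pair gains 1 / ln x - 1 / ln(x + h) = ln(1 + h / x) /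
  (ln x ln(x + h)); the bounds h \<ge> k / 3 and x + h \<le> (j + 1) k turn this into the given
  quotient.\<close>

lemma sign_count_full_block_ge:
  assumes k: "k > 2" and E: "\<And>n. n \<le> N \<Longrightarrow> \<bar>prime_error n\<bar> \<le> E" and N: "j * k + k \<le> N"
  shows "sign_count k (j * k) (j * k + k) \<ge>
     (real k / 2 - 2) * (ln (1 + 1 / (3 * (real j + 1))) / ln ((real j + 1) * real k) ^ 2) - (4 + 4 * E)"
proof -
  define \<delta> where "\<delta> = ln (1 + 1 / (3 * (real j + 1))) / ln ((real j + 1) * real k) ^ 2"
  let ?a = "j * k"
  have err: "prime_pi n - prime_pi m \<ge> inv_ln_sum n - inv_ln_sum m - 2 * E" 
    "prime_pi n - prime_pi m \<le> inv_ln_sum n - inv_ln_sum m + 2 * E" if "m \<le> N" "n \<le> N" for m n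
    using E[OF that(1)] E[OF that(2)] by (simp_all add: prime_pi_eq abs_le_iff)
  have 1: "sign_count k ?a (?a + k div 2) = 1 * (prime_pi (?a + k div 2) - prime_pi ?a)"
    by (rule sign_count_const) (use half_sign_first[OF k] in auto)
  have 2: "sign_count k (?a + k div 2) (?a + k) = - 1 * (prime_pi (?a + k) - prime_pi (?a + k div 2))"
    by (rule sign_count_const) (use half_sign_second[OF k] in auto)
  have "sign_count k ?a (?a + k) = sign_count k ?a (?a + k div 2) + sign_count k (?a + k div 2) (?a + k)"
    by (rule sign_count_split) auto
  also have "\<dots> \<ge> (inv_ln_sum (?a + k div 2) - inv_ln_sum ?a) - (inv_ln_sum (?a + k) - inv_ln_sum (?a + k div 2)) - 4 * E"
    unfolding 1 2 using err(1)[of ?a "?a + k div 2"] err(2)[of "?a + k div 2" "?a + k"] N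
      order_trans[OF add_left_mono[OF div_le_dividend] N] by simp
  finally have main: "sign_count k ?a (?a + k) \<ge> (inv_ln_sum (?a + k div 2) - inv_ln_sum ?a) - (inv_ln_sum (?a + k) - inv_ln_sum (?a + k div 2)) - 4 * E" .
  have "(inv_ln_sum (?a + k div 2) - inv_ln_sum ?a) - (inv_ln_sum (?a + k) - inv_ln_sum (?a + k div 2)) \<ge> (real k / 2 - 2) * \<delta> - 4"
  proof (rule inv_ln_half_blocks[OF _ _ k])
    show "\<delta> \<ge> 0" unfolding \<delta>_def by (intro divide_nonneg_nonneg ln_ge_zero) auto
    fix m assume m: "2 \<le> m" "m \<le> k div 2"
    define x where "x = real (?a + m)"
    define h where "h = real (k div 2)"
    have h: "h \<ge> real k / 3"
    proof -
      have "k \<le> 3 * (k div 2)" using k by auto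
      then have "real k \<le> 3 * h" unfolding h_def by (metis of_nat_le_iff of_nat_mult of_nat_numeral)
      then show ?thesis by simp
    qed
    have x2: "x \<ge> 2"
    proof -
      have "x = real (j * k) + real m" by (simp add: x_def)
      moreover have "real m \<ge> 2" using m by simp
      ultimately show ?thesis using of_nat_0_le_iff[of "j * k"] by linarith
    qed
    have xh: "x + h \<le> (real j + 1) * real k"
    proof -
      have "?a + m + k div 2 \<le> (j + 1) * k" using m by (simp add: algebra_simps)
      then have "real (?a + m + k div 2) \<le> real ((j + 1) * k)" by (simp only: of_nat_le_iff)
      then show ?thesis by (simp add: x_def h_def algebra_simps)
    qed
    have h0: "h \<ge> 0" by (simp add: h_def)
    define Y where "Y = ln ((real j + 1) * real k)"
    have lx: "0 < ln x" "ln x \<le> ln (x + h)" "ln (x + h) \<le> Y"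
      using x2 h0 xh by (auto simp: Y_def)
    have "1 + 1 / (3 * (real j + 1)) \<le> 1 + h / x"
    proof -
      have "x \<le> (real j + 1) * real k" using xh h0 by linarith
      moreover have "1 / (3 * (real j + 1)) = (real k / 3) / ((real j + 1) * real k)" using k by simp
      ultimately have "1 / (3 * (real j + 1)) \<le> h / x" using h x2 by (simp only:) (intro frac_le, auto)
      then show ?thesis by simp
    qed
    also have "1 + h / x = (x + h) / x" using x2 by (simp add: field_simps)
    finally have "ln (1 + 1 / (3 * (real j + 1))) \<le> ln ((x + h) / x)"
      by (subst ln_le_cancel_iff) (use x2 h0 in \<open>auto intro: add_pos_nonneg\<close>)
    also have "\<dots> = ln (x + h) - ln x" using x2 h0 by (simp add: ln_div)
    finally have "\<delta> \<le> (ln (x + h) - ln x) / Y ^ 2" unfolding \<delta>_def Y_def by (intro divide_right_mono) auto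
    also have "\<dots> \<le> (ln (x + h) - ln x) / (ln x * ln (x + h))"
      unfolding power2_eq_square using lx by (intro divide_left_mono mult_mono mult_pos_pos) auto
    also have "\<dots> = 1 / ln x - 1 / ln (x + h)" using lx by (simp add: field_simps)
    finally show "\<delta> \<le> 1 / ln (real (?a + m)) - 1 / ln (real (?a + k div 2 + m))"
      by (simp add: x_def h_def algebra_simps)
  qed
  with main show ?thesis by (simp add: \<delta>_def)
qed

text \<open>Only block l is credited with its gain; every block, including the incomplete last one,
  is charged the possible loss 4 + 4 E. There are at most N div k + 1 blocks.\<close>

lemma sign_count_ge:
  assumes k: "k > 2" and E: "\<And>n. n \<le> N \<Longrightarrow> \<bar>prime_error n\<bar> \<le> E" and N: "l * k + k \<le> N"
  shows "sign_count k (l * k) N \<ge>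
     (real k / 2 - 2) * (ln (1 + 1 / (3 * (real l + 1))) / ln ((real l + 1) * real k) ^ 2) -
     (4 + 4 * E) * (real (N div k) + 1)"
proof -
  define D where "D = (real k / 2 - 2) * (ln (1 + 1 / (3 * (real l + 1))) / ln ((real l + 1) * real k) ^ 2)"
  have E0: "E \<ge> 0" using E[of 0] by (meson abs_ge_zero order_trans le0)
  have step: "sign_count k (l * k) (J * k) \<ge> D - (4 + 4 * E) * real J" if "Suc l \<le> J" "J * k \<le> N" for J
    using that
  proof (induction J rule: nat_induct_at_least)
    case base
    have "sign_count k (l * k) (l * k + k) \<ge> D - (4 + 4 * E)"
      unfolding D_def by (rule sign_count_full_block_ge[OF k E]) (use base in \<open>auto simp: algebra_simps\<close>)
    moreover have "(4 + 4 * E) * 1 \<le> (4 + 4 * E) * real (Suc l)" using E0 by (intro mult_left_mono) auto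
    ultimately show ?case by (simp add: algebra_simps)
  next
    case (Suc J)
    have "l * k \<le> J * k" using Suc by (intro mult_le_mono1) auto
    then have "sign_count k (l * k) (Suc J * k) = sign_count k (l * k) (J * k) + sign_count k (J * k) (J * k + k)"
      by (subst sign_count_split[of _ "J * k"]) (auto simp: algebra_simps)
    moreover have "sign_count k (J * k) (J * k + k) \<ge> - (4 + 4 * E)"
      by (rule sign_count_block_ge[OF k E]) (use Suc in \<open>auto simp: algebra_simps\<close>)
    moreover have "sign_count k (l * k) (J * k) \<ge> D - (4 + 4 * E) * real J" using Suc by simp
    ultimately show ?case by (simp add: algebra_simps)
  qed
  define J where "J = N div k"
  have N_eq: "J * k + N mod k = N" by (simp add: J_def)
  have JN: "J * k \<le> N" by (simp add: J_def)
  have "Suc l \<le> J" unfolding J_def using N k by (simp add: less_eq_div_iff_mult_less_eq algebra_simps)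
  then have lJ: "l * k \<le> J * k" by (intro mult_le_mono1) auto
  have "sign_count k (l * k) N = sign_count k (l * k) (J * k) + sign_count k (J * k) N"
    by (rule sign_count_split[OF lJ JN])
  moreover have "sign_count k (l * k) (J * k) \<ge> D - (4 + 4 * E) * real J"
    by (rule step) (use \<open>Suc l \<le> J\<close> JN in auto)
  moreover have "sign_count k (J * k) (J * k + N mod k) \<ge> - (4 + 4 * E)"
    by (rule sign_count_block_ge[OF k E]) (use k in \<open>auto simp: J_def intro: less_imp_le\<close>)
  then have "sign_count k (J * k) N \<ge> - (4 + 4 * E)" unfolding N_eq .
  ultimately have "sign_count k (l * k) N \<ge> D - (4 + 4 * E) * real J - (4 + 4 * E)" by linarith
  then show ?thesis unfolding D_def J_def by (simp add: algebra_simps)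
qed

text \<open>Moving the left end from \<alpha> to a changes the set by at most |\<alpha> - a| + 1
  primes, each of weight 1 or -1. The summand 1 stems from the closed end at \<alpha> against the
  open one at a.\<close>

lemma sum_primes_between_ge:
  "(\<Sum>p\<in>primes_between \<alpha> \<beta>. half_sign k p) \<ge> sign_count k a \<beta> - (\<bar>real \<alpha> - real a\<bar> + 1)"
proof -
  define M where "M = primes_between \<alpha> \<beta>"
  define M' where "M' = {p. prime p \<and> a < p \<and> p \<le> \<beta>}"
  have fin: "finite M" "finite M'" unfolding M_def M'_def primes_between_def
    by (rule finite_subset[of _ "{..\<beta>}"]; auto)+
  have s: "\<bar>half_sign k p\<bar> = 1" for p by (simp add: half_sign_def)
  have M: "(\<Sum>p\<in>M. half_sign k p) = (\<Sum>p\<in>M \<inter> M'. half_sign k p) + (\<Sum>p\<in>M - M'. half_sign k p)"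
    by (rule sum.Int_Diff[OF fin(1)])
  have M': "(\<Sum>p\<in>M'. half_sign k p) = (\<Sum>p\<in>M \<inter> M'. half_sign k p) + (\<Sum>p\<in>M' - M. half_sign k p)"
    by (subst sum.Int_Diff[OF fin(2), of _ M]) (simp add: Int_commute)
  have b: "\<bar>\<Sum>p\<in>A. half_sign k p\<bar> \<le> real (card A)" for A
    using sum_abs[of "half_sign k" A] by (simp add: s)
  have "real (card (M - M')) + real (card (M' - M)) \<le> \<bar>real \<alpha> - real a\<bar> + 1"
  proof (cases "\<alpha> \<le> a")
    case True
    have "card (M - M') \<le> card {\<alpha>..a}" by (intro card_mono) (auto simp: M_def M'_def primes_between_def)
    moreover have "card (M' - M) = 0" using True by (auto simp: M_def M'_def primes_between_def card_eq_0_iff)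
    ultimately show ?thesis using True by (simp add: of_nat_diff)
  next
    case False
    have "card (M' - M) \<le> card {a<..<\<alpha>}" by (intro card_mono) (auto simp: M_def M'_def primes_between_def)
    moreover have "card (M - M') = 0" using False by (auto simp: M_def M'_def primes_between_def card_eq_0_iff)
    ultimately show ?thesis using False by (simp add: of_nat_diff)
  qed
  then show ?thesis using b[of "M - M'"] b[of "M' - M"] M M'
    unfolding sign_count_def M_def[symmetric] M'_def[symmetric] by linarith
qed

section \<open>The main theorem\<close>

text \<open>The prime number theorem gives three primes q with q^2 in the given range. They cannot
  all divide k: each exceeds sqrt k / 2, so their product exceeds k^(3/2) / 8, which is at least k
  for k \<ge> 64. The range keeps q^2 at least k / 4 away from the left end of block l and k / 2
  from the right end.\<close>

lemma prime_square_in_block: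
  "\<forall>\<^sub>F k in sequentially. \<exists>q. prime q \<and> \<not> q dvd k \<and> (4 * l + 1) * k < 4 * q ^ 2 \<and> 4 * q ^ 2 \<le> (4 * l + 2) * k"
proof -
  obtain C where C: "C > 0" "\<And>n N. N \<ge> 2 \<Longrightarrow> n \<le> N \<Longrightarrow> \<bar>prime_error n\<bar> \<le> C * real N / ln (real N) ^ 2"
    using prime_number_theorem_log_saving[of 2] by blast
  define u where "u = (4 * real l + 1) / 4"
  define v where "v = (4 * real l + 2) / 4"
  have uv: "u > 0" "v > 0" "u < v" by (auto simp: u_def v_def)
  \<comment> \<open>The ratio of the end points sqrt (u k) and sqrt (v k) of the interval for q. It
    does not depend on k, so the interval has the fixed relative length c.\<close>
  define \<theta> where "\<theta> = sqrt (u / v)"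
  have \<theta>: "0 \<le> \<theta>" "\<theta> < 1" using uv by (auto simp: \<theta>_def)
  define c where "c = 1 - \<theta>"
  have c: "c > 0" using \<theta> by (simp add: c_def)
  define N where "N k = nat \<lfloor>sqrt (v * real k)\<rfloor>" for k
  have "\<forall>\<^sub>F n in sequentially. (c * real n - 1) / ln (real n) - 2 * (C * real n / ln (real n) ^ 2) \<ge> 3"
    using c C(1) by real_asymp
  then have ev: "\<forall>\<^sub>F n in sequentially. (c * real n - 1) / ln (real n) - 2 * (C * real n / ln (real n) ^ 2) \<ge> 3 \<and> n \<ge> 2"
    using eventually_ge_at_top[of 2] by eventually_elim auto
  have "filterlim N at_top sequentially"
    unfolding filterlim_at_top
  proof
    fix Z :: nat
    have "filterlim (\<lambda>k. sqrt (v * real k)) at_top sequentially" using uv by real_asymp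
    then have "\<forall>\<^sub>F k in sequentially. real Z \<le> sqrt (v * real k)" by (simp add: filterlim_at_top)
    then show "\<forall>\<^sub>F k in sequentially. Z \<le> N k"
      by eventually_elim (unfold N_def, rule le_nat_floor)
  qed
  from eventually_compose_filterlim[OF ev this] eventually_ge_at_top[of 64]
  show ?thesis
  proof eventually_elim
    case (elim k)
    define a where "a = sqrt (u * real k)"
    define b where "b = sqrt (v * real k)"
    define n1 where "n1 = nat \<lfloor>a\<rfloor>"
    have k: "k \<ge> 64" using elim by simp
    have u: "u \<ge> 1/4" by (simp add: u_def)
    have a16: "a \<ge> sqrt 16" unfolding a_def 
      using mult_mono[of "1/4" u 64 "real k"] u k by (intro real_sqrt_le_mono) auto
    have a4: "a \<ge> 4" using a16 by simp
    have n1: "real n1 \<le> a" "a < real n1 + 1" "n1 \<ge> 1"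
      using a4 by (auto simp: n1_def le_nat_iff le_floor_iff)
    have Nk: "real (N k) \<le> b" "b < real (N k) + 1" using uv by (simp_all add: N_def b_def)
    have ab: "a = \<theta> * b" unfolding a_def b_def \<theta>_def using uv by (simp add: real_sqrt_mult[symmetric])
    have "a \<le> b" unfolding a_def b_def using uv by (intro real_sqrt_le_mono mult_right_mono) auto
    then have n1N: "n1 \<le> N k" unfolding n1_def N_def b_def by (intro nat_mono floor_mono)
    have diff: "real (N k) - real n1 \<ge> c * real (N k) - 1"
    proof -
      have "real n1 \<le> \<theta> * (real (N k) + 1)" using n1 Nk \<theta> unfolding ab by (smt (verit) mult_left_mono)
      then show ?thesis using \<theta> by (simp add: c_def algebra_simps)
    qed
    have l0: "ln (real (N k)) > 0" using elim by simp
    define Q where "Q = {p. prime p \<and> n1 < p \<and> p \<le> N k}"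
    have "(c * real (N k) - 1) / ln (real (N k)) \<le> (real (N k) - real n1) / ln (real (N k))"
      using diff l0 by (intro divide_right_mono) auto
    also have "\<dots> = real (card {n1<..N k}) * (1 / ln (real (N k)))" using n1N by (simp add: of_nat_diff)
    also have "\<dots> \<le> (\<Sum>m\<in>{n1<..N k}. 1 / ln (real m))"
      by (rule sum_bounded_below) (use n1 in \<open>auto intro!: inv_ln_antimono\<close>)
    also have "\<dots> = inv_ln_sum (N k) - inv_ln_sum n1" using inv_ln_sum_diff[OF n1N] by simp
    also have "\<dots> \<le> prime_pi (N k) - prime_pi n1 + 2 * (C * real (N k) / ln (real (N k)) ^ 2)"
      using C(2)[of "N k" "N k"] C(2)[of "N k" n1] elim n1N by (simp add: prime_pi_eq abs_le_iff)
    also have "prime_pi (N k) - prime_pi n1 = real (card Q)"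
      unfolding Q_def by (rule card_primes_Ioc[OF n1N, symmetric])
    finally have "real (card Q) \<ge> 3" using elim by linarith
    then have "3 \<le> card Q" by simp
    then obtain T where T: "T \<subseteq> Q" "card T = 3" using obtain_subset_with_card_n by metis
    have Q: "(4 * l + 1) * k < 4 * q ^ 2" "4 * q ^ 2 \<le> (4 * l + 2) * k" "prime q" if "q \<in> Q" for q
    proof -
      have "a < real q" "real q \<le> b" using that n1 Nk by (auto simp: Q_def)
      then have "a ^ 2 < real q ^ 2" "real q ^ 2 \<le> b ^ 2"
        using a4 by (auto intro: power_strict_mono power_mono)
      then have "u * real k < real q ^ 2" "real q ^ 2 \<le> v * real k"
        using uv by (auto simp: a_def b_def)
      then have "real ((4 * l + 1) * k) < real (4 * q ^ 2)" "real (4 * q ^ 2) \<le> real ((4 * l + 2) * k)"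
        by (auto simp: u_def v_def field_simps)
      then show "(4 * l + 1) * k < 4 * q ^ 2" "4 * q ^ 2 \<le> (4 * l + 2) * k"
        by (simp_all only: of_nat_less_iff of_nat_le_iff)
      show "prime q" using that by (simp add: Q_def)
    qed
    have "\<exists>q\<in>T. \<not> q dvd k"
    proof (rule ccontr)
      assume all: "\<not> (\<exists>q\<in>T. \<not> q dvd k)"
      obtain x y z where xyz: "T = {x, y, z}" "x \<noteq> y" "y \<noteq> z" "x \<noteq> z"
        using T(2) by (auto simp: card_3_iff)
      have pr: "prime x" "prime y" "prime z" and big: "k < 4 * x ^ 2" "k < 4 * y ^ 2" "k < 4 * z ^ 2"
        using xyz T(1) Q by force+
      have "coprime x y" "coprime x z" "coprime y z" using pr xyz by (auto intro: primes_coprime)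
      moreover have "x dvd k" "y dvd k" "z dvd k" using all xyz by auto
      ultimately have "x * y * z dvd k" by (intro divides_mult) auto
      then have le: "x * y * z \<le> k" using k by (intro dvd_imp_le) auto
      have "64 * k ^ 2 \<le> k * k * k" using k by (simp add: power2_eq_square)
      also have "\<dots> < (4 * x ^ 2) * (4 * y ^ 2) * (4 * z ^ 2)"
        using big k pr[THEN prime_gt_0_nat] by (intro mult_strict_mono) auto
      also have "\<dots> = 64 * (x * y * z) ^ 2" by (simp add: power_mult_distrib)
      also have "\<dots> \<le> 64 * k ^ 2" using le by (intro mult_le_mono power_mono) auto
      finally show False by simp
    qed
    then show ?case using T(1) Q by blast
  qed
qed

text \<open>If \<beta> < (l + 1) k, then every p in [\<alpha>, \<beta>] differs from q^2 by less
  than k, as \<alpha> > (l - 1/4) k and q^2 lies in the second quarter of block l. The class of q^2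
  then has no candidate but q^2, which is not prime, although this class is coprime to k and must
  contain \<gamma> > 0 primes.\<close>

lemma P_integer_not_short:
  assumes P: "P_integer \<alpha> \<beta> \<gamma> \<iota> k" and \<gamma>: "\<gamma> > 0" and \<alpha>: "4 * (l * k) < 4 * \<alpha> + k"
    and q: "prime q" "\<not> q dvd k" "(4 * l + 1) * k < 4 * q ^ 2" "4 * q ^ 2 \<le> (4 * l + 2) * k"
  shows "l * k + k \<le> \<beta>"
proof (rule ccontr)
  assume \<beta>: "\<not> l * k + k \<le> \<beta>"
  define r where "r = q ^ 2 - l * k"
  have r: "q ^ 2 = l * k + r" using q(3) by (simp add: r_def algebra_simps)
  have "coprime (q ^ 2) k" using prime_imp_coprime[OF q(1,2)] by simp
  then have "gcd k (l * k + r) = 1" unfolding r by (subst gcd.commute) (rule coprime_imp_gcd_eq_1)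
  then have "gcd r k = 1" unfolding gcd_add_mult by (subst gcd.commute)
  then have "coprime r k" by (simp only: coprime_iff_gcd_eq_1)
  then have "\<gamma> \<le> card {p \<in> primes_between \<alpha> \<beta>. [p = r] (mod k)}" using P by (simp add: P_integer_def)
  with \<gamma> have "card {p \<in> primes_between \<alpha> \<beta>. [p = r] (mod k)} \<noteq> 0" by linarith
  then have "{p \<in> primes_between \<alpha> \<beta>. [p = r] (mod k)} \<noteq> {}" by (metis card.empty)
  then obtain p where p: "prime p" "\<alpha> \<le> p" "p \<le> \<beta>" "[p = r] (mod k)" by (auto simp: primes_between_def)
  have mod: "p mod k = q ^ 2 mod k" using p(4) by (simp add: unique_euclidean_semiring_class.cong_def r)
  have d1: "q ^ 2 - p < k" "p - q ^ 2 < k"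
    using q(3,4) p \<alpha> \<beta> by (auto simp: algebra_simps)
  have "p = q ^ 2"
  proof (cases "p \<le> q ^ 2")
    case True
    then have "k dvd q ^ 2 - p" using mod by (simp add: mod_eq_dvd_iff_nat[symmetric])
    then have "q ^ 2 - p = 0" using d1(1) by (meson dvd_imp_le not_le neq0_conv)
    then show ?thesis using True by simp
  next
    case False
    then have "k dvd p - q ^ 2" using mod by (simp add: mod_eq_dvd_iff_nat[symmetric])
    then have "p - q ^ 2 = 0" using d1(2) by (meson dvd_imp_le not_le neq0_conv)
    then show ?thesis using False by simp
  qed
  then show False using p(1) by (simp add: prime_power_iff)
qed

text \<open>After division by k / log^2 k every term on the left tends to 0, while the right side
  tends to c / 2; c / 4 separates them. The largest term on the left is the product of B k log^(-d3
  - 3) k and C log^d3 k, of order k / log^3 k.\<close>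

lemma eventually_main_inequality:
  fixes B C c d1 d2 d3 m :: real
  assumes "B > 0" "C > 0" "c > 0" "d1 > 0" "d2 > 0" "d3 > 0" "m \<ge> 1"
  shows "\<forall>\<^sub>F k in sequentially. 
    (4 + 4 * (B * real k * ln (real k) powr (- d3 - 3))) * (C * ln (real k) powr d3 + 1) +
      (C * real k powr (1 - d1) + 1) + C * real k powr (1 - d2) <
    (real k / 2 - 2) * (c / ln (m * real k) ^ 2)"
proof -
  define w where "w k = real k / ln (real k) ^ 2" for k :: nat
  have w: "\<forall>\<^sub>F k in sequentially. w k > 0" unfolding w_def by real_asymp
  have 1: "(\<lambda>k. 4 * (C * ln (real k) powr d3 + 1) / w k) \<longlonglongrightarrow> 0"
    unfolding w_def using assms by real_asymp
  have 2: "(\<lambda>k. 4 * (B * real k * ln (real k) powr (- d3 - 3)) * (C * ln (real k) powr d3) / w k) \<longlonglongrightarrow> 0"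
    unfolding w_def using assms by real_asymp
  have 3: "(\<lambda>k. 4 * (B * real k * ln (real k) powr (- d3 - 3)) / w k) \<longlonglongrightarrow> 0"
    unfolding w_def using assms by real_asymp
  have 4: "(\<lambda>k. C * real k powr (1 - d1) / w k) \<longlonglongrightarrow> 0"
    unfolding w_def using assms by real_asymp
  have 5: "(\<lambda>k. C * real k powr (1 - d2) / w k) \<longlonglongrightarrow> 0"
    unfolding w_def using assms by real_asymp
  have 6: "(\<lambda>k. 1 / w k) \<longlonglongrightarrow> 0" unfolding w_def by real_asymp
  have 7: "(\<lambda>k. (real k / 2 - 2) * (c / ln (m * real k) ^ 2) / w k) \<longlonglongrightarrow> c / 2"
    unfolding w_def using assms by real_asymp
  have sum: "(\<lambda>k. 4 * (C * ln (real k) powr d3 + 1) / w k + 4 * (B * real k * ln (real k) powr (- d3 - 3)) * (C * ln (real k) powr d3) / w k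
      + 4 * (B * real k * ln (real k) powr (- d3 - 3)) / w k + C * real k powr (1 - d1) / w k + C * real k powr (1 - d2) / w k + 1 / w k)
      \<longlonglongrightarrow> 0 + 0 + 0 + 0 + 0 + 0"
    by (intro tendsto_add 1 2 3 4 5 6)
  have "0 < c / 4" "c / 4 < c / 2" using assms by auto
  with order_tendstoD(2)[OF sum, of "c / 4"] order_tendstoD(1)[OF 7, of "c / 4"] w
  have "\<forall>\<^sub>F k in sequentially. 4 * (C * ln (real k) powr d3 + 1) / w k + 4 * (B * real k * ln (real k) powr (- d3 - 3)) * (C * ln (real k) powr d3) / w k
      + 4 * (B * real k * ln (real k) powr (- d3 - 3)) / w k + C * real k powr (1 - d1) / w k + C * real k powr (1 - d2) / w k + 1 / w k < c / 4 
      \<and> c / 4 < (real k / 2 - 2) * (c / ln (m * real k) ^ 2) / w k \<and> w k > 0"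
    by (intro eventually_conj) auto
  then show ?thesis
  proof eventually_elim
    case (elim k)
    define X where "X = (4 + 4 * (B * real k * ln (real k) powr (- d3 - 3))) * (C * ln (real k) powr d3 + 1) +
      (C * real k powr (1 - d1) + 1) + C * real k powr (1 - d2)"
    have "X / w k = 4 * (C * ln (real k) powr d3 + 1) / w k + 4 * (B * real k * ln (real k) powr (- d3 - 3)) * (C * ln (real k) powr d3) / w k
      + 4 * (B * real k * ln (real k) powr (- d3 - 3)) / w k + C * real k powr (1 - d1) / w k + C * real k powr (1 - d2) / w k + 1 / w k"
      by (simp only: X_def add_divide_distrib[symmetric]) (simp add: algebra_simps)
    then have "X / w k < (real k / 2 - 2) * (c / ln (m * real k) ^ 2) / w k" using elim by linarith
    then show ?case using elim divide_less_cancel[of X "w k"] unfolding X_def by blast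
  qed
qed

theorem theorem2:
  fixes l :: nat and d1 d2 d3 C :: real
  assumes "d1 > 0" and "d2 > 0" and "d3 > 0" and "C > 0"
  shows "finite {k :: nat. k \<ge> 2 \<and>
    (\<exists>\<alpha> \<beta> \<gamma> \<iota> :: nat. \<alpha> > 0 \<and> \<beta> > 0 \<and> \<gamma> > 0 \<and> \<iota> > 0 \<and>
       \<bar>real \<alpha> - real l * real k\<bar> \<le> C * real k powr (1 - d1) \<and>
       real \<iota> \<le> C * real k powr (1 - d2) \<and>
       real \<beta> \<le> C * real k * ln (real k) powr d3 \<and>
       P_integer \<alpha> \<beta> \<gamma> \<iota> k)}"
    (is "finite ?S")
proof -
  \<comment> \<open>With \<beta> = O(k log^d3 k) the error per block is O(k log^(d3 - A) k), and
    there are O(log^d3 k) blocks; A \<ge> 2 d3 + 3 makes the total O(k / log^3 k), below the gain of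
    order k / log^2 k.\<close>
  define A where "A = nat \<lceil>2 * d3\<rceil> + 3"
  have A: "real A \<ge> 2 * d3 + 3" using assms by (simp add: A_def)
  obtain C0 where C0: "C0 > 0" "\<And>n N. N \<ge> 2 \<Longrightarrow> n \<le> N \<Longrightarrow> \<bar>prime_error n\<bar> \<le> C0 * real N / ln (real N) ^ A"
    using prime_number_theorem_log_saving[of A] by blast
  define c where "c = ln (1 + 1 / (3 * (real l + 1)))"
  have c: "c > 0" unfolding c_def by (intro ln_gt_zero) auto
  have ineq: "\<forall>\<^sub>F k in sequentially. 
    (4 + 4 * ((C0 * C) * real k * ln (real k) powr (- d3 - 3))) * (C * ln (real k) powr d3 + 1) +
      (C * real k powr (1 - d1) + 1) + C * real k powr (1 - d2) <
    (real k / 2 - 2) * (c / ln ((real l + 1) * real k) ^ 2)"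
    by (rule eventually_main_inequality) (use assms C0 c in auto)
  \<comment> \<open>Keeps \<alpha> above l k - k / 4, as the exclusion of short intervals
    requires.\<close>
  have small: "\<forall>\<^sub>F k in sequentially. C * real k powr (1 - d1) < real k / 4"
    using assms(1,4) by real_asymp
  have "\<forall>\<^sub>F k in sequentially. k \<notin> ?S"
    using prime_square_in_block[of l] ineq small eventually_ge_at_top[of 3]
  proof eventually_elim
    case (elim k)
    show "k \<notin> ?S"
    proof
      assume "k \<in> ?S"
      then obtain \<alpha> \<beta> \<gamma> \<iota> :: nat where *: "\<gamma> > 0"
        "\<bar>real \<alpha> - real l * real k\<bar> \<le> C * real k powr (1 - d1)"
        "real \<iota> \<le> C * real k powr (1 - d2)" "real \<beta> \<le> C * real k * ln (real k) powr d3"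
        "P_integer \<alpha> \<beta> \<gamma> \<iota> k" by blast
      define L where "L = ln (real k)"
      have "exp 1 \<le> real k" using elim(4) exp_le by linarith
      then have L: "L \<ge> 1" unfolding L_def by (subst ln_ge_iff) (use elim(4) in auto)
      obtain q where q: "prime q" "\<not> q dvd k" "(4 * l + 1) * k < 4 * q ^ 2" "4 * q ^ 2 \<le> (4 * l + 2) * k"
        using elim(1) by blast
      have "\<bar>real \<alpha> - real l * real k\<bar> < real k / 4" using * elim(3) by linarith
      then have "4 * (real l * real k) < 4 * real \<alpha> + real k"
        using abs_ge_minus_self[of "real \<alpha> - real l * real k"] by linarith
      then have "real (4 * (l * k)) < real (4 * \<alpha> + k)" by simp
      then have "4 * (l * k) < 4 * \<alpha> + k" by (simp only: of_nat_less_iff)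
      from P_integer_not_short[OF *(5,1) this q] have \<beta>: "l * k + k \<le> \<beta>" .
      \<comment> \<open>Hence ln \<beta> \<ge> ln k, so the saving, a power of ln \<beta>, is at
        least the same power of ln k.\<close>
      have k\<beta>: "k \<le> \<beta>" using \<beta> by simp
      define E where "E = C0 * real \<beta> / ln (real \<beta>) ^ A"
      have E: "\<bar>prime_error n\<bar> \<le> E" if "n \<le> \<beta>" for n
        unfolding E_def using C0(2)[of \<beta> n] that k\<beta> elim(4) by simp
      have EB: "E \<le> (C0 * C) * real k * L powr (- d3 - 3)"
      proof -
        have "L \<le> ln (real \<beta>)" unfolding L_def using k\<beta> elim(4) by simp
        then have "L ^ A \<le> ln (real \<beta>) ^ A" using L by (intro power_mono) auto
        moreover have "L powr (2 * d3 + 3) \<le> L powr real A" using A L by (intro powr_mono)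
        moreover have "L powr real A = L ^ A" using L by (simp add: powr_realpow)
        ultimately have "L powr (2 * d3 + 3) \<le> ln (real \<beta>) ^ A" by linarith
        then have "E \<le> C0 * (C * real k * L powr d3) / L powr (2 * d3 + 3)"
          unfolding E_def using C0(1) *(4) L assms(4) by (intro frac_le mult_left_mono) (auto simp: L_def)
        also have "\<dots> = (C0 * C) * real k * (L powr d3 / L powr (2 * d3 + 3))" by simp
        also have "L powr d3 / L powr (2 * d3 + 3) = L powr (- d3 - 3)"
          by (simp add: powr_diff[symmetric])
        finally show ?thesis .
      qed
      have bk: "real (\<beta> div k) \<le> C * L powr d3"
      proof -
        have "real (\<beta> div k) \<le> real \<beta> / real k" by (rule of_nat_div_le_of_nat)
        also have "\<dots> \<le> C * L powr d3" using *(4) elim(4) by (simp add: divide_le_eq L_def mult_ac)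
        finally show ?thesis .
      qed
      have E0: "E \<ge> 0" using E[of 0] by (meson abs_ge_zero order_trans le0)
      have "(real k / 2 - 2) * (c / ln ((real l + 1) * real k) ^ 2) - (4 + 4 * E) * (real (\<beta> div k) + 1) \<le> sign_count k (l * k) \<beta>"
        unfolding c_def using elim(4) by (intro sign_count_ge[OF _ E \<beta>]) auto
      also have "\<dots> \<le> (\<Sum>p\<in>primes_between \<alpha> \<beta>. half_sign k p) + (\<bar>real \<alpha> - real (l * k)\<bar> + 1)"
        using sum_primes_between_ge[of k "l * k" \<beta> \<alpha>] by linarith
      also have "(\<Sum>p\<in>primes_between \<alpha> \<beta>. half_sign k p) \<le> real \<iota>"
        using elim(4) by (intro P_integer_half_sign_sum[OF *(5)]) auto
      finally have "(real k / 2 - 2) * (c / ln ((real l + 1) * real k) ^ 2) \<le>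
          (4 + 4 * E) * (real (\<beta> div k) + 1) + (C * real k powr (1 - d1) + 1) + C * real k powr (1 - d2)"
        using *(2,3) by simp
      also have "(4 + 4 * E) * (real (\<beta> div k) + 1) \<le> (4 + 4 * ((C0 * C) * real k * L powr (- d3 - 3))) * (C * L powr d3 + 1)"
        using EB bk E0 by (intro mult_mono) auto
      finally show False using elim(2) by (simp add: L_def)
    qed
  qed
  then obtain K where "\<And>k. k \<ge> K \<Longrightarrow> k \<notin> ?S" unfolding eventually_sequentially by blast
  then have "?S \<subseteq> {..<K}" by (meson lessThan_iff not_le subsetI)
  then show ?thesis by (rule finite_subset) simp
qed

end
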